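(* Let $\xi>0$ and let $F$ be a distribution function with $\bar F:=1-F\in RV_{-1/\xi}$. Let $k=k_n$ be a sequence of positive integers increasing to infinity with $k_n/n\to 0$, and suppose that $$\lim_{n\to\infty}\sqrt{k}\left(\frac nk\,\bar F\big(b(n/k)\,y^{-\xi}\big)-y\right)=0\quad\text{locally uniformly in } y\in(0,\infty).$$ Let $X_1,\dots,X_n$ be i.i.d. observations from $F$ with decreasing order statistics $X_{(1)}\ge X_{(2)}\ge\cdots\ge X_{(n)}$. Then, as $n\to\infty$ (so that $k\to\infty$ and $n/k\to\infty$), $$\mathcal{QN}_n:=\left\{\left(-\log\frac jk,\;-\xi\log\frac jk+\sqrt k\left(\log\frac{X_{(j)}}{X_{(k)}}+\xi\log\frac jk\right)\right):1\le j\le k\right\}$$ converges weakly, as a sequence of random closed sets in $\mathcal F$, to $$\mathcal{QN}:=\left\{\left(-\log t,\;-\xi\log t+\xi t^{-1}B(t)\right):0<t\le 1\right\},$$ where $B$ is a (standard) Brownian bridge on $[0,1]$ restricted to $(0,1]$.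
   Context: A function $U:(0,\infty)\to[0,\infty)$ is regularly varying with index $\rho\in\mathbb R$, written $U\in RV_\rho$, if $\lim_{t\to\infty}U(tx)/U(t)=x^\rho$ for all $x>0$. The quantile function is $b(u):=F^{\leftarrow}(1-1/u)=\inf\{s:F(s)\ge 1-1/u\}$. $\mathcal F$ denotes the collection of closed subsets of $\mathbb R^2$ with the Fell topology, i.e. the smallest topology containing all the families $\{C\in\mathcal F:C\cap K=\varnothing\}$ ($K$ compact) and $\{C\in\mathcal F: C\cap G\ne\varnothing\}$ ($G$ open). This topology is metrizable. A random closed set is a random element of $\mathcal F$ with its Borel $\sigma$-algebra, and weak convergence of random closed sets is weak convergence of the induced probability laws on $\mathcal F$. Under the hypotheses $X_{(k)}>0$ with probability tending to one, so the logarithms are well defined with probability tending to one. *)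

theory Defs
  imports "HOL-Probability.Probability"
begin

section \<open>Closed sets with the Fell topology, and weak convergence\<close>

definition fell_topology :: "'a::topological_space set topology" where
  "fell_topology = topology_generated_by
     ({{C. closed C \<and> C \<inter> K = {}} | K. compact K} \<union>
      {{C. closed C \<and> C \<inter> G \<noteq> {}} | G. open G})"

lemma topspace_fell_topology: "topspace fell_topology = {C. closed C}"
proof
  show "topspace fell_topology \<subseteq> {C :: 'a set. closed C}"
    by (auto simp: fell_topology_def)
  have "{C :: 'a set. closed C \<and> C \<inter> {} = {}} \<subseteq> topspace fell_topology"
    unfolding fell_topology_def topology_generated_by_topspace
    by (intro Union_upper UnI1 CollectI exI[of _ "{}"] conjI refl compact_empty)
  then show "{C :: 'a set. closed C} \<subseteq> topspace fell_topology"
    by simp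
qed

definition borel_measure_of :: "'a topology \<Rightarrow> 'a measure" where
  "borel_measure_of T = sigma (topspace T) {U. openin T U}"

definition weak_conv_law :: "'a topology \<Rightarrow> (nat \<Rightarrow> 'a measure) \<Rightarrow> 'a measure \<Rightarrow> bool" where
  "weak_conv_law T \<mu> \<nu> \<longleftrightarrow>
     (\<forall>f. continuous_map T euclideanreal f \<and> bounded (f ` topspace T) \<longrightarrow>
        (\<lambda>n. \<integral>C. f C \<partial>\<mu> n) \<longlonglongrightarrow> (\<integral>C. f C \<partial>\<nu>))"

definition random_closed_set :: "'w measure \<Rightarrow> ('w \<Rightarrow> 'a::topological_space set) \<Rightarrow> bool" where
  "random_closed_set M Z \<longleftrightarrow> Z \<in> measurable M (borel_measure_of fell_topology)"

definition rcs_converges_weakly ::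
  "'v measure \<Rightarrow> (nat \<Rightarrow> 'v \<Rightarrow> 'a::topological_space set) \<Rightarrow>
   'w measure \<Rightarrow> ('w \<Rightarrow> 'a set) \<Rightarrow> bool" where
  "rcs_converges_weakly M Z N Z' \<longleftrightarrow>
     (\<forall>n. random_closed_set M (Z n)) \<and> random_closed_set N Z' \<and>
     weak_conv_law fell_topology
       (\<lambda>n. distr M (borel_measure_of fell_topology) (Z n))
       (distr N (borel_measure_of fell_topology) Z')"


section \<open>Brownian bridge\<close>

text \<open>Degenerate normal laws (standard deviation 0) are point masses; they have to be admitted
  in the definition of a Gaussian process.\<close>

definition normal_law :: "real \<Rightarrow> real \<Rightarrow> real measure" where
  "normal_law m \<sigma> =
     (if \<sigma> = 0 then return borel m else density lborel (\<lambda>x. ennreal (normal_density m \<sigma> x)))"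

definition gaussian_process :: "'w measure \<Rightarrow> real set \<Rightarrow> (real \<Rightarrow> 'w \<Rightarrow> real) \<Rightarrow> bool" where
  "gaussian_process N T B \<longleftrightarrow>
     (\<forall>t\<in>T. B t \<in> borel_measurable N) \<and>
     (\<forall>J a. finite J \<and> J \<subseteq> T \<longrightarrow>
        (\<exists>m \<sigma>. \<sigma> \<ge> 0 \<and> distr N borel (\<lambda>\<omega>. \<Sum>t\<in>J. a t * B t \<omega>) = normal_law m \<sigma>))"

definition brownian_bridge :: "'w measure \<Rightarrow> (real \<Rightarrow> 'w \<Rightarrow> real) \<Rightarrow> bool" where
  "brownian_bridge N B \<longleftrightarrow>
     prob_space N \<and>
     gaussian_process N {0..1} B \<and>
     (\<forall>t\<in>{0..1}. (\<integral>\<omega>. B t \<omega> \<partial>N) = 0) \<and>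
     (\<forall>s\<in>{0..1}. \<forall>t\<in>{0..1}. (\<integral>\<omega>. B s \<omega> * B t \<omega> \<partial>N) = min s t - s * t) \<and>
     (\<forall>\<omega>\<in>space N. continuous_on {0..1} (\<lambda>t. B t \<omega>))"


section \<open>Regular variation, quantiles, order statistics\<close>

definition regularly_varying :: "real \<Rightarrow> (real \<Rightarrow> real) \<Rightarrow> bool" where
  "regularly_varying \<rho> U \<longleftrightarrow>
     (\<forall>t>0. U t \<ge> 0) \<and>
     (\<forall>x>0. ((\<lambda>t. U (t * x) / U t) \<longlongrightarrow> x powr \<rho>) at_top)"

definition quantile_fun :: "(real \<Rightarrow> real) \<Rightarrow> real \<Rightarrow> real" where
  "quantile_fun F u = Inf {s. F s \<ge> 1 - 1 / u}"

text \<open>The \<open>j\<close>-th largest (\<open>1 \<le> j \<le> n\<close>) of \<open>X 1, \<dots>, X n\<close>.\<close>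

definition desc_order_stat :: "(nat \<Rightarrow> 'w \<Rightarrow> real) \<Rightarrow> nat \<Rightarrow> nat \<Rightarrow> 'w \<Rightarrow> real" where
  "desc_order_stat X n j \<omega> = rev (sort (map (\<lambda>i. X i \<omega>) [1..<Suc n])) ! (j - 1)"


section \<open>The normalised QQ plot and its limit\<close>

text \<open>Where the \<open>k\<close>-th largest observation is not positive the logarithm takes an arbitrary value;
  under the hypotheses of the theorem the probability of this event tends to zero, so that the
  value is irrelevant for weak limits. The same holds for the finitely many \<open>n\<close> with \<open>n < k n\<close>.\<close>

definition QN_seq ::
  "real \<Rightarrow> (nat \<Rightarrow> nat) \<Rightarrow> (nat \<Rightarrow> 'w \<Rightarrow> real) \<Rightarrow> nat \<Rightarrow> 'w \<Rightarrow> (real \<times> real) set" where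
  "QN_seq \<xi> k X n \<omega> =
     {(- ln (real j / real (k n)),
       - \<xi> * ln (real j / real (k n)) +
         sqrt (real (k n)) *
           (ln (desc_order_stat X n j \<omega> / desc_order_stat X n (k n) \<omega>) +
            \<xi> * ln (real j / real (k n)))) | j. 1 \<le> j \<and> j \<le> k n}"

definition QN_limit :: "real \<Rightarrow> (real \<Rightarrow> 'w \<Rightarrow> real) \<Rightarrow> 'w \<Rightarrow> (real \<times> real) set" where
  "QN_limit \<xi> B \<omega> =
     {(- ln t, - \<xi> * ln t + \<xi> * inverse t * B t \<omega>) | t. 0 < t \<and> t \<le> 1}"

end

(*
  Everything is read off the tail empirical process
    alpha_n(y) = sqrt k (#{i <= n. X_i > b(n/k) y^(-xi)} / k - y).
  Its characteristic functions converge by a triangular central limit theorem, and it is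
  asymptotically equicontinuous by chaining over a dyadic grid with fourth moments, the counts being
  monotone in y. Since X_(j) exceeds a threshold iff at least j observations do, inversion gives
    sqrt k (log (X_(j) / X_(k)) + xi log t) ~ xi (alpha_n(t) / t - alpha_n(1)),   t = j/k,
  uniformly for t bounded away from 0; the limit law of the right-hand side is that of xi B(t) / t.

  The Fell topology is compact, so a continuous functional is uniformly continuous for the relation
  "every point of one set in a large ball is near a point of the other". Both random sets may thus be
  replaced by finite skeletons, which depend continuously on finitely many coordinates, and for these
  a multivariate Levy continuity theorem applies. The latter follows from Stone-Weierstrass.
*)

theory Submission
  imports Defs
begin

section \<open>The Fell topology\<close>

text \<open>The obstacle is the range t -> 0, where the expansion of the order statistics is not
  uniform. The Fell topology sees only bounded windows: a point of norm at most R has - ln t \<le>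
  R, so only t \<ge> exp (- R) matters. Fourth moments rather than variances drive the chaining: an
  increment over length d has variance of order d, which a union bound over 1/d blocks cannot beat,
  while its fourth moment is of order d^2 as soon as d is at least of order 1/k. The term -
  alpha_n(1) arises because the plot is normalised by X_(k), itself an order statistic, and not by
  b(n/k). It turns the Brownian limit W of alpha_n into (W(t) - t W(1)) / t, and W(t) - t W(1) is a
  Brownian bridge. The limits are taken in a fixed order: n -> infinity for a skeleton with a fixed
  number of points, where only finite-dimensional laws enter, then refinement of the skeleton. This
  is legitimate because QN_n is close to its skeleton outside an event whose probability is small
  for all large n.\<close>

lemma topology_generated_by_subbase:
  "topology_generated_by S =
     topology (arbitrary union_of (finite intersection_of (\<lambda>x. x \<in> S) relative_to \<Union>S))"
  (is "?T = ?T'")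
proof -
  \<comment> \<open>Both sides are the coarsest topology in which the members of \<open>S\<close>
    are open; minimality is applied once in each direction. Alexander's subbase theorem refers to
    the explicit form.\<close>
  have "openin ?T' = openin ?T"
  proof (intro ext iffI)
    fix U assume "openin ?T' U"
    then show "openin ?T U"
    proof (rule minimal_topology_subbase[rotated 2])
      show "openin ?T (\<Union>S)"
        by (metis topology_generated_by_topspace openin_topspace)
    qed (auto intro: topology_generated_by_Basis)
  next
    fix U assume "openin ?T U"
    then have "generate_topology_on S U"
      by (rule openin_topology_generated_by)
    then show "openin ?T' U"
    proof (rule generate_topology_on_coarsest[rotated 2])
      fix s assume "s \<in> S"
      then show "openin ?T' s"
        by (simp add: openin_subbase)
           (metis Union_upper arbitrary_union_of_inc finite_intersection_of_inc inf.absorb2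
               relative_to_inc)
    qed simp
  qed
  then show ?thesis by (simp add: topology_eq)
qed

lemma openin_fell_miss: "compact K \<Longrightarrow> openin fell_topology {C. closed C \<and> C \<inter> K = {}}"
  unfolding fell_topology_def by (rule topology_generated_by_Basis) auto

lemma openin_fell_hit: "open G \<Longrightarrow> openin fell_topology {C. closed C \<and> C \<inter> G \<noteq> {}}"
  unfolding fell_topology_def by (rule topology_generated_by_Basis) auto

text \<open>By Alexander's theorem only covers by miss and hit sets matter. The complement of the
  union of all \<open>G\<close> whose hit sets occur in the cover lies in none of these hit sets, so
  it lies in a miss set of some compact \<open>K\<close>, which means that these \<open>G\<close>
  cover \<open>K\<close>. Finitely many of them do, and their hit sets together with that miss set
  cover everything: a closed set misses \<open>K\<close> or meets one of them.\<close>

lemma compact_space_fell: "compact_space (fell_topology :: 'a::topological_space set topology)"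
  unfolding fell_topology_def
proof (rule Alexander_subbase[OF topology_generated_by_subbase[symmetric]])
  let ?M = "{{C :: 'a set. closed C \<and> C \<inter> K = {}} | K. compact K}"
  let ?H = "{{C :: 'a set. closed C \<and> C \<inter> G \<noteq> {}} | G. open G}"
  have ts: "topspace (topology_generated_by (?M \<union> ?H)) = {C. closed C}"
    using topspace_fell_topology unfolding fell_topology_def .
  fix \<C> assume sub: "\<C> \<subseteq> ?M \<union> ?H" and cov: "\<Union>\<C> = topspace (topology_generated_by (?M \<union> ?H))"
  define \<G> where "\<G> = {G. open G \<and> {C. closed C \<and> C \<inter> G \<noteq> {}} \<in> \<C>}"
  have "open (\<Union>\<G>)" by (auto simp: \<G>_def)
  then have "- \<Union>\<G> \<in> \<Union>\<C>" unfolding cov ts by auto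
  then obtain S where S: "S \<in> \<C>" "- \<Union>\<G> \<in> S" by blast
  have "S \<in> ?M"
  proof (rule ccontr)
    assume "S \<notin> ?M"
    then have "S \<in> ?H" using subsetD[OF sub S(1)] by (simp only: Un_iff simp_thms)
    then obtain G where "open G" "S = {C. closed C \<and> C \<inter> G \<noteq> {}}" by auto
    then show False using S by (auto simp: \<G>_def)
  qed
  then obtain K where K: "compact K" "S = {C. closed C \<and> C \<inter> K = {}}" by blast
  then have "K \<subseteq> \<Union>\<G>" using S by auto
  obtain \<G>' where \<G>': "\<G>' \<subseteq> \<G>" "finite \<G>'" "K \<subseteq> \<Union>\<G>'"
    by (rule compactE[OF K(1) \<open>K \<subseteq> \<Union>\<G>\<close>]) (auto simp: \<G>_def)
  let ?F = "insert S ((\<lambda>G. {C. closed C \<and> C \<inter> G \<noteq> {}}) ` \<G>')"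
  have "?F \<subseteq> \<C>" using S \<G>' by (auto simp: \<G>_def)
  moreover have "\<Union>?F = {C. closed C}"
  proof
    show "{C. closed C} \<subseteq> \<Union>?F"
    proof
      fix C assume C: "C \<in> {C :: 'a set. closed C}"
      show "C \<in> \<Union>?F"
      proof (cases "C \<inter> K = {}")
        case False
        then obtain x G where "x \<in> C" "x \<in> G" "G \<in> \<G>'" using \<G>'(3) by blast
        then show ?thesis using C by auto
      qed (use C K in auto)
    qed
  qed (use K in auto)
  ultimately show "\<exists>C'. finite C' \<and> C' \<subseteq> \<C> \<and> \<Union>C' = topspace (topology_generated_by (?M \<union> ?H))"
    unfolding ts using \<G>'(2) by (intro exI[of _ ?F]) auto
qed

section \<open>Countable base and measurability of random closed sets\<close>

definition fell_box :: "('a::metric_space \<times> real) set \<Rightarrow> ('a \<times> real) set \<Rightarrow> 'a set set" where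
  "fell_box A B =
     {C. closed C \<and> (\<forall>(x,q)\<in>A. C \<inter> cball x q = {}) \<and> (\<forall>(x,q)\<in>B. C \<inter> ball x q \<noteq> {})}"

text \<open>Induction over the generation of open sets. Covering \<open>K\<close> by open balls
  whose closed versions avoid \<open>C\<close> lets finitely many missed closed balls witness that
  \<open>C\<close> misses \<open>K\<close>; for a hit set one small open ball suffices. The boxes
  are not claimed to be open here: the purpose is to write every open set as a countable union of
  boxes.\<close>

lemma fell_topology_countable_base:
  "\<exists>D :: ('a::{metric_space, second_countable_topology} \<times> real) set. countable D \<and>
    (\<forall>U C. openin fell_topology U \<longrightarrow> C \<in> U \<longrightarrow>
       (\<exists>A B. finite A \<and> A \<subseteq> D \<and> finite B \<and> B \<subseteq> D \<and> C \<in> fell_box A B \<and> fell_box A B \<subseteq> U))"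
proof -
  obtain E :: "'a set" where E: "countable E" "\<And>X. open X \<Longrightarrow> X \<noteq> {} \<Longrightarrow> \<exists>d\<in>E. d \<in> X"
    using countable_dense_exists by blast
  define D where "D = E \<times> (\<rat> :: real set)"
  have D: "countable D" unfolding D_def using E countable_rat by auto
  have small: "\<exists>(x,q)\<in>D. y \<in> ball x q \<and> cball x q \<subseteq> G" if "open G" "y \<in> G" for y G
  proof -
    obtain e where e: "e > 0" "ball y e \<subseteq> G" by (rule openE[OF \<open>open G\<close> \<open>y \<in> G\<close>])
    \<comment> \<open>With a centre within \<open>e/4\<close> of \<open>y\<close> and a radius
      between \<open>e/4\<close> and \<open>e/2\<close>, the open ball contains \<open>y\<close> and
      the closed ball stays within \<open>3 * e / 4\<close> of \<open>y\<close>.\<close>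
    obtain q where q: "q \<in> \<rat>" "e/4 < q" "q < e/2" using Rats_dense_in_real[of "e/4" "e/2"] e by auto
    obtain x where x: "x \<in> E" "x \<in> ball y (e/4)" using E(2)[of "ball y (e/4)"] e by auto
    have "y \<in> ball x q" using x q by (auto simp: dist_commute)
    moreover have "cball x q \<subseteq> ball y e"
    proof
      fix z assume "z \<in> cball x q"
      then show "z \<in> ball y e" using x q dist_triangle[of y z x] by auto
    qed
    ultimately show ?thesis using e x q by (auto simp: D_def intro!: bexI[of _ "(x,q)"])
  qed
  have base: "\<exists>A B. finite A \<and> A \<subseteq> D \<and> finite B \<and> B \<subseteq> D \<and> C \<in> fell_box A B \<and> fell_box A B \<subseteq> U"
    if "openin fell_topology U" "C \<in> U" for U C
    using openin_topology_generated_by[OF that(1)[unfolded fell_topology_def]] that(2)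
  proof (induction arbitrary: C)
    case Empty then show ?case by simp
  next
    case (Int a b)
    obtain A B where 1: "finite A" "A \<subseteq> D" "finite B" "B \<subseteq> D" "C \<in> fell_box A B" "fell_box A B \<subseteq> a"
      using Int.IH(1)[of C] Int.prems by auto
    obtain A' B' where 2: "finite A'" "A' \<subseteq> D" "finite B'" "B' \<subseteq> D" "C \<in> fell_box A' B'"
        "fell_box A' B' \<subseteq> b"
      using Int.IH(2)[of C] Int.prems by auto
    have "fell_box (A \<union> A') (B \<union> B') = fell_box A B \<inter> fell_box A' B'"
      unfolding fell_box_def ball_Un by (rule set_eqI) (simp, argo)
    then show ?case using 1 2 by - (rule exI[of _ "A \<union> A'"], rule exI[of _ "B \<union> B'"], auto)
  next
    case (UN K)
    then obtain S where S: "S \<in> K" "C \<in> S" by blast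
    from UN.IH[OF this] show ?case using S by (meson Union_upper order_trans)
  next
    case (Basis s)
    from Basis.hyps consider K where "compact K" "s = {C. closed C \<and> C \<inter> K = {}}"
      | G where "open G" "s = {C. closed C \<and> C \<inter> G \<noteq> {}}" by auto
    then show ?case
    proof cases
      case 1
      let ?A = "{(x,q)\<in>D. cball x q \<subseteq> - C}"
      have "open (- C)" using Basis 1 by auto
      have "K \<subseteq> (\<Union>(x,q)\<in>?A. ball x q)"
      proof
        fix y assume "y \<in> K"
        then have "y \<in> - C" using Basis 1 by auto
        from small[OF \<open>open (- C)\<close> this] show "y \<in> (\<Union>(x,q)\<in>?A. ball x q)" by fastforce
      qed
      then obtain A where A: "A \<subseteq> ?A" "finite A" "K \<subseteq> (\<Union>(x,q)\<in>A. ball x q)"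
        using compactE_image[OF 1(1), of ?A "\<lambda>(x,q). ball x q"] by (auto simp: case_prod_beta)
      have "C \<in> fell_box A {}" using A Basis 1 unfolding fell_box_def by auto
      moreover have "fell_box A {} \<subseteq> s"
      proof
        fix C' assume C': "C' \<in> fell_box A {}"
        have "C' \<inter> (\<Union>(x,q)\<in>A. ball x q) = {}"
          using C' unfolding fell_box_def by fastforce
        then have "C' \<inter> K = {}" using A(3) by blast
        then show "C' \<in> s" using C' unfolding fell_box_def 1 by simp
      qed
      ultimately show ?thesis using A by - (rule exI[of _ A], rule exI[of _ "{}"], auto)
    next
      case 2
      then obtain y where y: "y \<in> C" "y \<in> G" using Basis by auto
      obtain x q where xq: "(x,q) \<in> D" "y \<in> ball x q" "cball x q \<subseteq> G" using small[OF 2(1) y(2)]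
        by auto
      have "closed C" using Basis.prems unfolding 2(2) by simp
      moreover have "C \<inter> ball x q \<noteq> {}" using xq(2) y(1) by blast
      ultimately have "C \<in> fell_box {} {(x,q)}" unfolding fell_box_def by simp
      moreover have "fell_box {} {(x,q)} \<subseteq> s"
      proof -
        have "ball x q \<subseteq> G" using xq(3) ball_subset_cball by blast
        then have "C' \<inter> G \<noteq> {}" if "C' \<inter> ball x q \<noteq> {}" for C' using that by blast
        then show ?thesis unfolding fell_box_def 2(2) by auto
      qed
      ultimately show ?thesis using xq by - (rule exI[of _ "{}"], rule exI[of _ "{(x,q)}"], auto)
    qed
  qed
  show ?thesis using D base by blast
qed

text \<open>A closed set misses a compact \<open>K\<close> iff it misses some
  \<open>1 / Suc m\<close>-neighbourhood of \<open>K\<close>, since disjoint closed and compact sets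
  have positive distance. So hitting events of open sets also control miss events of compact sets,
  and a Fell-open set pulls back to a countable union of preimages of boxes.\<close>

lemma random_closed_setI:
  fixes Z :: "'w \<Rightarrow> 'a::{heine_borel, second_countable_topology} set"
  assumes closed: "\<And>\<omega>. \<omega> \<in> space M \<Longrightarrow> closed (Z \<omega>)"
    and hit: "\<And>G. open G \<Longrightarrow> {\<omega> \<in> space M. Z \<omega> \<inter> G \<noteq> {}} \<in> sets M"
  shows "random_closed_set M Z"
proof -
  have miss: "{\<omega> \<in> space M. Z \<omega> \<inter> K = {}} \<in> sets M" if K: "compact K" for K
  proof -
    define G where "G m = (\<Union>x\<in>K. ball x (1 / Suc m))" for m :: nat
    have "open (G m)" for m by (auto simp: G_def)
    have "Z \<omega> \<inter> K = {} \<longleftrightarrow> (\<exists>m. Z \<omega> \<inter> G m = {})" if w: "\<omega> \<in> space M" for \<omega>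
    proof
      assume "Z \<omega> \<inter> K = {}"
      then obtain d where d: "d > 0" "\<forall>x\<in>K. \<forall>y\<in>Z \<omega>. d \<le> dist x y"
        using separate_compact_closed[OF K closed[OF w]] by blast
      obtain m where "1 / Suc m < d" using nat_approx_posE d by blast
      then have "Z \<omega> \<inter> G m = {}" using d by (force simp: G_def)
      then show "\<exists>m. Z \<omega> \<inter> G m = {}" by blast
    next
      assume "\<exists>m. Z \<omega> \<inter> G m = {}"
      moreover have "K \<subseteq> G m" for m by (auto simp: G_def)
      ultimately show "Z \<omega> \<inter> K = {}" by blast
    qed
    then have "{\<omega> \<in> space M. Z \<omega> \<inter> K = {}} = (\<Union>m. space M - {\<omega> \<in> space M. Z \<omega> \<inter> G m \<noteq> {}})" by auto
    also have "\<dots> \<in> sets M" using hit[OF \<open>open (G _)\<close>] by auto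
    finally show ?thesis .
  qed
  obtain D :: "('a \<times> real) set" where D: "countable D"
    and base: "\<forall>U C. openin fell_topology U \<longrightarrow> C \<in> U \<longrightarrow>
       (\<exists>A B. finite A \<and> A \<subseteq> D \<and> finite B \<and> B \<subseteq> D \<and> C \<in> fell_box A B \<and> fell_box A B \<subseteq> U)"
    using fell_topology_countable_base[where 'a='a] by blast
  have meas: "Z -` fell_box A B \<inter> space M \<in> sets M" if "finite A" "finite B" for A B
  proof -
    have "Z -` fell_box A B \<inter> space M = {\<omega> \<in> space M. (\<forall>p\<in>A. Z \<omega> \<inter> cball (fst p) (snd p) = {}) \<and>
        (\<forall>p\<in>B. Z \<omega> \<inter> ball (fst p) (snd p) \<noteq> {})}"
      using closed by (auto simp: fell_box_def case_prod_beta)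
    also have "\<dots> \<in> sets M"
      using that hit miss by (intro sets.sets_Collect_conj sets.sets_Collect_finite_All) auto
    finally show ?thesis .
  qed
  show ?thesis unfolding random_closed_set_def borel_measure_of_def topspace_fell_topology
  proof (rule measurable_sigma_sets[OF sets_measure_of])
    show "{U. openin fell_topology U} \<subseteq> Pow {C :: 'a set. closed C}"
      using openin_subset[of fell_topology] by (auto simp: topspace_fell_topology)
    then show "{U. openin fell_topology U} \<subseteq> Pow {C :: 'a set. closed C}" .
    show "Z \<in> space M \<rightarrow> {C. closed C}" using closed by auto
    fix U :: "'a set set" assume "U \<in> {U. openin fell_topology U}"
    then have U: "openin fell_topology U" by simp
    define I where "I = {(A, B). finite A \<and> A \<subseteq> D \<and> finite B \<and> B \<subseteq> D \<and> fell_box A B \<subseteq> U}"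
    have "countable ({A. finite A \<and> A \<subseteq> D} \<times> {A. finite A \<and> A \<subseteq> D})"
      using D by (intro countable_SIGMA countable_Collect_finite_subset)
    then have I: "countable I" by (rule countable_subset[rotated]) (auto simp: I_def)
    have U_eq: "U = (\<Union>(A,B)\<in>I. fell_box A B)"
    proof
      show "U \<subseteq> (\<Union>(A,B)\<in>I. fell_box A B)"
      proof
        fix C assume "C \<in> U"
        then obtain A B where "finite A" "A \<subseteq> D" "finite B" "B \<subseteq> D" "C \<in> fell_box A B"
            "fell_box A B \<subseteq> U"
          using base U by meson
        then show "C \<in> (\<Union>(A,B)\<in>I. fell_box A B)"
          by (auto simp: I_def intro!: bexI[of _ "(A, B)"])
      qed
    qed (auto simp: I_def)
    have "Z -` U \<inter> space M = (\<Union>p\<in>I. Z -` fell_box (fst p) (snd p) \<inter> space M)"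
      using arg_cong[OF U_eq, of "\<lambda>U. Z -` U \<inter> space M"]
        by (simp only: case_prod_beta vimage_UN UN_simps)
    also have "\<dots> \<in> sets M"
    proof (rule sets.countable_UN''[OF I])
      fix p assume "p \<in> I"
      then show "Z -` fell_box (fst p) (snd p) \<inter> space M \<in> sets M"
        by (intro meas) (auto simp: I_def)
    qed
    finally show "Z -` U \<inter> space M \<in> sets M" .
  qed
qed

text \<open>A hit set pulls back to a union, a miss set to an intersection of open preimages under
  the single points. Finiteness of \<open>I\<close> keeps the intersection open and the image
  closed.\<close>

lemma continuous_map_finite_set_fell:
  fixes p :: "'i \<Rightarrow> 'b::topological_space \<Rightarrow> 'a::t2_space"
  assumes "finite I" and cont: "\<And>i. i \<in> I \<Longrightarrow> continuous_on UNIV (p i)"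
  shows "continuous_map euclidean fell_topology (\<lambda>v. (\<lambda>i. p i v) ` I)"
  unfolding fell_topology_def
proof (rule continuous_on_generated_topo)
  have ts: "\<Union>({{C. closed C \<and> C \<inter> K = {}} |K. compact K} \<union> {{C. closed C \<and>
      C \<inter> G \<noteq> {}} |G. open G}) = {C :: 'a set. closed C}"
    using topspace_fell_topology unfolding fell_topology_def topology_generated_by_topspace .
  show "(\<lambda>v. (\<lambda>i. p i v) ` I) ` topspace euclidean
      \<subseteq> \<Union>({{C. closed C \<and> C \<inter> K = {}} |K. compact K} \<union> {{C. closed C \<and> C \<inter> G \<noteq> {}} |G. open G})"
    unfolding ts using \<open>finite I\<close> by (auto intro!: finite_imp_closed)
  have pre: "open (p i -` G)" if "i \<in> I" "open G" for i G
    using cont[OF that(1)] that(2) by (simp add: continuous_on_open_vimage)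
  fix U :: "'a set set" assume "U \<in> {{C. closed C \<and> C \<inter> K = {}} |K. compact K} \<union> {{C. closed C \<and>
      C \<inter> G \<noteq> {}} |G. open G}"
  then consider K where "compact K" "U = {C. closed C \<and> C \<inter> K = {}}"
      | G where "open G" "U = {C. closed C \<and> C \<inter> G \<noteq> {}}" by blast
  then have "open ((\<lambda>v. (\<lambda>i. p i v) ` I) -` U)"
  proof cases
    case 1
    have "(\<lambda>v. (\<lambda>i. p i v) ` I) -` U = (\<Inter>i\<in>I. p i -` (- K))"
      unfolding 1 using \<open>finite I\<close> by (auto intro!: finite_imp_closed)
    then show ?thesis using pre[OF _ open_Compl[OF compact_imp_closed[OF 1(1)]]] \<open>finite I\<close>
      by (auto intro!: open_INT simp del: vimage_Compl)
  next
    case 2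
    have "(\<lambda>v. (\<lambda>i. p i v) ` I) -` U = (\<Union>i\<in>I. p i -` G)"
      unfolding 2 using \<open>finite I\<close> by (auto intro!: finite_imp_closed)
    then show ?thesis using pre 2 by auto
  qed
  then show "openin euclidean ((\<lambda>v. (\<lambda>i. p i v) ` I) -` U \<inter> topspace euclidean)" by simp
qed

text \<open>A Hausdorff distance truncated to the ball of radius \<open>R\<close>. The matching
  point may lie outside that ball; this keeps the relation monotone in \<open>R\<close>, at the cost
  of a larger ball when two relations are composed.\<close>

definition fell_close :: "real \<Rightarrow> real \<Rightarrow> 'a::real_normed_vector set \<Rightarrow> 'a set \<Rightarrow> bool" where
  "fell_close R r C C' \<longleftrightarrow>
     (\<forall>x\<in>C. norm x \<le> R \<longrightarrow> (\<exists>y\<in>C'. dist x y < r)) \<and>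
     (\<forall>y\<in>C'. norm y \<le> R \<longrightarrow> (\<exists>x\<in>C. dist x y < r))"

lemma fell_close_mono: "fell_close R r C C' \<Longrightarrow> R' \<le> R \<Longrightarrow> r \<le> r' \<Longrightarrow> fell_close R' r' C C'"
  unfolding fell_close_def by (meson less_le_trans order_trans)

text \<open>The intermediate point lies within \<open>r/2\<close> of a point of norm at most
  \<open>R\<close>; \<open>r \<le> 1\<close> keeps it in the ball of radius
  \<open>R + 1\<close>.\<close>

lemma fell_close_trans:
  assumes "fell_close (R + 1) (r/2) A B" "fell_close (R + 1) (r/2) B C" "r \<le> 1"
  shows "fell_close R r A C"
proof -
  have n: "norm y \<le> R + 1" if "norm x \<le> R" "dist x y < r/2 \<or> dist y x < r/2" for x y :: 'a
    using that assms(3) norm_triangle_ineq2[of y x] by (auto simp: dist_norm norm_minus_commute)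
  show ?thesis unfolding fell_close_def
  proof (intro conjI ballI impI)
    fix x assume x: "x \<in> A" "norm x \<le> R"
    then obtain y where y: "y \<in> B" "dist x y < r/2" using assms(1) unfolding fell_close_def
      by fastforce
    then obtain z where "z \<in> C" "dist y z < r/2" using assms(2) n[OF x(2)]
      unfolding fell_close_def by blast
    then show "\<exists>z\<in>C. dist x z < r" using y dist_triangle[of x z y] by force
  next
    fix z assume z: "z \<in> C" "norm z \<le> R"
    then obtain y where y: "y \<in> B" "dist y z < r/2" using assms(2) unfolding fell_close_def
      by fastforce
    then obtain x where "x \<in> A" "dist x y < r/2" using assms(1) n[OF z(2)]
      unfolding fell_close_def by blast
    then show "\<exists>x\<in>A. dist x z < r" using y dist_triangle[of x z y] by force
  qed
qed

text \<open>A miss set survives when \<open>r\<close> does not exceed the distance from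
  \<open>C\<close> to \<open>K\<close> and the ball of radius \<open>R\<close> contains
  \<open>K\<close>; a hit set survives when \<open>r\<close> fits a ball around one point of
  \<open>C\<close> into \<open>G\<close>. The bound \<open>r \<le> 1\<close> is recorded for the use
  of \<open>fell_close_trans\<close>.\<close>

lemma fell_close_in_open:
  fixes C :: "'a::euclidean_space set"
  assumes "openin fell_topology U" "C \<in> U"
  obtains R r where "r > 0" "r \<le> 1" "\<And>C'. closed C' \<Longrightarrow> fell_close R r C C' \<Longrightarrow> C' \<in> U"
proof -
  have "\<exists>R r. r > 0 \<and> r \<le> 1 \<and> (\<forall>C'. closed C' \<longrightarrow> fell_close R r C C' \<longrightarrow> C' \<in> U)"
    using openin_topology_generated_by[OF assms(1)[unfolded fell_topology_def]] assms(2)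
  proof (induction arbitrary: C)
    case Empty then show ?case by simp
  next
    case (Int a b)
    obtain R r where 1: "r > 0" "r \<le> 1" "\<forall>C'. closed C' \<longrightarrow> fell_close R r C C' \<longrightarrow> C' \<in> a"
      using Int.IH(1)[of C] Int.prems by auto
    obtain R' r' where 2: "r' > 0" "r' \<le> 1" "\<forall>C'. closed C' \<longrightarrow> fell_close R' r' C C' \<longrightarrow> C' \<in> b"
      using Int.IH(2)[of C] Int.prems by auto
    show ?case
    proof (rule exI[of _ "max R R'"], rule exI[of _ "min r r'"], intro conjI allI impI)
      fix C' assume C': "closed C'" "fell_close (max R R') (min r r') C C'"
      have "fell_close R r C C'" "fell_close R' r' C C'"
        using fell_close_mono[OF C'(2)] by auto
      then show "C' \<in> a \<inter> b" using 1(3) 2(3) C'(1) by blast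
    qed (use 1 2 in auto)
  next
    case (UN K)
    then obtain S where S: "S \<in> K" "C \<in> S" by blast
    from UN.IH[OF this] show ?case using S by (meson UnionI)
  next
    case (Basis s)
    from Basis.hyps consider K where "compact K" "s = {C. closed C \<and> C \<inter> K = {}}"
      | G where "open G" "s = {C. closed C \<and> C \<inter> G \<noteq> {}}" by auto
    then show ?case
    proof cases
      case 1
      then obtain d where d: "d > 0" "\<forall>x\<in>K. \<forall>y\<in>C. d \<le> dist x y"
        using separate_compact_closed[of K C] Basis by auto
      obtain R where R: "\<forall>x\<in>K. norm x \<le> R" using compact_imp_bounded[OF 1(1)] bounded_iff by blast
      have "C' \<in> s" if "closed C'" "fell_close R (min d 1) C C'" for C'
      proof -
        have False if "y \<in> C'" "y \<in> K" for y
        proof -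
          have "\<exists>x\<in>C. dist x y < min d 1"
            using conjunct2[OF \<open>fell_close R (min d 1) C C'\<close>[unfolded fell_close_def]] that R
              by simp
          then obtain x where "x \<in> C" "dist x y < d" by auto
          moreover have "d \<le> dist y x" using d(2) \<open>x \<in> C\<close> that(2) by blast
          ultimately show False by (simp add: dist_commute)
        qed
        then show ?thesis using that 1 by auto
      qed
      then show ?thesis using d by - (rule exI[of _ R], rule exI[of _ "min d 1"], auto)
    next
      case 2
      then obtain x where x: "x \<in> C" "x \<in> G" using Basis by auto
      obtain e where e: "e > 0" "ball x e \<subseteq> G" using openE 2 x by blast
      have "C' \<in> s" if C': "closed C'" "fell_close (norm x) (min e 1) C C'" for C'
      proof -
        have "\<exists>y\<in>C'. dist x y < min e 1"
          using bspec[OF conjunct1[OF C'(2)[unfolded fell_close_def]] x(1)]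
            by (simp only: order_refl simp_thms)
        then obtain y where "y \<in> C'" "dist x y < min e 1" ..
        then have "y \<in> C' \<inter> G" using subsetD[OF e(2), of y] by simp
        then show ?thesis using C'(1) unfolding 2(2) by blast
      qed
      then show ?thesis using e by - (rule exI[of _ "norm x"], rule exI[of _ "min e 1"], auto)
    qed
  qed
  then show ?thesis using that by blast
qed

text \<open>Counterpart of \<open>fell_close_in_open\<close>. Members of \<open>W\<close> miss the
  part of the ball at distance at least \<open>r\<close> from \<open>C\<close>, so their points in
  the ball are near \<open>C\<close>; they also hit finitely many balls of radius \<open>r/2\<close>
  centred in \<open>C\<close> that cover \<open>C\<close> inside the ball, so the points of
  \<open>C\<close> there are near them.\<close>

lemma fell_close_nbhd:
  fixes C :: "'a::euclidean_space set"
  assumes "closed C" "r > 0"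
  obtains W where "openin fell_topology W" "C \<in> W" "\<And>C'. C' \<in> W \<Longrightarrow> fell_close R r C C'"
proof -
  define K where "K = cball 0 R \<inter> - (\<Union>x\<in>C. ball x r)"
  have K: "compact K" unfolding K_def by (intro compact_Int_closed) (auto intro!: open_UN)
  have "compact (C \<inter> cball 0 R)" using assms by (simp add: closed_Int_compact)
  moreover have "C \<inter> cball 0 R \<subseteq> (\<Union>x\<in>C. ball x (r/2))" using assms by force
  ultimately obtain A where A: "A \<subseteq> C" "finite A" "C \<inter> cball 0 R \<subseteq> (\<Union>x\<in>A. ball x (r/2))"
    using compactE_image[of "C \<inter> cball 0 R" C "\<lambda>x. ball x (r/2)"] by auto
  define W where "W = {C'. closed C' \<and> C' \<inter> K = {}} \<inter> (\<Inter>x\<in>A. {C'. closed C' \<and>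
      C' \<inter> ball x (r/2) \<noteq> {}})"
  have "W = (\<Inter> (insert {C'. closed C' \<and> C' \<inter> K = {}} ((\<lambda>x. {C'. closed C' \<and>
      C' \<inter> ball x (r/2) \<noteq> {}}) ` A)))"
    unfolding W_def by auto
  moreover have "openin fell_topology \<dots>"
    using A K by (intro openin_Inter) (auto intro: openin_fell_miss openin_fell_hit)
  ultimately have "openin fell_topology W" by simp
  moreover have "C \<in> W"
  proof -
    have "C \<inter> K = {}" using assms by (force simp: K_def)
    moreover have "C \<inter> ball x (r/2) \<noteq> {}" if "x \<in> A" for x
    proof -
      have "x \<in> C \<inter> ball x (r/2)" using that A assms by auto
      then show ?thesis by blast
    qed
    ultimately show ?thesis unfolding W_def using assms by blast
  qed
  moreover have "fell_close R r C C'" if C': "C' \<in> W" for C'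
    unfolding fell_close_def
  proof (intro conjI ballI impI)
    fix x assume x: "x \<in> C" "norm x \<le> R"
    then obtain a where a: "a \<in> A" "dist a x < r/2" using subsetD[OF A(3), of x]
      by (auto simp: dist_commute)
    then have "C' \<inter> ball a (r/2) \<noteq> {}" using C' unfolding W_def by blast
    then obtain y where "y \<in> C'" "dist a y < r/2" by auto
    then show "\<exists>y\<in>C'. dist x y < r" using a dist_triangle[of x y a] by (force simp: dist_commute)
  next
    fix y assume y: "y \<in> C'" "norm y \<le> R"
    then have "y \<notin> K" using C' by (auto simp: W_def)
    then show "\<exists>x\<in>C. dist x y < r" using y by (auto simp: K_def)
  qed
  ultimately show ?thesis using that by blast
qed

text \<open>A Lebesgue number argument; the relations \<open>fell_close R r\<close> generate the uniformity of the
  compact space of closed sets.\<close>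

lemma fell_uniformly_continuous:
  fixes f :: "'a::euclidean_space set \<Rightarrow> real"
  assumes f: "continuous_map fell_topology euclideanreal f" and "\<epsilon> > 0"
  shows "\<exists>R. \<exists>r>0. \<forall>C C'. closed C \<longrightarrow> closed C' \<longrightarrow> fell_close R r C C' \<longrightarrow> \<bar>f C - f C'\<bar> < \<epsilon>"
proof -
  have "\<exists>R r W. r > 0 \<and> r \<le> 1 \<and> (\<forall>C'. closed C' \<longrightarrow> fell_close R r C C' \<longrightarrow> \<bar>f C' - f C\<bar> < \<epsilon>/2) \<and>
      openin fell_topology W \<and> C \<in> W \<and> (\<forall>C'\<in>W. fell_close (R + 1) (r/2) C C')"
    if C: "closed C" for C
  proof -
    let ?U = "{C' \<in> topspace fell_topology. f C' \<in> ball (f C) (\<epsilon>/2)}"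
    have "openin fell_topology ?U"
      using f by (rule openin_continuous_map_preimage) simp
    moreover have "C \<in> ?U" using C \<open>\<epsilon> > 0\<close> by (simp add: topspace_fell_topology)
    ultimately obtain R r where r: "r > 0" "r \<le> 1" "\<And>C'. closed C' \<Longrightarrow> fell_close R r C C' \<Longrightarrow> C' \<in> ?U"
      using fell_close_in_open by blast
    \<comment> \<open>Half of the radius is spent on \<open>W\<close>; the other half is left for
      the second relation in \<open>fell_close_trans\<close>, which also explains
      \<open>R + 1\<close>.\<close>
    obtain W where W: "openin fell_topology W" "C \<in> W" "\<And>C'. C' \<in> W \<Longrightarrow> fell_close (R + 1) (r/2) C C'"
      using fell_close_nbhd[OF C, of "r/2" "R + 1"] r by auto
    have "\<bar>f C' - f C\<bar> < \<epsilon>/2" if "closed C'" "fell_close R r C C'" for C'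
      using r(3)[OF that] by (simp add: dist_real_def abs_minus_commute)
    then show ?thesis using r W by blast
  qed
  then obtain R r W where *: "\<And>C. closed C \<Longrightarrow> r C > 0 \<and> r C \<le> 1"
    "\<And>C C'. closed C \<Longrightarrow> closed C' \<Longrightarrow> fell_close (R C) (r C) C C' \<Longrightarrow> \<bar>f C' - f C\<bar> < \<epsilon>/2"
    "\<And>C. closed C \<Longrightarrow> openin fell_topology (W C) \<and> C \<in> W C"
    "\<And>C C'. closed C \<Longrightarrow> C' \<in> W C \<Longrightarrow> fell_close (R C + 1) (r C / 2) C C'"
    by metis
  obtain \<F> where \<F>: "finite \<F>" "\<F> \<subseteq> W ` {C. closed C}" "{C. closed C} \<subseteq> \<Union>\<F>"
    using compact_space_fell[unfolded compact_space_alt, rule_format, of "W ` {C. closed C}"] *(3)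
    by (auto simp: topspace_fell_topology)
  obtain A where A: "finite A" "A \<subseteq> {C. closed C}" "\<F> = W ` A"
    using finite_subset_image[OF \<F>(1,2)] by blast
  have "A \<noteq> {}" using \<F>(3) A(3) closed_empty by auto
  define R0 where "R0 = Max ((\<lambda>C. R C + 1) ` A)"
  define r0 where "r0 = Min ((\<lambda>C. r C / 2) ` A)"
  have "r0 > 0" unfolding r0_def using A \<open>A \<noteq> {}\<close> *(1) by (subst Min_gr_iff) auto
  moreover have "\<bar>f C1 - f C2\<bar> < \<epsilon>" if C: "closed C1" "closed C2" "fell_close R0 r0 C1 C2" for C1 C2
  proof -
    obtain C where C': "C \<in> A" "C1 \<in> W C" using \<F>(3) A(3) C(1) by auto
    then have cl: "closed C" using A by auto
    have "R C + 1 \<le> R0" unfolding R0_def using A C' by (intro Max_ge) auto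
    moreover have "r0 \<le> r C / 2" unfolding r0_def using A C' by (intro Min_le) auto
    ultimately
    have c2: "fell_close (R C + 1) (r C / 2) C1 C2" using C(3) fell_close_mono by blast
    have c1: "fell_close (R C + 1) (r C / 2) C C1" using *(4) cl C' by blast
    have "fell_close (R C) (r C) C C2" using fell_close_trans[OF c1 c2] *(1)[OF cl] by blast
    then have "\<bar>f C2 - f C\<bar> < \<epsilon>/2" using * cl C by blast
    moreover have "\<bar>f C1 - f C\<bar> < \<epsilon>/2"
      using *(2)[OF cl C(1)] fell_close_mono[OF c1, of "R C" "r C"] *(1)[OF cl] by auto
    ultimately show ?thesis by linarith
  qed
  ultimately show ?thesis by blast
qed

lemma measurable_fell_continuous:
  assumes "continuous_map fell_topology euclideanreal f"
  shows "f \<in> borel_measurable (borel_measure_of fell_topology)"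
proof (rule borel_measurableI)
  have sp: "{U. openin T U} \<subseteq> Pow (topspace T)" for T :: "'b topology"
    using openin_subset by auto
  fix S :: "real set" assume "open S"
  then have "openin fell_topology {C \<in> topspace fell_topology. f C \<in> S}"
    using assms by (intro openin_continuous_map_preimage) auto
  then show "f -` S \<inter> space (borel_measure_of fell_topology) \<in> sets
      (borel_measure_of fell_topology)"
    unfolding borel_measure_of_def
    by (auto simp: sets_measure_of[OF sp] space_measure_of[OF sp] vimage_def Int_def conj_commute)
qed

section \<open>Moments, chaining and a triangular central limit theorem\<close>

lemma (in prob_space) prob_abs_gt_le_fourth_moment:
  fixes Y :: "'a \<Rightarrow> real"
  assumes [measurable]: "random_variable borel Y" and "integrable M (\<lambda>\<omega>. Y \<omega> ^ 4)" and c: "c > 0"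
  shows "prob {\<omega> \<in> space M. \<bar>Y \<omega>\<bar> > c} \<le> expectation (\<lambda>\<omega>. Y \<omega> ^ 4) / c ^ 4"
proof -
  have "c ^ 4 \<le> y ^ 4" if "\<bar>y\<bar> > c" for y :: real
    using power_mono[of c "\<bar>y\<bar>" 4] that c by (simp add: power_even_abs)
  then have "prob {\<omega> \<in> space M. \<bar>Y \<omega>\<bar> > c} \<le> prob {\<omega> \<in> space M. Y \<omega> ^ 4 \<ge> c ^ 4}"
    by (intro finite_measure_mono) auto
  also have "\<dots> \<le> expectation (\<lambda>\<omega>. Y \<omega> ^ 4) / c ^ 4"
    using assms by (intro integral_Markov_inequality_measure[where A = "{}"]) auto
  finally show ?thesis .
qed

text \<open>Induction on \<open>n\<close>: when one summand is added, the cross terms with an odd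
  power vanish by independence and centring, and boundedness by 1 reduces the fourth moment of the
  summand to its second. The part \<open>3 * (real n)\<^sup>2 * p\<^sup>2\<close> is Gaussian; the
  part \<open>real n * p\<close> dominates when \<open>real n * p\<close> is small and later limits
  how fine a grid may be.\<close>

lemma (in prob_space) bounded_indep_sum_moments:
  fixes Z :: "nat \<Rightarrow> 'a \<Rightarrow> real" and p :: real
  assumes indep: "indep_vars (\<lambda>_. borel) Z {1..}"
    and bd: "\<And>i \<omega>. \<omega> \<in> space M \<Longrightarrow> i \<ge> 1 \<Longrightarrow> \<bar>Z i \<omega>\<bar> \<le> 1"
    and mean: "\<And>i. i \<ge> 1 \<Longrightarrow> expectation (Z i) = 0"
    and var: "\<And>i. i \<ge> 1 \<Longrightarrow> expectation (\<lambda>\<omega>. Z i \<omega> ^ 2) \<le> p"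
  defines "S n \<equiv> \<lambda>\<omega>. \<Sum>i\<in>{1..n}. Z i \<omega>"
  shows "expectation (\<lambda>\<omega>. S n \<omega> ^ 2) \<le> real n * p"
    and "expectation (\<lambda>\<omega>. S n \<omega> ^ 4) \<le> real n * p + 3 * (real n)\<^sup>2 * p\<^sup>2"
    and "expectation (S n) = 0"
proof -
  have rvZ: "random_variable borel (Z i)" if "i \<ge> 1" for i
    using indep that unfolding indep_vars_def2 by auto
  have rvS[measurable]: "random_variable borel (S n)" for n
    unfolding S_def by (intro borel_measurable_sum rvZ) auto
  have bdS: "\<bar>S n \<omega>\<bar> \<le> real n" if "\<omega> \<in> space M" for n \<omega>
  proof -
    have "\<bar>S n \<omega>\<bar> \<le> (\<Sum>i\<in>{1..n}. \<bar>Z i \<omega>\<bar>)" unfolding S_def by (rule sum_abs)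
    also have "\<dots> \<le> (\<Sum>i\<in>{1..n}. 1)" using bd that by (intro sum_mono) auto
    finally show ?thesis by simp
  qed
  have intS: "integrable M (\<lambda>\<omega>. S n \<omega> ^ j)" for n j
  proof (rule integrable_const_bound[where B = "real n ^ j"])
    show "AE \<omega> in M. norm (S n \<omega> ^ j) \<le> real n ^ j"
      using bdS by (auto simp: power_abs intro!: power_mono)
  qed simp
  have intZ: "integrable M (\<lambda>\<omega>. Z i \<omega> ^ j)" if "i \<ge> 1" for i j
  proof (rule integrable_const_bound[where B = "1"])
    show "AE \<omega> in M. norm (Z i \<omega> ^ j) \<le> 1"
      using bd that by (auto simp: power_abs intro!: power_le_one)
  qed (use rvZ that in simp)
  have "0 \<le> expectation (\<lambda>\<omega>. Z 1 \<omega> ^ 2)" by simp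
  then have p0: "p \<ge> 0" using var[of 1] by linarith
  have prod: "expectation (\<lambda>\<omega>. S n \<omega> ^ a * Z (Suc n) \<omega> ^ b) =
      expectation (\<lambda>\<omega>. S n \<omega> ^ a) * expectation (\<lambda>\<omega>. Z (Suc n) \<omega> ^ b)"
    and intp: "integrable M (\<lambda>\<omega>. S n \<omega> ^ a * Z (Suc n) \<omega> ^ b)" for n a b
  proof -
    have "indep_vars (\<lambda>_. borel) Z (insert (Suc n) {1..n})"
      by (rule indep_vars_subset[OF indep]) auto
    then have "indep_var borel (Z (Suc n)) borel (S n)"
      unfolding S_def by (intro indep_vars_sum) auto
    then have i: "indep_var borel (\<lambda>\<omega>. Z (Suc n) \<omega> ^ b) borel (\<lambda>\<omega>. S n \<omega> ^ a)"
      using indep_var_compose[of borel "Z (Suc n)" borel "S n" "\<lambda>x. x ^ b" borel "\<lambda>x. x ^ a" borel]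
      by (simp add: comp_def)
    show "expectation (\<lambda>\<omega>. S n \<omega> ^ a * Z (Suc n) \<omega> ^ b) =
      expectation (\<lambda>\<omega>. S n \<omega> ^ a) * expectation (\<lambda>\<omega>. Z (Suc n) \<omega> ^ b)"
      using indep_var_lebesgue_integral[OF i intZ intS] by (simp add: mult.commute)
    show "integrable M (\<lambda>\<omega>. S n \<omega> ^ a * Z (Suc n) \<omega> ^ b)"
      using indep_var_integrable[OF i intZ intS] by (simp add: mult.commute)
  qed
  note p11 = prod[of _ 1 1, simplified] and i11 = intp[of _ 1 1, simplified]
    and p31 = prod[of _ 3 1, simplified] and i31 = intp[of _ 3 1, simplified]
    and p13 = prod[of _ 1 3, simplified] and i13 = intp[of _ 1 3, simplified]
    and intS1 = intS[of _ 1, simplified] and intZ1 = intZ[of _ 1, simplified]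
  have S_Suc: "S (Suc n) \<omega> = S n \<omega> + Z (Suc n) \<omega>" for n \<omega> by (simp add: S_def)
  have m: "expectation (S n) = 0" for n
    unfolding S_def using mean intZ1 by (subst Bochner_Integration.integral_sum) auto
  then show "expectation (S n) = 0" .
  have v: "expectation (\<lambda>\<omega>. S n \<omega> ^ 2) \<le> real n * p" for n
  proof (induction n)
    case (Suc n)
    have "expectation (\<lambda>\<omega>. S (Suc n) \<omega> ^ 2) =
        expectation (\<lambda>\<omega>. S n \<omega> ^ 2 + 2 * (S n \<omega> * Z (Suc n) \<omega>) + Z (Suc n) \<omega> ^ 2)"
      unfolding S_Suc by (intro Bochner_Integration.integral_cong) (auto simp: power2_eq_square
          algebra_simps)
    also have "\<dots> = expectation (\<lambda>\<omega>. S n \<omega> ^ 2) + expectation (\<lambda>\<omega>. Z (Suc n) \<omega> ^ 2)"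
      using intS[of n 2] intZ[of "Suc n" 2] i11[of n] p11[of n] m[of n] by simp
    also have "\<dots> \<le> real (Suc n) * p" using Suc.IH var[of "Suc n"] by (simp add: algebra_simps)
    finally show ?case .
  qed (simp add: S_def)
  then show "expectation (\<lambda>\<omega>. S n \<omega> ^ 2) \<le> real n * p" .
  have "expectation (\<lambda>\<omega>. S n \<omega> ^ 4) \<le> real n * p + 3 * (real n)\<^sup>2 * p\<^sup>2" for n
  proof (induction n)
    case (Suc n)
    have Z4: "expectation (\<lambda>\<omega>. Z (Suc n) \<omega> ^ 4) \<le> p"
    proof -
      have "expectation (\<lambda>\<omega>. Z (Suc n) \<omega> ^ 4) \<le> expectation (\<lambda>\<omega>. Z (Suc n) \<omega> ^ 2)"
      proof (rule integral_mono[OF intZ intZ])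
        fix \<omega> assume "\<omega> \<in> space M"
        then have "Z (Suc n) \<omega> ^ 2 \<le> 1" using bd[of \<omega> "Suc n"] by (simp add: abs_square_le_1)
        then have "Z (Suc n) \<omega> ^ 2 * Z (Suc n) \<omega> ^ 2 \<le> 1 * Z (Suc n) \<omega> ^ 2"
          by (intro mult_right_mono) auto
        then show "Z (Suc n) \<omega> ^ 4 \<le> Z (Suc n) \<omega> ^ 2" by (simp flip: power_add)
      qed auto
      then show ?thesis using var[of "Suc n"] by simp
    qed
    have Z2: "0 \<le> expectation (\<lambda>\<omega>. Z (Suc n) \<omega> ^ 2)" by simp
    have "expectation (\<lambda>\<omega>. S (Suc n) \<omega> ^ 4) =
        expectation (\<lambda>\<omega>. S n \<omega> ^ 4 + 4 * (S n \<omega> ^ 3 * Z (Suc n) \<omega>)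
            + 6 * (S n \<omega> ^ 2 * Z (Suc n) \<omega> ^ 2)
          + 4 * (S n \<omega> * Z (Suc n) \<omega> ^ 3) + Z (Suc n) \<omega> ^ 4)"
      unfolding S_Suc by (intro Bochner_Integration.integral_cong) (auto simp: power2_eq_square
          power3_eq_cube power4_eq_xxxx algebra_simps)
    also have "\<dots> = expectation (\<lambda>\<omega>. S n \<omega> ^ 4)
        + 6 * (expectation (\<lambda>\<omega>. S n \<omega> ^ 2) * expectation (\<lambda>\<omega>. Z (Suc n) \<omega> ^ 2)) + expectation
            (\<lambda>\<omega>. Z (Suc n) \<omega> ^ 4)"
      using intS[of n 4] intZ[of "Suc n" 4] i13[of n] p13[of n] i31[of n] p31[of n] intp[of n 2 2]
          prod[of n 2 2] m[of n]
        mean[of "Suc n"] by simp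
    also have "\<dots> \<le> (real n * p + 3 * (real n)\<^sup>2 * p\<^sup>2) + 6 * (real n * p * p) + p"
      using Suc.IH var[of "Suc n"] Z4 v[of n] p0 Z2 mult_nonneg_nonneg[OF of_nat_0_le_iff[of n] p0]
      by (intro add_mono mult_left_mono mult_mono) auto
    also have "\<dots> \<le> real (Suc n) * p + 3 * (real (Suc n))\<^sup>2 * p\<^sup>2"
      by (simp add: power2_eq_square algebra_simps)
    finally show ?case .
  qed (simp add: S_def)
  then show "expectation (\<lambda>\<omega>. S n \<omega> ^ 4) \<le> real n * p + 3 * (real n)\<^sup>2 * p\<^sup>2" .
qed

text \<open>The values of \<open>s\<close> at even indices form the same structure with one level
  less, and an odd index is one finest step beyond an even one. Hence each level is paid for at most
  once.\<close>

lemma dyadic_chaining: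
  fixes s :: "nat \<Rightarrow> real" and c :: "nat \<Rightarrow> real"
  assumes "\<And>l i. l \<le> r \<Longrightarrow> i < 2 ^ l \<Longrightarrow> \<bar>s ((i + 1) * 2 ^ (r - l)) - s (i * 2 ^ (r - l))\<bar> \<le> c l"
    and "i \<le> 2 ^ r"
  shows "\<bar>s i - s 0\<bar> \<le> (\<Sum>l\<le>r. c l)"
  using assms
proof (induction r arbitrary: s i)
  case 0
  have "\<bar>s 1 - s 0\<bar> \<le> c 0" using 0(1)[of 0 0] by simp
  moreover have "i = 0 \<or> i = 1" using 0(2) by auto
  ultimately show ?case by auto
next
  case (Suc r)
  have even: "\<bar>s (2 * j) - s 0\<bar> \<le> (\<Sum>l\<le>r. c l)" if "j \<le> 2 ^ r" for j
  proof -
    have "\<bar>(\<lambda>j. s (2 * j)) ((i + 1) * 2 ^ (r - l)) - (\<lambda>j. s (2 * j)) (i * 2 ^ (r - l))\<bar> \<le> c l"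
      if "l \<le> r" "i < 2 ^ l" for l i
      using Suc.prems(1)[of l i] that by (simp add: Suc_diff_le mult.left_commute)
    from Suc.IH[of "\<lambda>j. s (2 * j)", OF this that] show ?thesis by simp
  qed
  have last: "\<bar>s (j + 1) - s j\<bar> \<le> c (Suc r)" if "j < 2 ^ Suc r" for j
    using Suc.prems(1)[of "Suc r" j] that by simp
  have "0 \<le> c (Suc r)" using last[of 0] by (meson abs_ge_zero order_trans zero_less_numeral
      zero_less_power)
  show ?case
  proof (cases "even i")
    case True
    then obtain j where "i = 2 * j" by auto
    then show ?thesis using even[of j] Suc.prems(2) \<open>0 \<le> c (Suc r)\<close> by simp
  next
    case False
    then obtain j where j: "i = 2 * j + 1" by (auto elim: oddE)
    then have "2 * j < 2 ^ Suc r" "j \<le> 2 ^ r" using Suc.prems(2) by auto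
    then show ?thesis using even[of j] last[of "2 * j"] j by simp
  qed
qed

text \<open>Level \<open>l\<close> has \<open>2 ^ l\<close> blocks with fourth moments at most
  \<open>A / 4 ^ l\<close>. After Markov's inequality and the union bound a factor
  \<open>1 / 2 ^ l\<close> remains; it is spent on geometrically decreasing allowances for the
  increments, which then sum to at most \<open>c\<close>.\<close>

lemma (in prob_space) dyadic_maximal_inequality:
  fixes S :: "nat \<Rightarrow> 'a \<Rightarrow> real"
  assumes [measurable]: "\<And>i. random_variable borel (S i)"
    and int: "\<And>l i. l \<le> r \<Longrightarrow> i < 2 ^ l \<Longrightarrow>
        integrable M (\<lambda>\<omega>. (S ((i + 1) * 2 ^ (r - l)) \<omega> - S (i * 2 ^ (r - l)) \<omega>) ^ 4)"
    and mom: "\<And>l i. l \<le> r \<Longrightarrow> i < 2 ^ l \<Longrightarrow>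
        expectation (\<lambda>\<omega>. (S ((i + 1) * 2 ^ (r - l)) \<omega> - S (i * 2 ^ (r - l)) \<omega>) ^ 4) \<le> A / 4 ^ l"
    and "c > 0" "A \<ge> 0"
  shows "prob {\<omega> \<in> space M. \<exists>i\<le>2 ^ r. \<bar>S i \<omega> - S 0 \<omega>\<bar> > c} \<le> 50000 * A / c ^ 4"
proof -
  text \<open>These levels sum to at most \<open>c\<close>, and \<open>(9/10)\<^sup>4 > 1/2\<close> makes the union bound summable.\<close>
  define b where "b l = c / 10 * (9/10) ^ l" for l :: nat
  have b: "b l > 0" for l using \<open>c > 0\<close> by (simp add: b_def)
  define E where "E l i = {\<omega> \<in> space M. \<bar>S ((i + 1) * 2 ^ (r - l)) \<omega> - S (i * 2 ^ (r - l)) \<omega>\<bar> > b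
      l}" for l i
  have [measurable]: "E l i \<in> events" for l i unfolding E_def by measurable
  have sum_b: "(\<Sum>l\<le>r. b l) \<le> c"
  proof -
    have "(\<Sum>l\<le>r. (9/10 :: real) ^ l) \<le> 10" by (simp add: sum_gp0 )
    then have "c / 10 * (\<Sum>l\<le>r. (9/10 :: real) ^ l) \<le> c / 10 * 10"
      using \<open>c > 0\<close> by (intro mult_left_mono) auto
    then show ?thesis unfolding b_def sum_distrib_left by simp
  qed
  have "{\<omega> \<in> space M. \<exists>i\<le>2 ^ r. \<bar>S i \<omega> - S 0 \<omega>\<bar> > c} \<subseteq> (\<Union>l\<le>r. \<Union>i<2 ^ l. E l i)"
  proof
    fix \<omega> assume w: "\<omega> \<in> {\<omega> \<in> space M. \<exists>i\<le>2 ^ r. \<bar>S i \<omega> - S 0 \<omega>\<bar> > c}"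
    then obtain i where i: "i \<le> 2 ^ r" "\<bar>S i \<omega> - S 0 \<omega>\<bar> > c" by auto
    show "\<omega> \<in> (\<Union>l\<le>r. \<Union>i<2 ^ l. E l i)"
    proof (rule ccontr)
      assume "\<not> ?thesis"
      then have "\<bar>S ((i + 1) * 2 ^ (r - l)) \<omega> - S (i * 2 ^ (r - l)) \<omega>\<bar> \<le> b l"
          if "l \<le> r" "i < 2 ^ l" for l i
        using w that by (force simp: E_def)
      from dyadic_chaining[of r "\<lambda>i. S i \<omega>", OF this i(1)] show False using sum_b i(2) by simp
    qed
  qed
  then have "prob {\<omega> \<in> space M. \<exists>i\<le>2 ^ r. \<bar>S i \<omega> - S 0 \<omega>\<bar> > c} \<le> prob (\<Union>l\<le>r. \<Union>i<2 ^ l. E l i)"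
    by (rule finite_measure_mono) measurable
  also have "\<dots> \<le> (\<Sum>l\<le>r. prob (\<Union>i<2 ^ l. E l i))"
    by (rule finite_measure_subadditive_finite) auto
  also have "\<dots> \<le> (\<Sum>l\<le>r. \<Sum>i<2 ^ l. prob (E l i))"
    by (intro sum_mono finite_measure_subadditive_finite) auto
  also have "\<dots> \<le> (\<Sum>l\<le>r. \<Sum>i<(2::nat) ^ l. A / 4 ^ l / b l ^ 4)"
  proof (intro sum_mono)
    fix l i assume li: "l \<in> {..r}" "i \<in> {..<(2::nat) ^ l}"
    have "prob (E l i) \<le> expectation (\<lambda>\<omega>. (S ((i + 1) * 2 ^ (r - l)) \<omega> - S (i * 2 ^ (r - l)) \<omega>) ^
        4) / b l ^ 4"
      unfolding E_def using int[of l i] li b by (intro prob_abs_gt_le_fourth_moment) auto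
    also have "\<dots> \<le> A / 4 ^ l / b l ^ 4"
      using mom[of l i] li b[of l] by (intro divide_right_mono) auto
    finally show "prob (E l i) \<le> A / 4 ^ l / b l ^ 4" .
  qed
  \<comment> \<open>\<open>10000\<close> is the fourth power of the 10 in \<open>c / 10\<close>, and
    \<open>5000/6561\<close> is \<open>1/2\<close> divided by \<open>(9/10) ^ 4\<close>. The
    geometric series with this ratio sums to \<open>6561/1561\<close>, which is below 5; hence
    \<open>50000\<close>.\<close>
  also have "\<dots> = (\<Sum>l\<le>r. (10000 * A / c ^ 4) * (5000/6561) ^ l)"
  proof (intro sum.cong refl)
    fix l :: nat
    have "b l ^ 4 = c ^ 4 / 10000 * (6561/10000) ^ l"
    proof -
      have "((9/10 :: real) ^ l) ^ 4 = ((9/10) ^ 4) ^ l" by (metis power_mult mult.commute)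
      also have "(9/10 :: real) ^ 4 = 6561/10000" by (simp add: power4_eq_xxxx)
      finally have "(c / 10) ^ 4 * ((9/10) ^ l) ^ 4 = c ^ 4 / 10000 * (6561/10000) ^ l"
        by (simp add: power4_eq_xxxx)
      then show ?thesis by (simp only: b_def power_mult_distrib)
    qed
    then have "(\<Sum>i<(2::nat) ^ l. A / 4 ^ l / b l ^ 4)
        = 2 ^ l * (A / 4 ^ l / (c ^ 4 / 10000 * (6561/10000) ^ l))"
      by (simp only: sum_constant card_lessThan of_nat_power of_nat_numeral)
    also have "\<dots> = (10000 * A / c ^ 4) * (2 / (4 * (6561/10000))) ^ l"
      using \<open>c > 0\<close> by (simp add: power_divide power_mult_distrib field_simps)
        (simp flip: power_mult_distrib)
    finally show "(\<Sum>i<(2::nat) ^ l. A / 4 ^ l / b l ^ 4) = (10000 * A / c ^ 4) * (5000/6561) ^ l"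
      by simp
  qed
  also have "\<dots> = (10000 * A / c ^ 4) * (\<Sum>l\<le>r. (5000/6561) ^ l)" by (simp add: sum_distrib_left)
  also have "\<dots> \<le> (10000 * A / c ^ 4) * 5"
  proof (intro mult_left_mono)
    have "(\<Sum>l\<le>r. (5000/6561 :: real) ^ l) = (1 - (5000/6561) ^ Suc r) / (1 - 5000/6561)"
      by (simp add: sum_gp0)
    also have "\<dots> \<le> 1 / (1 - 5000/6561)" by (intro divide_right_mono) auto
    finally show "(\<Sum>l\<le>r. (5000/6561 :: real) ^ l) \<le> 5" by simp
  qed (use assms in auto)
  finally show ?thesis by simp
qed

text \<open>A row has \<open>n\<close> i.i.d. terms of size \<open>O(1 / sqrt (k n))\<close> and
  variance about \<open>v / n\<close>, so the Taylor error of one characteristic function,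
  multiplied by \<open>n\<close>, is \<open>O(1 / sqrt (k n)) + O(1 / n)\<close>.\<close>

lemma (in prob_space) triangular_clt_iexp:
  fixes X :: "nat \<Rightarrow> 'a \<Rightarrow> real" and h :: "nat \<Rightarrow> real \<Rightarrow> real" and k :: "nat \<Rightarrow> nat"
  assumes indep: "indep_vars (\<lambda>_. borel) X {1..}"
    and D: "\<And>i. i \<ge> 1 \<Longrightarrow> distr M borel (X i) = D"
    and [measurable]: "\<And>n. h n \<in> borel_measurable borel"
    and bd: "\<And>n x. \<bar>h n x\<bar> \<le> C"
    and k: "filterlim k at_top sequentially" "(\<lambda>n. real (k n) / real n) \<longlonglongrightarrow> 0"
    and m1: "(\<lambda>n. real n / real (k n) * (\<integral>x. h n x \<partial>D)) \<longlonglongrightarrow> \<mu>"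
    and m2: "(\<lambda>n. real n / real (k n) * (\<integral>x. h n x ^ 2 \<partial>D)) \<longlonglongrightarrow> v"
  shows "(\<lambda>n. expectation (\<lambda>\<omega>. iexp ((\<Sum>i\<in>{1..n}. h n (X i \<omega>) - (\<integral>x. h n x \<partial>D)) / sqrt
      (real (k n)))))
           \<longlonglongrightarrow> complex_of_real (exp (- v / 2))"
proof -
  have rvX[measurable]: "random_variable borel (X i)" if "i \<ge> 1" for i
    using indep that unfolding indep_vars_def2 by auto
  have D1: "D = distr M borel (X 1)" using D[of 1] by simp
  interpret D: real_distribution D unfolding D1 by (rule real_distribution_distr) simp
  have setsD[measurable_cong]: "sets D = sets borel" by simp
  have [simp]: "measure D UNIV = 1" using D.prob_space by simp
  have C: "C \<ge> 0" using bd[of 0 0] by linarith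
  define m where "m n = (\<integral>x. h n x \<partial>D)" for n
  define Y where "Y n x = h n x - m n" for n x
  have [measurable]: "Y n \<in> borel_measurable borel" for n unfolding Y_def by measurable
  have inth: "integrable D (\<lambda>x. h n x ^ j)" for n j
    by (rule D.integrable_const_bound[where B = "C ^ j"])
       (auto simp: power_abs intro!: power_mono bd)
  note inth1 = inth[of _ 1, simplified]
  have mC: "\<bar>m n\<bar> \<le> C" for n
  proof -
    have "\<bar>m n\<bar> \<le> (\<integral>x. \<bar>h n x\<bar> \<partial>D)" unfolding m_def by (rule integral_abs_bound)
    also have "\<dots> \<le> (\<integral>x. C \<partial>D)" using bd inth1 by (intro integral_mono) auto
    also have "\<dots> = C" by simp
    finally show ?thesis .
  qed
  have YC: "\<bar>Y n x\<bar> \<le> 2 * C" for n x unfolding Y_def using bd[of n x] mC[of n] by linarith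
  have intY: "integrable D (\<lambda>x. Y n x ^ j)" for n j
  proof (rule D.integrable_const_bound[where B = "(2 * C) ^ j"])
    show "AE x in D. norm (Y n x ^ j) \<le> (2 * C) ^ j"
      unfolding real_norm_def power_abs by (intro AE_I2 power_mono YC) simp
  qed simp
  note intY1 = intY[of _ 1, simplified]
  have EY: "(\<integral>x. Y n x \<partial>D) = 0" for n
    unfolding Y_def using inth1 by (simp add: m_def)
  define s2 where "s2 n = (\<integral>x. Y n x ^ 2 \<partial>D)" for n
  have s2_nonneg: "s2 n \<ge> 0" for n unfolding s2_def by simp
  have s2: "s2 n = (\<integral>x. h n x ^ 2 \<partial>D) - m n ^ 2" for n
  proof -
    have "s2 n = (\<integral>x. h n x ^ 2 - 2 * m n * h n x + m n ^ 2 \<partial>D)"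
      unfolding s2_def Y_def by (intro Bochner_Integration.integral_cong)
          (auto simp: power2_eq_square algebra_simps)
    also have "\<dots> = (\<integral>x. h n x ^ 2 \<partial>D) - 2 * m n * m n + m n ^ 2"
      using inth[of n 2] inth1[of n] by (simp add: m_def)
    finally show ?thesis by (simp add: power2_eq_square)
  qed
  have k_inf: "filterlim (\<lambda>n. real (k n)) at_top sequentially"
    using k(1) filterlim_real_sequentially filterlim_compose by blast
  have k0: "eventually (\<lambda>n. k n > 0) sequentially"
    using k(1)[unfolded filterlim_at_top, rule_format, of 1] by eventually_elim simp
  \<comment> \<open>By \<open>m1\<close> the mean is \<open>O(k n / n)\<close>; its square times
    \<open>n / k n\<close> is again \<open>O(k n / n)\<close> and vanishes. Raw and centred second
    moments thus have the same rescaled limit.\<close>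
  have s2_lim: "(\<lambda>n. real n / real (k n) * s2 n) \<longlonglongrightarrow> v"
  proof -
    have "(\<lambda>n. real n / real (k n) * (\<integral>x. h n x ^ 2 \<partial>D)
        - (real n / real (k n) * m n)\<^sup>2 * (real (k n) / real n)) \<longlonglongrightarrow> v - \<mu>\<^sup>2 * 0"
      using m1 m2 k(2) unfolding m_def by (intro tendsto_intros)
    moreover have "eventually (\<lambda>n. real n / real (k n) * (\<integral>x. h n x ^ 2 \<partial>D)
        - (real n / real (k n) * m n)\<^sup>2 * (real (k n) / real n)
            = real n / real (k n) * s2 n) sequentially"
      using k0 eventually_gt_at_top[of 0]
      by eventually_elim (simp add: s2 field_simps power2_eq_square)
    ultimately show ?thesis by (simp add: Lim_transform_eventually)
  qed
  define x where "x n = s2 n / (2 * real (k n))" for n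
  define \<psi> where "\<psi> n = expectation (\<lambda>\<omega>. iexp (Y n (X 1 \<omega>) / sqrt (real (k n))))" for n
  have \<psi>_D: "expectation (\<lambda>\<omega>. iexp (Y n (X i \<omega>) / sqrt (real (k n)))) = \<psi> n" if "i \<ge> 1" for i n
  proof -
    have "expectation (\<lambda>\<omega>. iexp (Y n (X j \<omega>) / sqrt (real (k n))))
        = (\<integral>x. iexp (Y n x / sqrt (real (k n))) \<partial>D)"
      if "j \<ge> 1" for j
      using that by (subst D[OF that, symmetric], subst integral_distr) auto
    then show ?thesis using that by (simp add: \<psi>_def)
  qed
  have prod: "expectation (\<lambda>\<omega>. iexp ((\<Sum>i\<in>{1..n}. h n (X i \<omega>) - m n) / sqrt (real (k n))))
      = \<psi> n ^ n" for n
  proof -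
    have "expectation (\<lambda>\<omega>. iexp ((\<Sum>i\<in>{1..n}. h n (X i \<omega>) - m n) / sqrt (real (k n)))) =
        char (distr M borel (\<lambda>\<omega>. \<Sum>i\<in>{1..n}. Y n (X i \<omega>) / sqrt (real (k n)))) 1"
      unfolding char_def Y_def
      by (subst integral_distr) (auto simp: sum_divide_distrib intro!: borel_measurable_sum)
    also have "\<dots> = (\<Prod>i\<in>{1..n}. char (distr M borel (\<lambda>\<omega>. Y n (X i \<omega>) / sqrt (real (k n)))) 1)"
    proof (rule char_distr_sum)
      show "indep_vars (\<lambda>i. borel) (\<lambda>i \<omega>. Y n (X i \<omega>) / sqrt (real (k n))) {1..n}"
        using indep_vars_subset[OF indep, of "{1..n}"]
        by (rule indep_vars_compose2[where X = X]) auto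
    qed
    also have "\<dots> = (\<Prod>i\<in>{1..n}. \<psi> n)"
    proof (intro prod.cong refl)
      fix i assume i: "i \<in> {1..n}"
      then have "char (distr M borel (\<lambda>\<omega>. Y n (X i \<omega>) / sqrt (real (k n)))) 1 =
          expectation (\<lambda>\<omega>. iexp (Y n (X i \<omega>) / sqrt (real (k n))))"
        unfolding char_def by (subst integral_distr) auto
      then show "char (distr M borel (\<lambda>\<omega>. Y n (X i \<omega>) / sqrt (real (k n)))) 1 = \<psi> n"
        using \<psi>_D i by simp
    qed
    finally show ?thesis by simp
  qed
  have x_nonneg: "x n \<ge> 0" for n using s2_nonneg by (simp add: x_def)
  \<comment> \<open>These are \<open>n\<close> times the cubic term
    \<open>t^3 * 2 * C * s2 n / 6\<close> with \<open>t = 1 / sqrt (k n)\<close>, and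
    \<open>n\<close> times \<open>(x n)\<^sup>2\<close>, both expressed through the convergent
    quantity \<open>n / k n * s2 n\<close>. Comparing with \<open>exp (- x n)\<close> and not with
    \<open>1 - x n\<close> keeps both bases in the unit disc, as \<open>norm_power_diff\<close>
    requires.\<close>
  have approx: "cmod (\<psi> n ^ n - complex_of_real (exp (- x n)) ^ n) \<le>
      (real n / real (k n) * s2 n) * (C / 3) * (1 / sqrt (real (k n)))
      + (real n / real (k n) * s2 n)\<^sup>2 / 4 * (1 / real n)" if n: "n > 0" "k n > 0" for n
  proof -
    define t where "t = 1 / sqrt (real (k n))"
    have t2: "t\<^sup>2 = 1 / real (k n)" using n by (simp add: t_def power_divide)
    have t0: "t > 0" using n by (simp add: t_def)
    have "cmod (char (distr D borel (Y n)) t - (1 - t^2 * s2 n / 2)) \<le>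
        (t^2 / 6) * D.expectation (\<lambda>x. min (6 * (Y n x)^2) (\<bar>t\<bar> * \<bar>Y n x\<bar>^3))"
      using intY[of n 2] intY1[of n] EY[of n]
      by (intro D.char_approx3') (auto simp: s2_def)
    also have "D.expectation (\<lambda>x. min (6 * (Y n x)^2) (\<bar>t\<bar> * \<bar>Y n x\<bar>^3))
        \<le> D.expectation (\<lambda>x. t * (2 * C) * Y n x ^ 2)"
    proof (rule integral_mono)
      show "integrable D (\<lambda>x. t * (2 * C) * Y n x ^ 2)" using intY[of n 2] by simp
      show "integrable D (\<lambda>x. min (6 * (Y n x)^2) (\<bar>t\<bar> * \<bar>Y n x\<bar>^3))"
      proof (rule Bochner_Integration.integrable_bound)
        show "integrable D (\<lambda>x. 6 * (Y n x)^2)" using intY[of n 2] by simp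
        have "\<bar>min a b\<bar> \<le> \<bar>a\<bar>" if "0 \<le> a" "0 \<le> b" for a b :: real using that by linarith
        then show "AE x in D. norm (min (6 * (Y n x)^2) (\<bar>t\<bar> * \<bar>Y n x\<bar>^3)) \<le> norm (6 * (Y n x)^2)"
          by (intro AE_I2) simp
      qed simp
      fix x
      have "\<bar>Y n x\<bar> ^ 3 = \<bar>Y n x\<bar> * Y n x ^ 2"
        by (simp add: power3_eq_cube power2_eq_square abs_mult)
      also have "\<dots> \<le> 2 * C * Y n x ^ 2" using YC by (intro mult_right_mono) auto
      finally show "min (6 * (Y n x)^2) (\<bar>t\<bar> * \<bar>Y n x\<bar>^3) \<le> t * (2 * C) * Y n x ^ 2"
        using t0 by (simp add: min.coboundedI2)
    qed
    also have "\<dots> = t * (2 * C) * s2 n" by (simp add: s2_def)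
    also have "char (distr D borel (Y n)) t = \<psi> n"
    proof -
      have "char (distr D borel (Y n)) t = (\<integral>x. iexp (t * Y n x) \<partial>D)"
        unfolding char_def by (subst integral_distr) auto
      also have "\<dots> = (\<integral>x. iexp (Y n x / sqrt (real (k n))) \<partial>D)" by (simp add: t_def)
      also have "\<dots> = \<psi> n" unfolding D1 \<psi>_def by (subst integral_distr) auto
      finally show ?thesis .
    qed
    also have "t^2 * s2 n / 2 = x n" by (simp add: t2 x_def)
    finally have 1: "cmod (\<psi> n - complex_of_real (1 - x n)) \<le> (t^2 / 6) * (t * (2 * C) * s2 n)"
      by (simp add: mult_left_mono)
    have "exp (- x n) \<ge> 1 - x n" using exp_ge_add_one_self[of "- x n"] by simp
    moreover have "exp (- x n) \<le> 1 - x n + (x n)\<^sup>2"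
    proof -
      \<comment> \<open>From \<open>1 + x \<le> exp x\<close> and
        \<open>(1 + x) * (1 - x + x\<^sup>2) = 1 + x ^ 3\<close>.\<close>
      have "1 \<le> exp (x n) * (1 - x n + (x n)\<^sup>2)"
      proof -
        have "(1 + x n) * (1 - x n + (x n)\<^sup>2) = 1 + x n ^ 3"
          by (simp add: power2_eq_square power3_eq_cube algebra_simps)
        moreover have "(1 + x n) * (1 - x n + (x n)\<^sup>2) \<le> exp (x n) * (1 - x n + (x n)\<^sup>2)"
        proof (rule mult_right_mono)
          have "0 \<le> (x n - 1/2)\<^sup>2" by simp
          then show "0 \<le> 1 - x n + (x n)\<^sup>2" by (simp add: power2_eq_square algebra_simps)
        qed simp
        moreover have "0 \<le> x n ^ 3" using x_nonneg by simp
        ultimately show ?thesis by linarith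
      qed
      then show ?thesis by (simp add: exp_minus field_simps)
    qed
    ultimately have 2: "cmod (complex_of_real (1 - x n) - complex_of_real (exp (- x n))) \<le> (x n)\<^sup>2"
      unfolding of_real_diff[symmetric] norm_of_real by linarith
    have "cmod (\<psi> n) \<le> 1"
      unfolding \<psi>_def by (rule order_trans[OF integral_norm_bound]) (simp add: prob_space)
    moreover have "cmod (complex_of_real (exp (- x n))) \<le> 1"
      using x_nonneg by (simp del: of_real_exp)
    ultimately have "cmod (\<psi> n ^ n - complex_of_real (exp (- x n)) ^ n)
        \<le> n * cmod (\<psi> n - complex_of_real (exp (- x n)))"
      by (rule norm_power_diff)
    also have "\<dots> \<le> n * ((t^2 / 6) * (t * (2 * C) * s2 n) + (x n)\<^sup>2)"
      using norm_triangle_ineq[of "\<psi> n - complex_of_real (1 - x n)"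
          "complex_of_real (1 - x n) - complex_of_real (exp (- x n))"] 1 2
      by (intro mult_left_mono) auto
    also have "\<dots> = (real n / real (k n) * s2 n) * (C / 3) * (1 / sqrt (real (k n)))
      + (real n / real (k n) * s2 n)\<^sup>2 / 4 * (1 / real n)"
      unfolding t2 using n by (simp add: t_def x_def field_simps power2_eq_square)
    finally show ?thesis .
  qed
  have "(\<lambda>n. \<psi> n ^ n - complex_of_real (exp (- x n)) ^ n) \<longlonglongrightarrow> 0"
  proof (rule Lim_null_comparison)
    show "eventually (\<lambda>n. cmod (\<psi> n ^ n - complex_of_real (exp (- x n)) ^ n) \<le>
      (real n / real (k n) * s2 n) * (C / 3) * (1 / sqrt (real (k n)))
      + (real n / real (k n) * s2 n)\<^sup>2 / 4 * (1 / real n)) sequentially"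
      using k0 eventually_gt_at_top[of 0] by eventually_elim (rule approx)
    have "(\<lambda>n. 1 / sqrt (real (k n))) \<longlonglongrightarrow> 0"
      by (intro tendsto_divide_0[OF tendsto_const] filterlim_at_top_imp_at_infinity
          filterlim_compose[OF sqrt_at_top k_inf])
    from tendsto_add[OF tendsto_mult[OF tendsto_mult[OF s2_lim tendsto_const[of "C/3"]] this]
        tendsto_mult[OF tendsto_divide[OF tendsto_power[OF s2_lim, of 2] tendsto_const[of 4]]
            lim_1_over_n]]
    show "(\<lambda>n. (real n / real (k n) * s2 n) * (C / 3) * (1 / sqrt (real (k n)))
      + (real n / real (k n) * s2 n)\<^sup>2 / 4 * (1 / real n)) \<longlonglongrightarrow> 0" by simp
  qed
  moreover have "(\<lambda>n. complex_of_real (exp (- x n)) ^ n) \<longlonglongrightarrow> complex_of_real (exp (- v / 2))"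
  proof -
    have eq: "complex_of_real (exp (- x n)) ^ n
        = complex_of_real (exp (- (real n / real (k n) * s2 n) / 2))" for n
      by (simp del: of_real_exp add: x_def flip: of_real_power exp_of_nat_mult)
    show ?thesis unfolding eq using s2_lim by (intro tendsto_intros) auto
  qed
  ultimately have "(\<lambda>n. \<psi> n ^ n) \<longlonglongrightarrow> complex_of_real (exp (- v / 2))"
    using tendsto_add by fastforce
  then show ?thesis unfolding prod[symmetric] m_def .
qed

section \<open>A multivariate continuity theorem\<close>

lemma (in prob_space) expectation_diff_le:
  fixes f g :: "'a \<Rightarrow> real"
  assumes [measurable]: "f \<in> borel_measurable M" "g \<in> borel_measurable M" "E \<in> events"
    and K: "\<And>\<omega>. \<omega> \<in> space M \<Longrightarrow> \<bar>f \<omega>\<bar> \<le> K" "\<And>\<omega>. \<omega> \<in> space M \<Longrightarrow> \<bar>g \<omega>\<bar> \<le> K"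
    and e: "\<And>\<omega>. \<omega> \<in> space M - E \<Longrightarrow> \<bar>f \<omega> - g \<omega>\<bar> \<le> \<epsilon>" "\<epsilon> \<ge> 0"
  shows "\<bar>expectation f - expectation g\<bar> \<le> \<epsilon> + 2 * K * prob E"
proof -
  have i: "integrable M f" "integrable M g"
    using K by (auto intro!: integrable_const_bound[of _ K])
  have "\<bar>expectation f - expectation g\<bar> = \<bar>expectation (\<lambda>\<omega>. f \<omega> - g \<omega>)\<bar>" using i by simp
  also have "\<dots> \<le> expectation (\<lambda>\<omega>. \<bar>f \<omega> - g \<omega>\<bar>)" by (rule integral_abs_bound)
  also have "\<dots> \<le> expectation (\<lambda>\<omega>. \<epsilon> + 2 * K * indicator E \<omega>)"
  proof (rule integral_mono)
    show "integrable M (\<lambda>\<omega>. \<bar>f \<omega> - g \<omega>\<bar>)" using i by auto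
    show "integrable M (\<lambda>\<omega>. \<epsilon> + 2 * K * indicator E \<omega>)"
      by (intro Bochner_Integration.integrable_add integrable_mult_right integrable_real_indicator)
        (auto simp: emeasure_eq_measure)
    fix \<omega> assume w: "\<omega> \<in> space M"
    show "\<bar>f \<omega> - g \<omega>\<bar> \<le> \<epsilon> + 2 * K * indicator E \<omega>"
    proof (cases "\<omega> \<in> E")
      case True
      have "\<bar>f \<omega> - g \<omega>\<bar> \<le> 2 * K" using K[OF w] by linarith
      then show ?thesis using True e(2) by simp
    next
      case False
      then show ?thesis using e(1)[of \<omega>] w by simp
    qed
  qed
  also have "\<dots> = \<epsilon> + 2 * K * prob E" by (simp add: prob_space emeasure_eq_measure)
  finally show ?thesis .
qed

text \<open>The complex span of the characters of the first \<open>m\<close> coordinates. The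
  dimension is a number and not a type because it grows with the skeleton; vectors are therefore
  total functions on \<open>nat\<close>.\<close>

inductive trig_poly :: "nat \<Rightarrow> ((nat \<Rightarrow> real) \<Rightarrow> complex) \<Rightarrow> bool" for m where
  trig_iexp: "trig_poly m (\<lambda>v. iexp (\<Sum>i<m. a i * v i))"
| trig_scale: "trig_poly m f \<Longrightarrow> trig_poly m (\<lambda>v. z * f v)"
| trig_add: "trig_poly m f \<Longrightarrow> trig_poly m g \<Longrightarrow> trig_poly m (\<lambda>v. f v + g v)"

lemma trig_poly_const: "trig_poly m (\<lambda>v. z)"
  using trig_scale[OF trig_iexp[of m "\<lambda>_. 0"], of z] by simp

text \<open>A product of characters is a character, so the span is an algebra; the nested inductions
  are bilinearity.\<close>

lemma trig_poly_mult:
  assumes "trig_poly m f" "trig_poly m g"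
  shows "trig_poly m (\<lambda>v. f v * g v)"
  using assms
proof (induction arbitrary: g)
  case (trig_iexp a)
  from trig_iexp show ?case
  proof induction
    case (trig_iexp b)
    have "trig_poly m (\<lambda>v. iexp (\<Sum>i<m. (a i + b i) * v i))" by (rule trig_poly.trig_iexp)
    then show ?case by (simp add: distrib_left distrib_right sum.distrib exp_add)
  next
    case (trig_scale f z)
    from trig_poly.trig_scale[OF trig_scale.IH, of z] show ?case by (simp add: mult.left_commute)
  next
    case (trig_add f g)
    from trig_poly.trig_add[OF trig_add.IH] show ?case by (simp add: distrib_left)
  qed
next
  case (trig_scale f z)
  from trig_poly.trig_scale[OF trig_scale.IH[OF trig_scale.prems], of z] show ?case
    by (simp add: mult.assoc)
next
  case (trig_add f1 f2)
  from trig_poly.trig_add[OF trig_add.IH[OF trig_add.prems]] show ?case by (simp add: distrib_right)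
qed

lemma trig_poly_sin:
  assumes "j < m"
  shows "trig_poly m (\<lambda>v. complex_of_real (sin (c * v j)))"
proof -
  have s: "(\<Sum>i<m. (if i = j then b else 0) * v i) = b * v j" for v :: "nat \<Rightarrow> real" and b
    using assms by (simp add: if_distrib[of "\<lambda>x. x * _"] cong: if_cong)
  have "trig_poly m (\<lambda>v. 1 / (2 * \<i>) * iexp (\<Sum>i<m. (if i = j then c else 0) * v i)
      + - 1 / (2 * \<i>) * iexp (\<Sum>i<m. (if i = j then - c else 0) * v i))"
    by (intro trig_poly.intros)
  moreover have sin_eq: "1 / (2 * \<i>) * iexp x + - 1 / (2 * \<i>) * iexp (- x)
      = complex_of_real (sin x)" for x
    using sin_exp_eq[of "complex_of_real x"] by (simp add: sin_of_real field_simps)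
  ultimately show ?thesis unfolding s mult_minus_left sin_eq by (simp only:)
qed

lemma trig_poly_bounded: "trig_poly m f \<Longrightarrow> \<exists>K. \<forall>v. cmod (f v) \<le> K"
proof (induction rule: trig_poly.induct)
  case (trig_iexp a) then show ?case by (intro exI[of _ 1]) simp
next
  case (trig_scale f z)
  then obtain K where "\<forall>v. cmod (f v) \<le> K" by blast
  then show ?case by (intro exI[of _ "cmod z * K"]) (simp add: norm_mult mult_left_mono)
next
  case (trig_add f g)
  then obtain K K' where "\<forall>v. cmod (f v) \<le> K" "\<forall>v. cmod (g v) \<le> K'" by blast
  then show ?case by (intro exI[of _ "K + K'"]) (auto intro: norm_triangle_le add_mono)
qed

lemma trig_poly_measurable:
  assumes "trig_poly m f" and [measurable]: "\<And>i. i < m \<Longrightarrow> (\<lambda>\<omega>. V \<omega> i) \<in> borel_measurable M"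
  shows "(\<lambda>\<omega>. f (V \<omega>)) \<in> borel_measurable M"
  using assms(1) by induction (auto intro!: borel_measurable_add borel_measurable_times)

lemma (in prob_space) trig_poly_integrable:
  assumes "trig_poly m f" "\<And>i. i < m \<Longrightarrow> random_variable borel (\<lambda>\<omega>. V \<omega> i)"
  shows "integrable M (\<lambda>\<omega>. f (V \<omega>))"
proof -
  obtain K where "\<forall>v. cmod (f v) \<le> K" using trig_poly_bounded[OF assms(1)] by blast
  then show ?thesis by (intro integrable_const_bound[of _ K] trig_poly_measurable[OF assms]) auto
qed

lemma trig_poly_expectation_tendsto:
  assumes "prob_space M" "prob_space N" "trig_poly m f"
    and V: "\<And>n i. i < m \<Longrightarrow> (\<lambda>\<omega>. V n \<omega> i) \<in> borel_measurable M"
    and W: "\<And>i. i < m \<Longrightarrow> (\<lambda>\<omega>. W \<omega> i) \<in> borel_measurable N"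
    and lim: "\<And>a. (\<lambda>n. \<integral>\<omega>. iexp (\<Sum>i<m. a i * V n \<omega> i) \<partial>M) \<longlonglongrightarrow> (\<integral>\<omega>. iexp (\<Sum>i<m. a i * W \<omega> i) \<partial>N)"
  shows "(\<lambda>n. \<integral>\<omega>. f (V n \<omega>) \<partial>M) \<longlonglongrightarrow> (\<integral>\<omega>. f (W \<omega>) \<partial>N)"
proof -
  interpret M: prob_space M by fact
  interpret N: prob_space N by fact
  show ?thesis
    using assms(3)
  proof induction
    case (trig_iexp a)
    show ?case by (rule lim)
  next
    case (trig_scale f z)
    then show ?case by (simp add: tendsto_mult_left)
  next
    case (trig_add f g)
    note i = M.trig_poly_integrable[OF trig_add.hyps(1), of
        "V _", OF V] M.trig_poly_integrable[OF trig_add.hyps(2), of "V _", OF V]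
      N.trig_poly_integrable[OF trig_add.hyps(1), of W, OF W] N.trig_poly_integrable[OF
          trig_add.hyps(2), of W, OF W]
    show ?case using tendsto_add[OF trig_add.IH] by (simp add: i)
  qed
qed

lemma compact_cube:
  fixes A :: "nat \<Rightarrow> real set"
  assumes "\<And>i. compact (A i)"
  shows "compact {v. \<forall>i. v i \<in> A i}"
proof -
  have "{v. \<forall>i. v i \<in> A i} = PiE UNIV A" by (auto simp: PiE_def Pi_def)
  moreover have "compactin (product_topology (\<lambda>_. euclidean) UNIV) (PiE UNIV A)"
    using assms by (simp add: compactin_PiE)
  ultimately show ?thesis by (simp add: euclidean_product_topology)
qed

lemma continuous_on_funI:
  fixes f :: "'a::topological_space \<Rightarrow> 'b \<Rightarrow> 'c::topological_space"
  assumes "\<And>i. continuous_on S (\<lambda>x. f x i)"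
  shows "continuous_on S f"
  using assms by (rule continuous_on_coordinatewise_then_product)

text \<open>On \<open>[-P, P]\<^sup>m\<close>, \<open>h\<close> is a continuous function of the sines of the rescaled coordinates, hence
  uniformly close to a polynomial in these sines. Unlike a polynomial in the coordinates, the latter
  is bounded on the whole space.\<close>

lemma trig_poly_approx:
  fixes h :: "(nat \<Rightarrow> real) \<Rightarrow> real"
  assumes h: "continuous_on UNIV h" and dep: "\<And>v w. (\<And>i. i < m \<Longrightarrow> v i = w i) \<Longrightarrow> h v = h w"
    and bd: "\<And>v. \<bar>h v\<bar> \<le> B" and P: "P > 0" and e: "\<epsilon> > 0"
  obtains g where "trig_poly m (\<lambda>v. complex_of_real (g v))" "\<And>v. \<bar>g v\<bar> \<le> B + \<epsilon>"
    "\<And>v. (\<And>i. i < m \<Longrightarrow> \<bar>v i\<bar> \<le> P) \<Longrightarrow> \<bar>h v - g v\<bar> < \<epsilon>"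
proof -
  \<comment> \<open>Scales \<open>[-P, P]\<close> onto \<open>[-pi/2, pi/2]\<close>, where
    \<open>arcsin\<close> inverts \<open>sin\<close>.\<close>
  define c where "c = pi / (2 * P)"
  have c: "c > 0" using P by (simp add: c_def)
  \<comment> \<open>Pinning the coordinates from \<open>m\<close> on to 0 forces distinct points of
    \<open>S\<close> to differ in a coordinate below \<open>m\<close>, as point separation by
    trigonometric polynomials in these coordinates demands.\<close>
  define A where "A i = (if i < m then {-1..1} else {0 :: real})" for i :: nat
  define S where "S = {v. \<forall>i. v i \<in> A i}"
  define sn where "sn v = (\<lambda>i. if i < m then sin (c * v i) else 0)" for v :: "nat \<Rightarrow> real"
  have S: "compact S" unfolding S_def by (rule compact_cube) (simp add: A_def)
  have sn_S: "sn v \<in> S" for v by (auto simp: S_def sn_def A_def)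
  define H where "H s = h (\<lambda>i. arcsin (s i) / c)" for s
  have coord: "continuous_on T (\<lambda>s :: nat \<Rightarrow> real. s i)" for i T
    by (rule continuous_on_subset[OF continuous_on_product_coordinates]) auto
  have H: "continuous_on S H"
    unfolding H_def
  proof (rule continuous_on_compose2[OF h])
    show "continuous_on S (\<lambda>s i. arcsin (s i) / c)"
    proof (rule continuous_on_funI)
      fix i
      have "\<forall>s\<in>S. -1 \<le> s i \<and> s i \<le> 1"
      proof
        fix s assume "s \<in> S"
        then have "s i \<in> A i" by (auto simp: S_def)
        then show "-1 \<le> s i \<and> s i \<le> 1" by (auto simp: A_def split: if_splits)
      qed
      then show "continuous_on S (\<lambda>s. arcsin (s i) / c)"
        using c coord by (intro continuous_intros) auto
    qed
  qed auto
  \<comment> \<open>Besides continuity on \<open>S\<close>, the ring carries the property wanted of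
    the approximant: composed with the sines it is a trigonometric polynomial on the whole
    space.\<close>
  define R where "R = {r. continuous_on S r \<and> trig_poly m (\<lambda>v. complex_of_real (r (sn v)))}"
  interpret function_ring_on R S
  proof
    fix f g assume "f \<in> R" "g \<in> R"
    then show "(\<lambda>x. f x + g x) \<in> R" "(\<lambda>x. f x * g x) \<in> R"
      unfolding R_def by (auto intro!: continuous_intros trig_add trig_poly_mult)
  next
    fix x y assume xy: "x \<in> S" "y \<in> S" "x \<noteq> y"
    then obtain i where i: "x i \<noteq> y i" by blast
    have "i < m"
    proof (rule ccontr)
      assume "\<not> i < m"
      have "x i \<in> A i" "y i \<in> A i" using xy by (auto simp: S_def)
      then show False using i \<open>\<not> i < m\<close> by (simp add: A_def)
    qed
    then have "(\<lambda>s. s i) \<in> R"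
      unfolding R_def using trig_poly_sin[of i m c] coord by (simp add: sn_def)
    then show "\<exists>f\<in>R. f x \<noteq> f y" by (rule bexI[rotated]) (rule i)
  qed (use S in \<open>auto simp: R_def trig_poly_const\<close>)
  obtain r where r: "r \<in> R" "\<forall>s\<in>S. \<bar>H s - r s\<bar> < \<epsilon>"
    using Stone_Weierstrass_basic[OF H e] by blast
  show thesis
  proof (rule that[of "\<lambda>v. r (sn v)"])
    show "trig_poly m (\<lambda>v. complex_of_real (r (sn v)))" using r by (simp add: R_def)
    fix v
    have "\<bar>H (sn v) - r (sn v)\<bar> < \<epsilon>" using r sn_S by blast
    then show "\<bar>r (sn v)\<bar> \<le> B + \<epsilon>" using bd[of "\<lambda>i. arcsin (sn v i) / c"] unfolding H_def
      by linarith
    show "\<bar>h v - r (sn v)\<bar> < \<epsilon>" if v: "\<And>i. i < m \<Longrightarrow> \<bar>v i\<bar> \<le> P"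
    proof -
      have "arcsin (sn v i) / c = v i" if "i < m" for i
      proof -
        have "c * \<bar>v i\<bar> \<le> c * P" using v[OF that] c by (intro mult_left_mono) auto
        then have "\<bar>c * v i\<bar> \<le> pi / 2" using c P by (simp add: abs_mult c_def)
        then have "arcsin (sin (c * v i)) = c * v i" by (intro arcsin_sin) auto
        then show ?thesis using that c by (simp add: sn_def)
      qed
      then have "H (sn v) = h v" unfolding H_def by (intro dep)
      then show ?thesis using \<open>\<bar>H (sn v) - r (sn v)\<bar> < \<epsilon>\<close> by simp
    qed
  qed
qed

text \<open>\<open>h\<close> is exchanged for a trigonometric polynomial, whose expectations
  converge by linearity. The two agree approximately only on a cube; off the cube the global bound
  of the polynomial and tightness take over, the latter from \<open>tight\<close> for the sequence
  and by exhaustion with cubes for the single law of \<open>W\<close>.\<close>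

theorem multivariate_levy_continuity:
  fixes h :: "(nat \<Rightarrow> real) \<Rightarrow> real"
  assumes "prob_space M" "prob_space N"
    and V: "\<And>n i. (\<lambda>\<omega>. V n \<omega> i) \<in> borel_measurable M"
    and W: "\<And>i. (\<lambda>\<omega>. W \<omega> i) \<in> borel_measurable N"
    and lim: "\<And>a. (\<lambda>n. \<integral>\<omega>. iexp (\<Sum>i<m. a i * V n \<omega> i) \<partial>M) \<longlonglongrightarrow> (\<integral>\<omega>. iexp (\<Sum>i<m. a i * W \<omega> i) \<partial>N)"
    and tight: "\<And>\<epsilon>. \<epsilon> > 0 \<Longrightarrow> \<exists>P. eventually (\<lambda>n. measure M {\<omega>\<in>space M. \<exists>i<m. \<bar>V n \<omega> i\<bar> > P}
        \<le> \<epsilon>) sequentially"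
    and h: "continuous_on UNIV h" and dep: "\<And>v w. (\<And>i. i < m \<Longrightarrow> v i = w i) \<Longrightarrow> h v = h w"
    and bd: "\<And>v. \<bar>h v\<bar> \<le> B"
  shows "(\<lambda>n. \<integral>\<omega>. h (V n \<omega>) \<partial>M) \<longlonglongrightarrow> (\<integral>\<omega>. h (W \<omega>) \<partial>N)"
proof -
  interpret M: prob_space M by fact
  interpret N: prob_space N by fact
  have B: "B \<ge> 0" using bd[of undefined] by linarith
  have [measurable]: "V n \<in> borel_measurable M" for n
    by (rule measurable_coordinatewise_then_product[OF V])
  have [measurable]: "W \<in> borel_measurable N"
    by (rule measurable_coordinatewise_then_product[OF W])
  have [measurable]: "h \<in> borel_measurable borel" by (rule borel_measurable_continuous_onI[OF h])
  \<comment> \<open>Stated for an arbitrary probability space because it serves both the sequence on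
    \<open>M\<close> and the limit on \<open>N\<close>. On the exceptional event the difference is
    at most \<open>2 * (B + \<epsilon>)\<close>.\<close>
  have key: "\<bar>(\<integral>\<omega>. h (U \<omega>) \<partial>Q) - (\<integral>\<omega>. g (U \<omega>) \<partial>Q)\<bar> \<le> \<epsilon> + (2 * B + 2 * \<epsilon>) * \<epsilon>"
    if "prob_space Q" and U: "\<And>i. (\<lambda>\<omega>. U \<omega> i) \<in> borel_measurable Q"
      and g: "trig_poly m (\<lambda>v. complex_of_real (g v))" "\<And>v. \<bar>g v\<bar> \<le> B + \<epsilon>"
        "\<And>v. (\<And>i. i < m \<Longrightarrow> \<bar>v i\<bar> \<le> P) \<Longrightarrow> \<bar>h v - g v\<bar> < \<epsilon>"
      and pr: "measure Q {\<omega>\<in>space Q. \<exists>i<m. \<bar>U \<omega> i\<bar> > P} \<le> \<epsilon>" and "\<epsilon> > 0"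
    for Q and U :: "_ \<Rightarrow> nat \<Rightarrow> real" and g P \<epsilon>
  proof -
    interpret Q: prob_space Q by fact
    note [measurable] = U
    have [measurable]: "U \<in> borel_measurable Q"
      by (rule measurable_coordinatewise_then_product[OF U])
    have "(\<lambda>\<omega>. complex_of_real (g (U \<omega>))) \<in> borel_measurable Q"
      by (rule trig_poly_measurable[OF g(1)]) (rule U)
    then have [measurable]: "(\<lambda>\<omega>. g (U \<omega>)) \<in> borel_measurable Q"
      using measurable_compose[OF _ borel_measurable_continuous_onI[of Re], of
          "\<lambda>\<omega>. complex_of_real (g (U \<omega>))" Q]
      by (simp add: continuous_on_Re)
    define E where "E = {\<omega>\<in>space Q. \<exists>i<m. \<bar>U \<omega> i\<bar> > P}"
    have "\<bar>(\<integral>\<omega>. h (U \<omega>) \<partial>Q) - (\<integral>\<omega>. g (U \<omega>) \<partial>Q)\<bar> \<le> \<epsilon> + 2 * (B + \<epsilon>) * Q.prob E"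
    proof (rule Q.expectation_diff_le)
      show "E \<in> sets Q" unfolding E_def by measurable
      show "\<bar>h (U \<omega>)\<bar> \<le> B + \<epsilon>" for \<omega> using bd[of "U \<omega>"] \<open>\<epsilon> > 0\<close> by linarith
      fix \<omega> assume "\<omega> \<in> space Q - E"
      then have "\<forall>i<m. \<bar>U \<omega> i\<bar> \<le> P" by (simp add: E_def) (meson not_less)
      then show "\<bar>h (U \<omega>) - g (U \<omega>)\<bar> \<le> \<epsilon>" by (intro less_imp_le[OF g(3)]) simp
    qed (use g(2) \<open>\<epsilon> > 0\<close> in auto)
    also have "\<dots> \<le> \<epsilon> + (2 * B + 2 * \<epsilon>) * \<epsilon>"
      using pr B \<open>\<epsilon> > 0\<close> unfolding E_def by (intro add_left_mono mult_mono) auto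
    finally show ?thesis .
  qed
  have tightW: "\<exists>P. measure N {\<omega>\<in>space N. \<exists>i<m. \<bar>W \<omega> i\<bar> > P} \<le> \<epsilon>" if "\<epsilon> > 0" for \<epsilon>
  proof -
    note [measurable] = W
    define E where "E p = {\<omega>\<in>space N. \<exists>i<m. \<bar>W \<omega> i\<bar> > real p}" for p :: nat
    have "(\<lambda>p. N.prob (E p)) \<longlonglongrightarrow> N.prob (\<Inter>p. E p)"
    proof (rule N.finite_Lim_measure_decseq)
      show "range E \<subseteq> sets N" unfolding E_def by auto
      show "decseq E" unfolding E_def decseq_def by (force intro: le_less_trans)
    qed
    moreover have "(\<Inter>p. E p) = {}"
    proof -
      have False if w: "\<omega> \<in> (\<Inter>p. E p)" for \<omega>
      proof -
        obtain p where p: "real p \<ge> (\<Sum>i<m. \<bar>W \<omega> i\<bar>)" using real_arch_simple by blast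
        obtain i where i: "i < m" "\<bar>W \<omega> i\<bar> > real p" using INT_D[OF w UNIV_I, of p]
          by (auto simp: E_def)
        have "\<bar>W \<omega> i\<bar> \<le> (\<Sum>i<m. \<bar>W \<omega> i\<bar>)" using i by (intro member_le_sum) auto
        then show False using p i by linarith
      qed
      then show ?thesis by blast
    qed
    ultimately have "(\<lambda>p. N.prob (E p)) \<longlonglongrightarrow> 0" by simp
    then have "eventually (\<lambda>p. N.prob (E p) < \<epsilon>) sequentially" using that by (rule order_tendstoD)
    then obtain p where "N.prob (E p) < \<epsilon>" by (auto simp: eventually_sequentially)
    then show ?thesis by (intro exI[of _ "real p"]) (simp add: E_def)
  qed
  show ?thesis
  proof (rule LIMSEQ_I)
    fix d :: real assume d: "d > 0"
    \<comment> \<open>With \<open>\<epsilon> \<le> 1\<close> each of the three errors is at most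
      \<open>(2 * B + 3) * \<epsilon>\<close>; taking \<open>2 * B + 4\<close> in the denominator
      makes their total strictly less than \<open>d\<close>.\<close>
    define \<epsilon> where "\<epsilon> = min 1 (d / (3 * (2 * B + 4)))"
    have e: "\<epsilon> > 0" "\<epsilon> \<le> 1" using d B by (auto simp: \<epsilon>_def)
    have e3: "3 * (\<epsilon> + (2 * B + 2 * \<epsilon>) * \<epsilon>) < d"
    proof -
      have "3 * (\<epsilon> + (2 * B + 2 * \<epsilon>) * \<epsilon>) \<le> 3 * (\<epsilon> + (2 * B + 2) * \<epsilon>)"
        using e by (intro mult_left_mono add_left_mono mult_right_mono) auto
      also have "\<dots> = (3 * (2 * B + 3)) * \<epsilon>" by (simp add: algebra_simps)
      also have "\<dots> < (3 * (2 * B + 4)) * \<epsilon>" using e B by (intro mult_strict_right_mono) auto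
      also have "\<dots> \<le> (3 * (2 * B + 4)) * (d / (3 * (2 * B + 4)))"
        using B by (intro mult_left_mono) (auto simp: \<epsilon>_def)
      also have "\<dots> = d" using B by simp
      finally show ?thesis .
    qed
    obtain P1 where P1: "eventually (\<lambda>n. M.prob {\<omega>\<in>space M. \<exists>i<m. \<bar>V n \<omega> i\<bar> > P1} \<le> \<epsilon>) sequentially"
      using tight[OF e(1)] by blast
    obtain P2 where P2: "N.prob {\<omega>\<in>space N. \<exists>i<m. \<bar>W \<omega> i\<bar> > P2} \<le> \<epsilon>" using tightW[OF e(1)] by blast
    define P where "P = max 1 (max P1 P2)"
    have "P > 0" by (simp add: P_def)
    obtain g where g: "trig_poly m (\<lambda>v. complex_of_real (g v))" "\<And>v. \<bar>g v\<bar> \<le> B + \<epsilon>"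
      "\<And>v. (\<And>i. i < m \<Longrightarrow> \<bar>v i\<bar> \<le> P) \<Longrightarrow> \<bar>h v - g v\<bar> < \<epsilon>"
      using trig_poly_approx[OF h dep bd \<open>P > 0\<close> e(1)] by blast
    have g1: "\<And>v. (\<And>i. i < m \<Longrightarrow> \<bar>v i\<bar> \<le> P1) \<Longrightarrow> \<bar>h v - g v\<bar> < \<epsilon>"
      and g2: "\<And>v. (\<And>i. i < m \<Longrightarrow> \<bar>v i\<bar> \<le> P2) \<Longrightarrow> \<bar>h v - g v\<bar> < \<epsilon>"
    proof -
      have "P1 \<le> P" "P2 \<le> P" by (auto simp: P_def)
      then show "\<And>v. (\<And>i. i < m \<Longrightarrow> \<bar>v i\<bar> \<le> P1) \<Longrightarrow> \<bar>h v - g v\<bar> < \<epsilon>"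
        and "\<And>v. (\<And>i. i < m \<Longrightarrow> \<bar>v i\<bar> \<le> P2) \<Longrightarrow> \<bar>h v - g v\<bar> < \<epsilon>"
        by (blast intro: g(3) order_trans)+
    qed
    have "(\<lambda>n. \<integral>\<omega>. complex_of_real (g (V n \<omega>)) \<partial>M) \<longlonglongrightarrow> (\<integral>\<omega>. complex_of_real (g (W \<omega>)) \<partial>N)"
      by (rule trig_poly_expectation_tendsto[OF assms(1,2) g(1) V W lim])
    then have "(\<lambda>n. \<integral>\<omega>. g (V n \<omega>) \<partial>M) \<longlonglongrightarrow> (\<integral>\<omega>. g (W \<omega>) \<partial>N)"
      by (simp add: tendsto_of_real_iff)
    then have "eventually (\<lambda>n. \<bar>(\<integral>\<omega>. g (V n \<omega>) \<partial>M) - (\<integral>\<omega>. g (W \<omega>) \<partial>N)\<bar> < \<epsilon>) sequentially"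
      using tendstoD[OF _ e(1)] by (fastforce simp: dist_real_def)
    then have "eventually (\<lambda>n. \<bar>(\<integral>\<omega>. h (V n \<omega>) \<partial>M) - (\<integral>\<omega>. h (W \<omega>) \<partial>N)\<bar> < d) sequentially"
      using P1
    proof eventually_elim
      case (elim n)
      have "\<bar>(\<integral>\<omega>. h (V n \<omega>) \<partial>M) - (\<integral>\<omega>. g (V n \<omega>) \<partial>M)\<bar> \<le> \<epsilon> + (2 * B + 2 * \<epsilon>) * \<epsilon>"
        by (rule key[OF assms(1) V g(1,2) g1 elim(2) e(1)])
      moreover have "\<bar>(\<integral>\<omega>. h (W \<omega>) \<partial>N) - (\<integral>\<omega>. g (W \<omega>) \<partial>N)\<bar> \<le> \<epsilon> + (2 * B + 2 * \<epsilon>) * \<epsilon>"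
        by (rule key[OF assms(2) W g(1,2) g2 P2 e(1)])
      moreover have "\<epsilon> \<le> \<epsilon> + (2 * B + 2 * \<epsilon>) * \<epsilon>" using B e by simp
      moreover have "\<bar>x - y\<bar> < d"
        if "\<bar>x - x'\<bar> \<le> s" "\<bar>y - y'\<bar> \<le> s" "\<epsilon> \<le> s" "\<bar>x' - y'\<bar> < \<epsilon>" "3 * s < d" for x y x' y' s
        using that by linarith
      ultimately show ?case using elim(1) e3 by blast
    qed
    then show "\<exists>no. \<forall>n\<ge>no. norm ((\<integral>\<omega>. h (V n \<omega>) \<partial>M) - (\<integral>\<omega>. h (W \<omega>) \<partial>N)) < d"
      by (simp add: eventually_sequentially)
  qed
qed

section \<open>Characteristic functions of the Brownian bridge\<close>

text \<open>Centring reduces to two known laws: the point mass, necessarily at 0, and the standard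
  normal law with its characteristic function taken at \<open>\<sigma>\<close>. Integrability of the
  square is concluded as well, since the value of its integral alone does not provide it.\<close>

lemma normal_law_iexp:
  assumes "\<sigma> \<ge> 0" "distr N borel S = normal_law m \<sigma>" and [measurable]: "S \<in> borel_measurable N"
    and "(\<integral>\<omega>. S \<omega> \<partial>N) = 0" "prob_space N"
  shows "(\<integral>\<omega>. iexp (S \<omega>) \<partial>N) = complex_of_real (exp (- (\<integral>\<omega>. S \<omega> ^ 2 \<partial>N) / 2))"
    and "integrable N (\<lambda>\<omega>. S \<omega> ^ 2)"
proof -
  interpret N: prob_space N by fact
  have "(\<integral>\<omega>. iexp (S \<omega>) \<partial>N) = complex_of_real (exp (- (\<integral>\<omega>. S \<omega> ^ 2 \<partial>N) / 2)) \<and>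
      integrable N (\<lambda>\<omega>. S \<omega> ^ 2)"
  proof (cases "\<sigma> = 0")
    case True
    have "AE x in distr N borel S. x = m"
      unfolding assms(2) normal_law_def if_P[OF True] by (subst AE_return) auto
    then have ae: "AE \<omega> in N. S \<omega> = m" by (subst (asm) AE_distr_iff) auto
    have "(\<integral>\<omega>. S \<omega> \<partial>N) = (\<integral>\<omega>. m \<partial>N)" by (rule integral_cong_AE) (use ae in auto)
    then have "m = 0" using assms(4) by (simp add: N.prob_space)
    then have ae0: "AE \<omega> in N. S \<omega> = 0" using ae by simp
    have "(\<integral>\<omega>. iexp (S \<omega>) \<partial>N) = (\<integral>\<omega>. 1 \<partial>N)"
      by (rule integral_cong_AE) (use ae0 in auto)
    moreover have "(\<integral>\<omega>. S \<omega> ^ 2 \<partial>N) = (\<integral>\<omega>. 0 \<partial>N)"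
      by (rule integral_cong_AE) (use ae0 in auto)
    moreover have "integrable N (\<lambda>\<omega>. S \<omega> ^ 2)"
    proof (subst integrable_cong_AE)
      show "AE \<omega> in N. S \<omega> ^ 2 = 0" using ae0 by auto
    qed auto
    ultimately show ?thesis by (simp add: N.prob_space)
  next
    case False
    then have s: "\<sigma> > 0" using assms(1) by simp
    have d: "distributed N lborel S (normal_density m \<sigma>)"
    proof -
      have "distr N lborel S = distr N borel S" by (rule distr_cong) auto
      then show ?thesis unfolding distributed_def using assms(2) False
        by (auto simp: normal_law_def)
    qed
    have "m = 0" using N.normal_distributed_expectation[OF s d] assms(4) by simp
    note d = d[unfolded this]
    have d1: "distributed N lborel (\<lambda>\<omega>. S \<omega> / \<sigma>) std_normal_density"
      using N.normal_standard_normal_convert[OF s, of S 0] d by simp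
    have S2: "(\<integral>\<omega>. S \<omega> ^ 2 \<partial>N) = \<sigma>\<^sup>2"
      using N.normal_distributed_variance[OF s d] assms(4) by simp
    \<comment> \<open>A non-integrable function has integral 0 by convention, which contradicts the
      value \<open>\<sigma>\<^sup>2 > 0\<close>.\<close>
    have "integrable N (\<lambda>\<omega>. S \<omega> ^ 2)"
    proof (rule ccontr)
      assume "\<not> ?thesis"
      then have "(\<integral>\<omega>. S \<omega> ^ 2 \<partial>N) = 0" by (rule not_integrable_integral_eq)
      then show False using S2 s by simp
    qed
    moreover have "(\<integral>\<omega>. iexp (S \<omega>) \<partial>N) = char (distr N borel (\<lambda>\<omega>. S \<omega> / \<sigma>)) \<sigma>"
      unfolding char_def using s by (subst integral_distr) auto
    moreover have "distr N borel (\<lambda>\<omega>. S \<omega> / \<sigma>) = std_normal_distribution"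
      using d1 by (simp add: distributed_def cong: distr_cong)
    ultimately show ?thesis unfolding S2 by (simp add: char_std_normal_distribution)
  qed
  then show "(\<integral>\<omega>. iexp (S \<omega>) \<partial>N) = complex_of_real (exp (- (\<integral>\<omega>. S \<omega> ^ 2 \<partial>N) / 2))"
    and "integrable N (\<lambda>\<omega>. S \<omega> ^ 2)" by auto
qed

text \<open>The weighted sum is a centred normal variable whose variance is read off the covariance
  of the bridge.\<close>

lemma brownian_bridge_iexp:
  fixes t :: "nat \<Rightarrow> real"
  assumes B: "brownian_bridge N B" and t: "\<And>i. i < m \<Longrightarrow> t i \<in> {0..1}" and inj: "inj_on t {..<m}"
  shows "(\<integral>\<omega>. iexp (\<Sum>i<m. a i * B (t i) \<omega>) \<partial>N) =
    complex_of_real (exp (- (\<Sum>i<m. \<Sum>j<m. a i * a j * (min (t i) (t j) - t i * t j)) / 2))"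
proof -
  interpret N: prob_space N using B by (simp add: brownian_bridge_def)
  have Bm[measurable]: "B s \<in> borel_measurable N" if "s \<in> {0..1}" for s
    using B that by (auto simp: brownian_bridge_def gaussian_process_def)
  have mean: "(\<integral>\<omega>. B s \<omega> \<partial>N) = 0" if "s \<in> {0..1}" for s
    using B that by (auto simp: brownian_bridge_def)
  have cov: "(\<integral>\<omega>. B s \<omega> * B u \<omega> \<partial>N) = min s u - s * u" if "s \<in> {0..1}" "u \<in> {0..1}" for s u
    using B that by (auto simp: brownian_bridge_def)
  have normal: "\<exists>m \<sigma>. \<sigma> \<ge> 0 \<and> distr N borel (\<lambda>\<omega>. \<Sum>t\<in>J. a t * B t \<omega>) = normal_law m \<sigma>"
    if "finite J" "J \<subseteq> {0..1}" for J a
    using B that unfolding brownian_bridge_def gaussian_process_def by blast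
  \<comment> \<open>\<open>brownian_bridge\<close> prescribes second moments only as values of
    integrals; integrability is extracted from normality of the marginal at
    \<open>s\<close>.\<close>
  have sq: "integrable N (\<lambda>\<omega>. B s \<omega> ^ 2)" if "s \<in> {0..1}" for s
  proof -
    obtain m \<sigma> where "\<sigma> \<ge> 0" "distr N borel (B s) = normal_law m \<sigma>"
      using normal[of "{s}" "\<lambda>_. 1"] \<open>s \<in> {0..1}\<close> by auto
    then show ?thesis using normal_law_iexp(2)[OF _ _ Bm[OF that] mean[OF that]]
        N.prob_space_axioms by blast
  qed
  have int1: "integrable N (B s)" if "s \<in> {0..1}" for s
    by (rule N.square_integrable_imp_integrable[OF Bm[OF that] sq[OF that]])
  have int2: "integrable N (\<lambda>\<omega>. B s \<omega> * B u \<omega>)" if "s \<in> {0..1}" "u \<in> {0..1}" for s u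
  proof (rule Bochner_Integration.integrable_bound)
    show "integrable N (\<lambda>\<omega>. B s \<omega> ^ 2 + B u \<omega> ^ 2)" using sq that by simp
    show "(\<lambda>\<omega>. B s \<omega> * B u \<omega>) \<in> borel_measurable N" using Bm that by simp
    have "\<bar>x * y\<bar> \<le> x\<^sup>2 + y\<^sup>2" for x y :: real
    proof -
      have "0 \<le> (\<bar>x\<bar> - \<bar>y\<bar>)\<^sup>2" by simp
      then have "2 * (\<bar>x\<bar> * \<bar>y\<bar>) \<le> x\<^sup>2 + y\<^sup>2" by (simp add: power2_diff)
      moreover have "0 \<le> \<bar>x\<bar> * \<bar>y\<bar>" by simp
      ultimately show ?thesis unfolding abs_mult by linarith
    qed
    then show "AE \<omega> in N. norm (B s \<omega> * B u \<omega>) \<le> norm (B s \<omega> ^ 2 + B u \<omega> ^ 2)"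
      by (intro AE_I2) (simp add: abs_of_nonneg)
  qed
  define S where "S \<omega> = (\<Sum>i<m. a i * B (t i) \<omega>)" for \<omega>
  have Sm: "S \<in> borel_measurable N"
    unfolding S_def using t Bm by (intro borel_measurable_sum borel_measurable_times) auto
  have S0: "(\<integral>\<omega>. S \<omega> \<partial>N) = 0"
    unfolding S_def using t int1 mean by (subst Bochner_Integration.integral_sum) auto
  have S2: "(\<integral>\<omega>. S \<omega> ^ 2 \<partial>N) = (\<Sum>i<m. \<Sum>j<m. a i * a j * (min (t i) (t j) - t i * t j))"
  proof -
    have "(\<integral>\<omega>. S \<omega> ^ 2 \<partial>N) = (\<integral>\<omega>. (\<Sum>i<m. \<Sum>j<m. a i * a j * (B (t i) \<omega> * B (t j) \<omega>)) \<partial>N)"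
      unfolding S_def power2_eq_square sum_product by (simp add: ac_simps)
    also have "\<dots> = (\<Sum>i<m. \<Sum>j<m. \<integral>\<omega>. a i * a j * (B (t i) \<omega> * B (t j) \<omega>) \<partial>N)"
      using t int2
      by (subst Bochner_Integration.integral_sum, force intro!: Bochner_Integration.integrable_sum
          integrable_mult_right)
        (intro sum.cong refl Bochner_Integration.integral_sum integrable_mult_right, auto)
    also have "\<dots> = (\<Sum>i<m. \<Sum>j<m. a i * a j * (min (t i) (t j) - t i * t j))"
      using t cov by (intro sum.cong refl) auto
    finally show ?thesis .
  qed
  obtain \<mu> \<sigma> where "\<sigma> \<ge> 0" "distr N borel S = normal_law \<mu> \<sigma>"
  proof -
    \<comment> \<open>\<open>gaussian_process\<close> sums over a set of times, so injectivity of
      \<open>t\<close> is what transports the weights from indices to times.\<close>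
    have "S = (\<lambda>\<omega>. \<Sum>s\<in>t ` {..<m}. a (the_inv_into {..<m} t s) * B s \<omega>)"
      unfolding S_def by (rule ext) (simp add: sum.reindex[OF inj] the_inv_into_f_f[OF inj])
    moreover have "t ` {..<m} \<subseteq> {0..1}" using t by blast
    ultimately show thesis
      using that normal[of "t ` {..<m}" "\<lambda>s. a (the_inv_into {..<m} t s)"] by auto
  qed
  from normal_law_iexp(1)[OF this Sm S0 N.prob_space_axioms] show ?thesis
    unfolding S2 by (simp add: S_def)
qed

section \<open>The tail empirical process\<close>

lemma sorted_nth_gt_iff:
  fixes x :: "'a::linorder"
  assumes "sorted ys" "i < length ys"
  shows "ys ! i > x \<longleftrightarrow> length (filter (\<lambda>y. y \<le> x) ys) \<le> i"
  using assms
proof (induction ys arbitrary: i)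
  case (Cons y ys)
  show ?case
  proof (cases "y \<le> x")
    case True
    then show ?thesis using Cons by (cases i) auto
  next
    case False
    then have "filter (\<lambda>y. y \<le> x) ys = []" using Cons.prems(1) by (force simp: filter_empty_conv)
    moreover have "(y # ys) ! i > x"
      using False Cons.prems by (cases i) (auto simp: not_le, meson less_le_trans nth_mem)
    ultimately show ?thesis using False by simp
  qed
qed simp

text \<open>This equivalence replaces order statistics by counts, which are sums over the sample;
  both their measurability and their asymptotics go through it.\<close>

lemma desc_order_stat_gt_iff:
  assumes "1 \<le> j" "j \<le> n"
  shows "desc_order_stat X n j \<omega> > x \<longleftrightarrow> j \<le> card {i\<in>{1..n}. X i \<omega> > x}"
proof -
  define xs where "xs = map (\<lambda>i. X i \<omega>) [1..<Suc n]"
  have len: "length (sort xs) = n" by (simp add: xs_def)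
  have "desc_order_stat X n j \<omega> = sort xs ! (n - j)"
    unfolding desc_order_stat_def xs_def[symmetric] using assms len by (subst rev_nth) auto
  also have "\<dots> > x \<longleftrightarrow> length (filter (\<lambda>y. y \<le> x) (sort xs)) \<le> n - j"
    using assms len by (intro sorted_nth_gt_iff) auto
  also have "length (filter (\<lambda>y. y \<le> x) (sort xs)) = n - length (filter (\<lambda>y. y > x) xs)"
    using sum_length_filter_compl[of "\<lambda>y. y > x" xs] len
    by (simp add: filter_sort not_less)
  also have "length (filter (\<lambda>y. y > x) xs) = card {i\<in>{1..n}. X i \<omega> > x}"
  proof -
    have "length (filter (\<lambda>y. y > x) xs) = length (filter (\<lambda>i. X i \<omega> > x) [1..<Suc n])"
      by (simp add: xs_def filter_map comp_def)
    also have "\<dots> = card (set (filter (\<lambda>i. X i \<omega> > x) [1..<Suc n]))"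
      by (rule distinct_card[symmetric]) simp
    also have "set (filter (\<lambda>i. X i \<omega> > x) [1..<Suc n]) = {i\<in>{1..n}. X i \<omega> > x}" by auto
    finally show ?thesis .
  qed
  also have "n - card {i\<in>{1..n}. X i \<omega> > x} \<le> n - j \<longleftrightarrow> j \<le> card {i\<in>{1..n}. X i \<omega> > x}"
    using assms card_mono[of "{1..n}" "{i\<in>{1..n}. X i \<omega> > x}"] by auto
  finally show ?thesis .
qed

text \<open>\<open>b n\<close> stands for the quantile at \<open>n / k n\<close>. The tail is
  measured on open half-lines so that it matches the strict exceedances in
  \<open>desc_order_stat_gt_iff\<close>.\<close>

locale tail_sample = prob_space M for M :: "'v measure" +
  fixes X :: "nat \<Rightarrow> 'v \<Rightarrow> real" and D :: "real measure"
    and \<xi> :: real and k :: "nat \<Rightarrow> nat" and b :: "nat \<Rightarrow> real"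
  assumes xi: "\<xi> > 0"
    and indep: "indep_vars (\<lambda>_. borel) X {1..}"
    and distr_X: "\<And>i. i \<ge> 1 \<Longrightarrow> distr M borel (X i) = D"
    and k_inf: "filterlim k at_top sequentially"
    and k_small: "(\<lambda>n. real (k n) / real n) \<longlonglongrightarrow> 0"
    and tail: "\<And>K. compact K \<Longrightarrow> K \<subseteq> {0<..} \<Longrightarrow>
      uniform_limit K
        (\<lambda>n y. sqrt (real (k n)) * (real n / real (k n) * measure D {b n * y powr (- \<xi>)<..} - y))
        (\<lambda>y. 0) sequentially"
begin

text \<open>Parametrising the thresholds as \<open>b n * y powr - \<xi>\<close> makes Brownian motion the limit of the tail
  empirical process \<open>\<alpha>\<close>; \<open>\<beta>\<close> is the same process with its exact centring.\<close>

definition p :: "nat \<Rightarrow> real \<Rightarrow> real" where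
  "p n y = measure D {b n * y powr (- \<xi>)<..}"

definition cnt :: "nat \<Rightarrow> real \<Rightarrow> 'v \<Rightarrow> real" where
  "cnt n y \<omega> = (\<Sum>i\<in>{1..n}. indicator {b n * y powr (- \<xi>)<..} (X i \<omega>))"

definition \<alpha> :: "nat \<Rightarrow> real \<Rightarrow> 'v \<Rightarrow> real" where
  "\<alpha> n y \<omega> = sqrt (real (k n)) * (cnt n y \<omega> / real (k n) - y)"

definition \<beta> :: "nat \<Rightarrow> real \<Rightarrow> 'v \<Rightarrow> real" where
  "\<beta> n y \<omega> = (cnt n y \<omega> - real n * p n y) / sqrt (real (k n))"

lemma rvX: "i \<ge> 1 \<Longrightarrow> random_variable borel (X i)"
  using indep unfolding indep_vars_def2 by auto

lemma D_eq: "D = distr M borel (X 1)" using distr_X[of 1] by simp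

sublocale D: real_distribution D
  unfolding D_eq by (rule real_distribution_distr) (simp add: rvX)

lemma cnt_measurable[measurable]: "cnt n y \<in> borel_measurable M"
  unfolding cnt_def[abs_def] by (intro borel_measurable_sum measurable_compose[OF rvX]
      borel_measurable_indicator) auto

lemma \<alpha>_measurable[measurable]: "\<alpha> n y \<in> borel_measurable M"
  unfolding \<alpha>_def[abs_def] by measurable

lemma \<beta>_measurable[measurable]: "\<beta> n y \<in> borel_measurable M"
  unfolding \<beta>_def[abs_def] by measurable

lemma k_inf_real: "filterlim (\<lambda>n. real (k n)) at_top sequentially"
  using k_inf filterlim_real_sequentially filterlim_compose by blast

lemma sqrt_k_inf: "filterlim (\<lambda>n. sqrt (real (k n))) at_top sequentially"
  by (rule filterlim_compose[OF sqrt_at_top k_inf_real])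

lemma eventually_sqrt_k: "eventually (\<lambda>n. sqrt (real (k n)) \<ge> c) sequentially"
  using sqrt_k_inf by (simp add: filterlim_at_top)

lemma eventually_k_pos: "eventually (\<lambda>n. k n \<ge> 1) sequentially"
  using k_inf by (simp add: filterlim_at_top)

lemma eventually_k_le: "eventually (\<lambda>n. k n \<le> n) sequentially"
proof -
  have "eventually (\<lambda>n. real (k n) / real n < 1) sequentially"
    using k_small by (rule order_tendstoD) simp
  then show ?thesis using eventually_gt_at_top[of 0] by eventually_elim (simp add: divide_less_eq)
qed

lemma tail_uniform:
  assumes "0 < c" "\<eta> > 0"
  shows "eventually (\<lambda>n. \<forall>y\<in>{c..d}. \<bar>sqrt (real (k n)) * (real n / real (k n) * p n y - y)\<bar>
      < \<eta>) sequentially"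
proof -
  have "uniform_limit {c..d} (\<lambda>n y. sqrt (real (k n)) * (real n / real (k n) * p n y - y)) (\<lambda>y. 0)
      sequentially"
    unfolding p_def using assms by (intro tail) auto
  from uniform_limitD[OF this assms(2)] show ?thesis by (simp add: dist_real_def)
qed

lemma tail_error_tendsto:
  assumes "0 < y"
  shows "(\<lambda>n. sqrt (real (k n)) * (real n / real (k n) * p n y - y)) \<longlonglongrightarrow> 0"
  using tail_uniform[OF assms, of _ y] by (intro tendstoI) (simp add: dist_real_def)

lemma tail_tendsto:
  assumes "0 < y"
  shows "(\<lambda>n. real n / real (k n) * p n y) \<longlonglongrightarrow> y"
proof -
  have "(\<lambda>n. inverse (sqrt (real (k n)))) \<longlonglongrightarrow> 0"
    by (rule tendsto_inverse_0_at_top[OF sqrt_k_inf])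
  from tendsto_add[OF tendsto_mult[OF this tail_error_tendsto[OF assms]] tendsto_const[of y]]
  have "(\<lambda>n. inverse (sqrt (real (k n))) * (sqrt (real (k n)) * (real n / real (k n) * p n y - y))
      + y) \<longlonglongrightarrow> y"
    by simp
  then show ?thesis
  proof (rule Lim_transform_eventually)
    show "eventually (\<lambda>n. inverse (sqrt (real (k n)))
        * (sqrt (real (k n)) * (real n / real (k n) * p n y - y)) + y =
        real n / real (k n) * p n y) sequentially"
      using eventually_k_pos by eventually_elim (simp add: field_simps)
  qed
qed

text \<open>If \<open>b n \<le> 0\<close>, then \<open>p n\<close> is nonincreasing, whereas its rescaling tends to the identity.\<close>

lemma eventually_b_pos: "eventually (\<lambda>n. b n > 0) sequentially"
proof -
  have "eventually (\<lambda>n. real n / real (k n) * p n 2 - real n / real (k n) * p n 1 > 0) sequentially"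
    using tendsto_diff[OF tail_tendsto[of 2] tail_tendsto[of 1]]
    by (rule order_tendstoD) auto
  then show ?thesis using eventually_k_pos eventually_gt_at_top[of 0]
  proof eventually_elim
    case (elim n)
    show ?case
    proof (rule ccontr)
      assume "\<not> 0 < b n"
      then have "b n \<le> 0" by simp
      have "2 powr - \<xi> \<le> (1 :: real) powr - \<xi>"
        using xi by (intro powr_mono2') auto
      then have "b n * 1 powr - \<xi> \<le> b n * 2 powr - \<xi>" using \<open>b n \<le> 0\<close>
        by (intro mult_left_mono_neg) auto
      then have "p n 2 \<le> p n 1" unfolding p_def by (intro D.finite_measure_mono) auto
      then have "real n / real (k n) * p n 2 \<le> real n / real (k n) * p n 1"
        by (intro mult_left_mono) auto
      then show False using elim(1) by linarith
    qed
  qed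
qed

lemma threshold_antimono: "b n > 0 \<Longrightarrow> 0 < x \<Longrightarrow> x \<le> y \<Longrightarrow> b n * y powr - \<xi> \<le> b n * x powr - \<xi>"
  using xi by (intro mult_left_mono powr_mono2') auto

lemma cnt_mono: "b n > 0 \<Longrightarrow> 0 < x \<Longrightarrow> x \<le> y \<Longrightarrow> cnt n x \<omega> \<le> cnt n y \<omega>"
proof -
  assume "b n > 0" "0 < x" "x \<le> y"
  then have "b n * y powr - \<xi> \<le> b n * x powr - \<xi>" by (rule threshold_antimono)
  moreover have "indicator {u<..} z \<le> (indicator {v<..} z :: real)" if "v \<le> u" for u v z :: real
    using that by (auto simp: indicator_def)
  ultimately show ?thesis unfolding cnt_def by (intro sum_mono) blast
qed

lemma p_mono: "b n > 0 \<Longrightarrow> 0 < x \<Longrightarrow> x \<le> y \<Longrightarrow> p n x \<le> p n y"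
  unfolding p_def using threshold_antimono[of n x y] by (intro D.finite_measure_mono) auto

section \<open>Moment bounds for centred counts\<close>

lemma count_moments:
  fixes n :: nat
  assumes [measurable]: "A \<in> sets borel"
  defines "S \<equiv> \<lambda>\<omega>. (\<Sum>i\<in>{1..n}. indicator A (X i \<omega>)) - real n * measure D A"
  shows "expectation (\<lambda>\<omega>. S \<omega> ^ 2) \<le> real n * measure D A"
    and "expectation (\<lambda>\<omega>. S \<omega> ^ 4) \<le> real n * measure D A + 3 * (real n)\<^sup>2 * (measure D A)\<^sup>2"
    and "integrable M (\<lambda>\<omega>. S \<omega> ^ j)"
proof -
  let ?q = "measure D A"
  define Z where "Z i \<omega> = indicator A (X i \<omega>) - ?q" for i \<omega>
  have S_eq: "S = (\<lambda>\<omega>. \<Sum>i\<in>{1..n}. Z i \<omega>)"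
    by (simp add: S_def Z_def sum_subtractf)
  have ind: "indep_vars (\<lambda>_. borel) Z {1..}"
    unfolding Z_def by (rule indep_vars_compose2[OF indep]) measurable
  have q: "0 \<le> ?q" "?q \<le> 1" by auto
  have bd: "\<bar>Z i \<omega>\<bar> \<le> 1" for i \<omega>
    using q by (auto simp: Z_def indicator_def)
  have E1: "expectation (\<lambda>\<omega>. indicator A (X i \<omega>)) = ?q"
      and int1: "integrable M (\<lambda>\<omega>. indicator A (X i \<omega>) :: real)" if "i \<ge> 1" for i
  proof -
    note rvX[OF that, measurable]
    have "expectation (\<lambda>\<omega>. indicator A (X i \<omega>) :: real) = (\<integral>x. indicator A x \<partial>D)"
      unfolding distr_X[OF that, symmetric] by (subst integral_distr) auto
    then show "expectation (\<lambda>\<omega>. indicator A (X i \<omega>)) = ?q" by simp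
    show "integrable M (\<lambda>\<omega>. indicator A (X i \<omega>) :: real)"
      by (rule integrable_const_bound[of _ 1]) (auto simp: indicator_def)
  qed
  have mean: "expectation (Z i) = 0" if "i \<ge> 1" for i
    unfolding Z_def using E1[OF that] int1[OF that] by (simp add: prob_space)
  have var: "expectation (\<lambda>\<omega>. Z i \<omega> ^ 2) \<le> ?q" if "i \<ge> 1" for i
  proof -
    have "expectation (\<lambda>\<omega>. Z i \<omega> ^ 2) = expectation (\<lambda>\<omega>. (1 - 2 * ?q) * indicator A (X i \<omega>) + ?q\<^sup>2)"
      unfolding Z_def by (intro Bochner_Integration.integral_cong) (auto simp: indicator_def
          power2_eq_square algebra_simps)
    also have "\<dots> = (1 - 2 * ?q) * ?q + ?q\<^sup>2" using E1[OF that] int1[OF that]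
      by (simp add: prob_space)
    also have "\<dots> \<le> ?q" by (simp add: power2_eq_square algebra_simps)
    finally show ?thesis .
  qed
  note * = bounded_indep_sum_moments[OF ind bd mean var, where n = n]
  show "expectation (\<lambda>\<omega>. S \<omega> ^ 2) \<le> real n * measure D A"
    unfolding S_eq by (rule *(1))
  show "expectation (\<lambda>\<omega>. S \<omega> ^ 4) \<le> real n * measure D A + 3 * (real n)\<^sup>2 * (measure D A)\<^sup>2"
    unfolding S_eq by (rule *(2))
  have [measurable]: "random_variable borel (Z i)" if "i \<ge> 1" for i
    using ind that unfolding indep_vars_def2 by auto
  have "\<bar>S \<omega>\<bar> \<le> real n" for \<omega>
  proof -
    have "\<bar>S \<omega>\<bar> \<le> (\<Sum>i\<in>{1..n}. \<bar>Z i \<omega>\<bar>)" unfolding S_eq by (rule sum_abs)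
    also have "\<dots> \<le> (\<Sum>i\<in>{1..n}. 1)" using bd by (intro sum_mono) auto
    finally show ?thesis by simp
  qed
  moreover have "S \<in> borel_measurable M" unfolding S_eq by (intro borel_measurable_sum) auto
  ultimately show "integrable M (\<lambda>\<omega>. S \<omega> ^ j)"
    by (intro integrable_const_bound[where B = "real n ^ j"]) (auto simp: power_abs intro!:
        power_mono)
qed

lemma \<beta>_second_moment:
  "k n \<ge> 1 \<Longrightarrow> expectation (\<lambda>\<omega>. \<beta> n y \<omega> ^ 2) \<le> real n / real (k n) * p n y"
  "integrable M (\<lambda>\<omega>. \<beta> n y \<omega> ^ 2)"
  using count_moments(1)[of "{b n * y powr - \<xi><..}" n] count_moments(3)[of
      "{b n * y powr - \<xi><..}" n 2]
  by (auto simp: \<beta>_def power_divide cnt_def p_def divide_right_mono)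

text \<open>Exceedance sets are nested, so an increment of \<open>\<beta>\<close> is a centred count
  over the interval between two thresholds and \<open>count_moments\<close> applies. With
  \<open>q\<close> the rescaled probability of that interval, the extra term \<open>q / k n\<close>
  is of order \<open>q\<^sup>2\<close> as soon as \<open>q\<close> is at least of order
  \<open>1 / k n\<close>.\<close>

lemma \<beta>_increment:
  fixes n :: nat
  assumes "b n > 0" "0 < x" "x \<le> y"
  defines "q \<equiv> real n / real (k n) * (p n y - p n x)"
  shows "k n \<ge> 1 \<Longrightarrow> expectation (\<lambda>\<omega>. (\<beta> n y \<omega> - \<beta> n x \<omega>) ^ 4) \<le> q / real (k n) + 3 * q\<^sup>2"
    and "integrable M (\<lambda>\<omega>. (\<beta> n y \<omega> - \<beta> n x \<omega>) ^ 4)"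
proof -
  let ?A = "{b n * y powr - \<xi><..b n * x powr - \<xi>}"
  have le: "b n * y powr - \<xi> \<le> b n * x powr - \<xi>" using assms by (intro threshold_antimono)
  have "{b n * y powr - \<xi><..} = ?A \<union> {b n * x powr - \<xi><..}" using le by auto
  then have "p n y = measure D (?A \<union> {b n * x powr - \<xi><..})" by (simp add: p_def)
  also have "\<dots> = measure D ?A + p n x"
    unfolding p_def by (rule D.finite_measure_Union) auto
  finally have mA: "measure D ?A = p n y - p n x" by simp
  have "indicator {b n * y powr - \<xi><..} z = (indicator ?A z + indicator {b n * x powr - \<xi><..} z ::
      real)" for z
    using le by (auto simp: indicator_def)
  then have inc: "\<beta> n y \<omega> - \<beta> n x \<omega> = ((\<Sum>i\<in>{1..n}. indicator ?A (X i \<omega>)) - real n * measure D ?A)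
      / sqrt (real (k n))" for \<omega>
    unfolding \<beta>_def cnt_def mA diff_divide_distrib[symmetric]
    by (simp add: sum.distrib algebra_simps)
  have s4: "sqrt (real (k n)) ^ 4 = real (k n) ^ 2"
    by (metis of_nat_0_le_iff power2_eq_square power4_eq_xxxx real_sqrt_pow2 mult.assoc)
  show "integrable M (\<lambda>\<omega>. (\<beta> n y \<omega> - \<beta> n x \<omega>) ^ 4)"
    unfolding inc using count_moments(3)[of ?A n 4] by (simp add: power_divide)
  assume k: "k n \<ge> 1"
  have "expectation (\<lambda>\<omega>. (\<beta> n y \<omega> - \<beta> n x \<omega>) ^ 4) \<le>
      (real n * measure D ?A + 3 * (real n)\<^sup>2 * (measure D ?A)\<^sup>2) / real (k n) ^ 2"
    unfolding inc power_divide s4 using count_moments(2)[of ?A n] by (simp add: divide_right_mono)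
  also have "\<dots> = q / real (k n) + 3 * q\<^sup>2"
    using k by (simp add: q_def mA power2_eq_square field_simps)
  finally show "expectation (\<lambda>\<omega>. (\<beta> n y \<omega> - \<beta> n x \<omega>) ^ 4) \<le> q / real (k n) + 3 * q\<^sup>2" .
qed

section \<open>Asymptotic equicontinuity and tightness of the tail empirical process\<close>

lemma \<alpha>_\<beta>: "k n \<ge> 1 \<Longrightarrow> \<alpha> n y \<omega> = \<beta> n y \<omega> + sqrt (real (k n)) * (real n / real (k n) * p n y - y)"
proof -
  assume "k n \<ge> 1"
  then have r: "sqrt (real (k n)) / real (k n) = 1 / sqrt (real (k n))"
    by (simp add: real_div_sqrt field_simps)
  have "sqrt (real (k n)) * (c / real (k n)) = c / sqrt (real (k n))" for c
  proof -
    have "sqrt (real (k n)) * (c / real (k n)) = (sqrt (real (k n)) / real (k n)) * c" by simp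
    then show ?thesis unfolding r by simp
  qed
  from this[of "cnt n y \<omega>"] this[of "real n * p n y"] show ?thesis unfolding \<alpha>_def \<beta>_def
    by (simp add: right_diff_distrib diff_divide_distrib)
qed

text \<open>The grid spacing \<open>s\<close> is of order \<open>\<eta> / sqrt (k n)\<close>: fine enough for the monotonicity of \<open>cnt\<close> to
  control \<open>\<alpha>\<close> between grid points, and coarse enough for the fourth moment of an increment over
  length \<open>\<delta> \<ge> s\<close> to be \<open>O(\<delta>\<^sup>2)\<close>.\<close>

lemma \<alpha>_block_oscillation:
  assumes "0 < c" "h > 0" "\<eta> > 0"
  shows "eventually (\<lambda>n. \<forall>x. c \<le> x \<longrightarrow> x + h \<le> d \<longrightarrow>
    (\<exists>E\<in>events. prob E \<le> 700000 * h\<^sup>2 / \<eta> ^ 4 \<and>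
      (\<forall>\<omega>\<in>space M - E. \<forall>y\<in>{x..x + h}. \<bar>\<alpha> n y \<omega> - \<alpha> n x \<omega>\<bar> \<le> 3 * \<eta>))) sequentially"
proof -
  have e8: "\<eta> / 8 > 0" using \<open>\<eta> > 0\<close> by simp
  show ?thesis
    using eventually_b_pos eventually_k_pos tail_uniform[OF \<open>0 < c\<close> e8, of d]
      eventually_sqrt_k[of "2 / \<eta>"] eventually_sqrt_k[of "\<eta> / h"]
  proof eventually_elim
    case (elim n)
    define K where "K = sqrt (real (k n))"
    have K2: "K * K = real (k n)" by (simp add: K_def)
    have K: "K > 0" using elim(2) by (simp add: K_def)
    have err: "\<bar>K * (real n / real (k n) * p n y - y)\<bar> < \<eta> / 8" if "c \<le> y" "y \<le> d" for y
      using elim(3) that \<open>\<eta> > 0\<close> by (auto simp: K_def)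
    have Kh: "K * \<eta> \<ge> 2" "K * h \<ge> \<eta>"
      using elim(4,5) assms by (auto simp: K_def field_simps)
    \<comment> \<open>A power of two within a factor 2 of \<open>h * K / \<eta>\<close>; the mesh
      \<open>s\<close> then satisfies \<open>\<eta> / 2 \<le> K * s \<le> \<eta>\<close>.\<close>
    obtain r where r: "2 ^ r \<le> 2 * h * K / \<eta>" "h * K / \<eta> \<le> 2 ^ r"
    proof -
      define u where "u = 2 * h * K / \<eta>"
      have u: "u \<ge> 2" using Kh assms by (simp add: u_def field_simps)
      then have "1 \<le> nat \<lfloor>u\<rfloor>" by linarith
      then obtain r where "2 ^ r \<le> nat \<lfloor>u\<rfloor>" "nat \<lfloor>u\<rfloor> < 2 ^ (r + 1)"
        using ex_power_ivl1[of 2 "nat \<lfloor>u\<rfloor>"] by auto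
      then have "real (2 ^ r) \<le> real (nat \<lfloor>u\<rfloor>)" "real (nat \<lfloor>u\<rfloor>) + 1 \<le> real (2 ^ (r + 1))"
        by (simp_all only: of_nat_le_iff Suc_le_eq flip: of_nat_Suc Suc_eq_plus1)
      moreover have "real (nat \<lfloor>u\<rfloor>) \<le> u" "u < real (nat \<lfloor>u\<rfloor>) + 1" using u by linarith+
      moreover have "real (2 ^ r) = 2 ^ r" "real (2 ^ (r + 1)) = 2 * 2 ^ r" by simp_all
      ultimately have "2 ^ r \<le> u" "u / 2 \<le> 2 ^ r" by linarith+
      moreover have "u / 2 = h * K / \<eta>" by (simp add: u_def)
      ultimately show thesis using that[of r] by (simp add: u_def)
    qed
    define s where "s = h / 2 ^ r"
    have s: "s > 0" "K * s \<le> \<eta>" "K * s \<ge> \<eta> / 2"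
      using r assms by (auto simp: s_def field_simps)
    show ?case
    proof (intro allI impI)
      fix x assume x: "c \<le> x" "x + h \<le> d"
      define g where "g i = x + real i * s" for i :: nat
      define E where "E = {\<omega>\<in>space M. \<exists>i\<le>2 ^ r. \<bar>\<beta> n (g i) \<omega> - \<beta> n (g 0) \<omega>\<bar> > \<eta>}"
      have [measurable]: "E \<in> events" unfolding E_def by measurable
      have g_range: "x \<le> g i" "g i \<le> x + h" if "i \<le> 2 ^ r" for i
      proof -
        have "real i \<le> 2 ^ r" using that by (metis of_nat_le_iff of_nat_numeral of_nat_power)
        then have "real i * s \<le> 2 ^ r * s" using s by (intro mult_right_mono) auto
        moreover have "0 \<le> real i * s" using s by simp
        moreover have "2 ^ r * s = h" by (simp add: s_def)
        ultimately show "x \<le> g i" "g i \<le> x + h" by (simp_all add: g_def)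
      qed
      \<comment> \<open>\<open>14 = 2 + 3 * 4\<close>: on a block of length \<open>\<delta>\<close>
        one has \<open>q \<le> 2 * \<delta>\<close> and \<open>1 / k n \<le> \<delta>\<close>, so
        \<open>q / k n + 3 * q\<^sup>2 \<le> 14 * \<delta>\<^sup>2\<close>. The product with
        \<open>50000\<close> is \<open>700000\<close>.\<close>
      have "prob E \<le> 50000 * (14 * h\<^sup>2) / \<eta> ^ 4"
        unfolding E_def
      proof (rule dyadic_maximal_inequality)
        fix l i assume l: "l \<le> r" "i < (2::nat) ^ l"
        define i0 where "i0 = i * 2 ^ (r - l)"
        define i1 where "i1 = (i + 1) * 2 ^ (r - l)"
        define \<delta> where "\<delta> = h / 2 ^ l"
        have pw: "(2::nat) ^ r = 2 ^ l * 2 ^ (r - l)" using l by (simp flip: power_add)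
        have "i1 \<le> 2 ^ r" unfolding i1_def pw using l by (intro mult_le_mono1) auto
        moreover have "i0 \<le> i1" unfolding i0_def i1_def by simp
        ultimately have gg: "x \<le> g i0" "g i1 \<le> x + h" "x \<le> g i1" "g i0 \<le> x + h"
          using g_range[of i0] g_range[of i1] by auto
        have pw': "(2::real) ^ r = 2 ^ l * 2 ^ (r - l)" using l by (simp flip: power_add)
        have diff: "g i1 - g i0 = \<delta>"
          unfolding g_def i0_def i1_def \<delta>_def s_def pw' by (simp add: field_simps)
        have \<delta>: "\<delta> \<ge> s" unfolding \<delta>_def s_def using l assms
          by (intro divide_left_mono power_increasing) auto
        then have d0: "\<delta> > 0" using s by simp
        define q where "q = real n / real (k n) * (p n (g i1) - p n (g i0))"
        \<comment> \<open>The two centring errors add at most \<open>\<eta> / 4\<close>, which is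
          absorbed because \<open>K * \<delta> \<ge> \<eta> / 2\<close>.\<close>
        have "K * q - K * \<delta> = K * (real n / real (k n) * p n (g i1) - g i1)
            - K * (real n / real (k n) * p n (g i0) - g i0)"
          unfolding q_def diff[symmetric] by (simp add: algebra_simps)
        moreover have "\<bar>K * (real n / real (k n) * p n (g i1) - g i1)\<bar> < \<eta> / 8"
          "\<bar>K * (real n / real (k n) * p n (g i0) - g i0)\<bar> < \<eta> / 8"
          using gg x by (intro err; linarith)+
        moreover have "x \<le> y + \<eta> / 4" if "x - y = u - v" "\<bar>u\<bar> < \<eta> / 8" "\<bar>v\<bar> < \<eta> / 8" for x y u v
          using that by linarith
        ultimately have "K * q \<le> K * \<delta> + \<eta> / 4" by blast
        moreover have Kd: "K * \<delta> \<ge> \<eta> / 2" using s(3) \<delta> K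
          by (meson mult_le_cancel_left_pos order_trans)
        moreover have "K * (2 * \<delta>) = 2 * (K * \<delta>)" by simp
        ultimately have "K * q \<le> K * (2 * \<delta>)" using \<open>\<eta> > 0\<close> by linarith
        then have q: "q \<le> 2 * \<delta>" using K by simp
        have q0: "q \<ge> 0" unfolding q_def using elim(1) gg x \<open>0 < c\<close> diff d0
          by (intro mult_nonneg_nonneg) (auto intro!: p_mono)
        have "1 \<le> K * (K * \<delta>)"
        proof -
          have "1 \<le> K * (\<eta> / 2)" using Kh by simp
          also have "\<dots> \<le> K * (K * \<delta>)" using Kd K by (intro mult_left_mono) auto
          finally show ?thesis .
        qed
        then have kd: "1 / real (k n) \<le> \<delta>" using elim(2) unfolding mult.assoc[symmetric] K2
          by (simp add: field_simps)
        have g0: "0 < g i0" "g i0 \<le> g i1" using gg x \<open>0 < c\<close> diff d0 by auto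
        have "expectation (\<lambda>\<omega>. (\<beta> n (g i1) \<omega> - \<beta> n (g i0) \<omega>) ^ 4) \<le> q / real (k n) + 3 * q\<^sup>2"
          unfolding q_def by (rule \<beta>_increment(1)[OF elim(1) g0 elim(2)])
        also have "\<dots> = q * (1 / real (k n)) + 3 * q\<^sup>2" by simp
        also have "\<dots> \<le> (2 * \<delta>) * \<delta> + 3 * (2 * \<delta>)\<^sup>2"
          using q q0 kd d0 by (intro add_mono mult_mono mult_left_mono power_mono) auto
        also have "\<dots> = 14 * h\<^sup>2 / 4 ^ l"
          by (simp add: \<delta>_def power2_eq_square power_mult_distrib[symmetric])
        finally show "expectation (\<lambda>\<omega>. (\<beta> n (g ((i + 1) * 2 ^ (r - l))) \<omega>
            - \<beta> n (g (i * 2 ^ (r - l))) \<omega>) ^ 4) \<le> 14 * h\<^sup>2 / 4 ^ l"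
          by (simp only: i0_def i1_def)
        show "integrable M (\<lambda>\<omega>. (\<beta> n (g ((i + 1) * 2 ^ (r - l))) \<omega> - \<beta> n (g (i * 2 ^ (r - l))) \<omega>)
            ^ 4)"
          using \<beta>_increment(2)[OF elim(1) g0] by (simp only: i0_def i1_def)
      qed (use assms in auto)
      moreover have "\<bar>\<alpha> n y \<omega> - \<alpha> n x \<omega>\<bar> \<le> 3 * \<eta>" if w: "\<omega> \<in> space M - E" and y: "y \<in> {x..x + h}"
          for \<omega> y
      proof -
        have ab: "\<bar>\<alpha> n y \<omega> - \<beta> n y \<omega>\<bar> < \<eta> / 8" if "c \<le> y" "y \<le> d" for y
          using err[OF that] \<alpha>_\<beta>[OF elim(2), of y \<omega>] by (simp add: K_def)
        have grid: "\<bar>\<alpha> n (g i) \<omega> - \<alpha> n x \<omega>\<bar> \<le> \<eta> + \<eta> / 4" if "i \<le> 2 ^ r" for i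
        proof -
          have "g 0 = x" by (simp add: g_def)
          then have "\<bar>\<beta> n (g i) \<omega> - \<beta> n x \<omega>\<bar> \<le> \<eta>" using w that by (auto simp: E_def not_less)
          moreover have "\<bar>\<alpha> n (g i) \<omega> - \<beta> n (g i) \<omega>\<bar> < \<eta> / 8" "\<bar>\<alpha> n x \<omega> - \<beta> n x \<omega>\<bar> < \<eta> / 8"
            using g_range[OF that] x \<open>h > 0\<close> by (intro ab; linarith)+
          ultimately show ?thesis by linarith
        qed
        define i where "i = nat \<lfloor>(y - x) / s\<rfloor>"
        have fl: "real i \<le> (y - x) / s" "(y - x) / s < real i + 1"
          using y s by (auto simp: i_def)
        have gi: "g i \<le> y" "y < g (i + 1)" using fl s by (auto simp: g_def field_simps)
        have "(y - x) / s \<le> h / s" using y s by (intro divide_right_mono) auto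
        then have "(y - x) / s \<le> 2 ^ r" using \<open>h > 0\<close> by (simp add: s_def)
        then have "real i \<le> 2 ^ r" using fl(1) by linarith
        then have "real i \<le> real (2 ^ r)" by (simp only: of_nat_power of_nat_numeral)
        then have i: "i \<le> 2 ^ r" by (simp only: of_nat_le_iff)
        have step: "K * (cnt n u \<omega> / real (k n)) \<le> K * (cnt n v \<omega> / real (k n))"
            if "0 < u" "u \<le> v" for u v
          using cnt_mono[OF elim(1) that, of \<omega>] K by (intro mult_left_mono divide_right_mono) auto
        have xpos: "0 < x" using x \<open>0 < c\<close> by simp
        have gpos: "0 < g j" for j using xpos s by (simp add: g_def add_pos_nonneg)
        have gs: "K * g (i + 1) = K * g i + K * s" by (simp add: g_def algebra_simps)
        \<comment> \<open>The count is monotone between neighbouring grid points. Hence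
          \<open>\<alpha>\<close> falls below its value at the left neighbour, or rises above that
          at the right one, only through the deterministic drift, at most
          \<open>K * s \<le> \<eta>\<close>.\<close>
        have low: "\<alpha> n y \<omega> \<ge> \<alpha> n (g i) \<omega> - \<eta>"
        proof -
          have "K * y \<le> K * g (i + 1)" using gi K by simp
          then show ?thesis
            using step[OF gpos gi(1)] gs s(2) unfolding \<alpha>_def K_def[symmetric] right_diff_distrib
              by linarith
        qed
        have up: "\<alpha> n y \<omega> \<le> \<alpha> n x \<omega> + \<eta> + \<eta> / 4 + \<eta>"
        \<comment> \<open>At the right end of the block \<open>g (i + 1)\<close> lies outside, but
          there \<open>y\<close> is itself a grid point.\<close>
        proof (cases "i = 2 ^ r")
          case True
          then have "g i = x + h" by (simp add: g_def s_def)
          then have y: "y = g i" using gi y by auto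
          show ?thesis unfolding y using grid[OF i] \<open>\<eta> > 0\<close> by linarith
        next
          case False
          then have "i + 1 \<le> 2 ^ r" using i by simp
          note gr = grid[OF this]
          have "0 < y" using y xpos by auto
          have "K * y \<ge> K * g i" using gi K by simp
          then have "\<alpha> n y \<omega> \<le> \<alpha> n (g (i + 1)) \<omega> + \<eta>"
            using step[OF \<open>0 < y\<close> less_imp_le[OF gi(2)]] gs s(2)
              unfolding \<alpha>_def K_def[symmetric] right_diff_distrib by linarith
          then show ?thesis using gr by linarith
        qed
        show ?thesis using low up grid[OF i] \<open>\<eta> > 0\<close> by linarith
      qed
      ultimately show "\<exists>E\<in>events. prob E \<le> 700000 * h\<^sup>2 / \<eta> ^ 4 \<and>
        (\<forall>\<omega>\<in>space M - E. \<forall>y\<in>{x..x + h}. \<bar>\<alpha> n y \<omega> - \<alpha> n x \<omega>\<bar> \<le> 3 * \<eta>)"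
        using \<open>E \<in> events\<close> by (intro bexI[of _ E]) auto
    qed
  qed
qed

text \<open>About \<open>(d - c) / h\<close> blocks, each bad with probability
  \<open>O(h\<^sup>2)\<close>, give a total of \<open>O(h)\<close>. Points at distance at most
  \<open>h\<close> lie in the same block or in adjacent ones.\<close>

lemma \<alpha>_modulus:
  assumes "0 < c" "\<eta> > 0" "\<epsilon> > 0"
  shows "\<exists>\<delta>>0. eventually (\<lambda>n. \<exists>E\<in>events. prob E \<le> \<epsilon> \<and>
    (\<forall>\<omega>\<in>space M - E. \<forall>x\<in>{c..d}. \<forall>y\<in>{c..d}. \<bar>x - y\<bar> \<le> \<delta> \<longrightarrow> \<bar>\<alpha> n x \<omega> - \<alpha> n y \<omega>\<bar> \<le> \<eta>)) sequentially"
proof (cases "c \<le> d")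
  case False
  then show ?thesis using assms by (intro exI[of _ 1]) (auto intro!: always_eventually bexI[of _
      "{}"])
next
  case True
  \<comment> \<open>Points of adjacent blocks are compared through the left ends of both blocks, in
    three steps of at most \<open>3 * \<eta>'\<close> each.\<close>
  define \<eta>' where "\<eta>' = \<eta> / 9"
  define C where "C = 700000 / \<eta>' ^ 4"
  have C: "C > 0" using assms by (simp add: C_def \<eta>'_def)
  define h where "h = min 1 (\<epsilon> / (C * (d - c + 1)))"
  have h: "h > 0" "h \<le> 1" using assms C True by (auto simp: h_def)
  define m where "m = nat \<lfloor>(d - c) / h\<rfloor>"
  have m: "real j \<le> (d - c) / h \<longleftrightarrow> j \<le> m" for j
    using True h unfolding m_def by (simp add: le_nat_floor le_floor_iff nat_le_iff le_nat_iff)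
  have "\<eta>' > 0" using assms by (simp add: \<eta>'_def)
  \<comment> \<open>The range extends to \<open>d + 1\<close> because the last block may protrude
    beyond \<open>d\<close> by at most \<open>h \<le> 1\<close>.\<close>
  from \<alpha>_block_oscillation[OF \<open>0 < c\<close> h(1) this, of "d + 1"]
  have "eventually (\<lambda>n. \<exists>E\<in>events. prob E \<le> \<epsilon> \<and>
    (\<forall>\<omega>\<in>space M - E. \<forall>x\<in>{c..d}. \<forall>y\<in>{c..d}. \<bar>x - y\<bar> \<le> h \<longrightarrow> \<bar>\<alpha> n x \<omega> - \<alpha> n y \<omega>\<bar> \<le> \<eta>)) sequentially"
  proof eventually_elim
    case (elim n)
    define g where "g j = c + real j * h" for j :: nat
    have g: "c \<le> g j" "g j \<le> d" if "j \<le> m" for j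
      using m[of j] that h by (auto simp: g_def field_simps)
    have "\<forall>j\<in>{..m}. \<exists>E. E \<in> events \<and> prob E \<le> C * h\<^sup>2 \<and>
      (\<forall>\<omega>\<in>space M - E. \<forall>y\<in>{g j..g j + h}. \<bar>\<alpha> n y \<omega> - \<alpha> n (g j) \<omega>\<bar> \<le> 3 * \<eta>')"
    proof
      fix j assume j: "j \<in> {..m}"
      then have "c \<le> g j" "g j + h \<le> d + 1" using g[of j] h by auto
      from elim[rule_format, OF this] show "\<exists>E. E \<in> events \<and> prob E \<le> C * h\<^sup>2 \<and>
        (\<forall>\<omega>\<in>space M - E. \<forall>y\<in>{g j..g j + h}. \<bar>\<alpha> n y \<omega> - \<alpha> n (g j) \<omega>\<bar> \<le> 3 * \<eta>')"
        by (auto simp: C_def)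
    qed
    then obtain E where E: "\<forall>j\<in>{..m}. E j \<in> events \<and> prob (E j) \<le> C * h\<^sup>2 \<and>
      (\<forall>\<omega>\<in>space M - E j. \<forall>y\<in>{g j..g j + h}. \<bar>\<alpha> n y \<omega> - \<alpha> n (g j) \<omega>\<bar> \<le> 3 * \<eta>')"
      by (rule bchoice[THEN exE])
    have "prob (\<Union>j\<le>m. E j) \<le> (\<Sum>j\<le>m. prob (E j))"
      using E by (intro finite_measure_subadditive_finite) auto
    also have "\<dots> \<le> (\<Sum>j\<le>m. C * h\<^sup>2)" using E by (intro sum_mono) auto
    also have "\<dots> = (real m + 1) * (C * h\<^sup>2)" by simp
    also have "\<dots> \<le> ((d - c) / h + 1) * (C * h\<^sup>2)"
      using m[of m] C by (intro mult_right_mono) auto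
    also have "\<dots> = C * (d - c + h) * h" using h by (simp add: power2_eq_square field_simps)
    also have "\<dots> \<le> C * (d - c + 1) * h" using h C True
      by (intro mult_right_mono mult_left_mono) auto
    also have "\<dots> \<le> C * (d - c + 1) * (\<epsilon> / (C * (d - c + 1)))"
      using C True by (intro mult_left_mono) (auto simp: h_def)
    also have "\<dots> = \<epsilon>" using C True by simp
    finally have pr: "prob (\<Union>j\<le>m. E j) \<le> \<epsilon>" .
    have main: "\<bar>\<alpha> n x \<omega> - \<alpha> n y \<omega>\<bar> \<le> \<eta>"
      if w: "\<omega> \<in> space M - (\<Union>j\<le>m. E j)" and x: "c \<le> x" and xy: "x \<le> y" and y: "y \<le> d" "y - x \<le> h"
          for \<omega> x y
    proof -
      have blk: "\<bar>\<alpha> n y \<omega> - \<alpha> n (g j) \<omega>\<bar> \<le> 3 * \<eta>'" if "j \<le> m" "g j \<le> y" "y \<le> g j + h" for j y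
        using E w that by auto
      define j where "j = nat \<lfloor>(x - c) / h\<rfloor>"
      have fl: "real j \<le> (x - c) / h" "(x - c) / h < real j + 1"
        using x h by (auto simp: j_def)
      have "(x - c) / h \<le> (d - c) / h" using x xy y h by (intro divide_right_mono) auto
      then have jm: "j \<le> m" using fl m[of j] by simp
      have gx: "g j \<le> x" "x \<le> g j + h" using fl h by (auto simp: g_def field_simps)
      show ?thesis
      proof (cases "y \<le> g j + h")
        case True
        then show ?thesis using blk[OF jm gx] blk[OF jm order_trans[OF gx(1) xy] True] \<open>\<eta> > 0\<close>
          unfolding \<eta>'_def by linarith
      next
        case False
        have g1: "g (Suc j) = g j + h" by (simp add: g_def algebra_simps)
        then have "g (Suc j) \<le> d" using False y by simp
        then have "Suc j \<le> m" using m[of "Suc j"] h by (simp add: g_def field_simps)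
        from blk[OF this, of y] have "\<bar>\<alpha> n y \<omega> - \<alpha> n (g j + h) \<omega>\<bar> \<le> 3 * \<eta>'"
          using False gx xy y unfolding g1 by auto
        moreover have "\<bar>\<alpha> n (g j + h) \<omega> - \<alpha> n (g j) \<omega>\<bar> \<le> 3 * \<eta>'" using blk[OF jm, of "g j + h"] h
          by auto
        ultimately show ?thesis using blk[OF jm gx] unfolding \<eta>'_def by linarith
      qed
    qed
    have "\<forall>\<omega>\<in>space M - (\<Union>j\<le>m. E j). \<forall>x\<in>{c..d}. \<forall>y\<in>{c..d}. \<bar>x - y\<bar> \<le> h \<longrightarrow> \<bar>\<alpha> n x \<omega> - \<alpha> n y \<omega>\<bar> \<le> \<eta>"
    proof (intro ballI impI)
      fix \<omega> x y assume *: "\<omega> \<in> space M - (\<Union>j\<le>m. E j)" "x \<in> {c..d}" "y \<in> {c..d}" "\<bar>x - y\<bar> \<le> h"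
      show "\<bar>\<alpha> n x \<omega> - \<alpha> n y \<omega>\<bar> \<le> \<eta>"
        using main[OF *(1), of x y] main[OF *(1), of y x] *
          by (cases "x \<le> y") (auto simp: abs_minus_commute)
    qed
    moreover have "(\<Union>j\<le>m. E j) \<in> events" using E by auto
    ultimately show ?case using pr by blast
  qed
  then show ?thesis using h by blast
qed

lemma \<alpha>_stochastically_bounded:
  assumes "0 < y" "\<epsilon> > 0"
  shows "\<exists>P>0. eventually (\<lambda>n. prob {\<omega>\<in>space M. \<bar>\<alpha> n y \<omega>\<bar> > P} \<le> \<epsilon>) sequentially"
proof -
  \<comment> \<open>Chebyshev: the second moment of \<open>\<beta>\<close> is eventually below
    \<open>y + 1\<close>. The bound for \<open>\<alpha>\<close> is \<open>P + 1\<close>, where the 1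
    covers the centring error.\<close>
  define P where "P = sqrt ((y + 1) / \<epsilon>)"
  have P: "P > 0" "P\<^sup>2 = (y + 1) / \<epsilon>" using assms by (auto simp: P_def)
  have "eventually (\<lambda>n. real n / real (k n) * p n y < y + 1) sequentially"
    by (rule order_tendstoD[OF tail_tendsto[OF assms(1)]]) simp
  then have "eventually (\<lambda>n. prob {\<omega>\<in>space M. \<bar>\<alpha> n y \<omega>\<bar> > P + 1} \<le> \<epsilon>) sequentially"
    using eventually_k_pos tail_uniform[OF assms(1) zero_less_one, of y]
  proof eventually_elim
    case (elim n)
    have "prob {\<omega>\<in>space M. \<bar>\<alpha> n y \<omega>\<bar> > P + 1} \<le> prob {\<omega>\<in>space M. \<beta> n y \<omega> ^ 2 \<ge> P\<^sup>2}"
    proof (rule finite_measure_mono)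
      show "{\<omega>\<in>space M. \<bar>\<alpha> n y \<omega>\<bar> > P + 1} \<subseteq> {\<omega>\<in>space M. \<beta> n y \<omega> ^ 2 \<ge> P\<^sup>2}"
      proof (clarify)
        fix \<omega> assume "P + 1 < \<bar>\<alpha> n y \<omega>\<bar>"
        moreover have "\<bar>sqrt (real (k n)) * (real n / real (k n) * p n y - y)\<bar> < 1" using elim(3)
          by simp
        ultimately have "P \<le> \<bar>\<beta> n y \<omega>\<bar>" unfolding \<alpha>_\<beta>[OF elim(2)] by linarith
        then show "P\<^sup>2 \<le> \<beta> n y \<omega> ^ 2" using power_mono[of P "\<bar>\<beta> n y \<omega>\<bar>" 2] P by simp
      qed
    qed measurable
    also have "\<dots> \<le> expectation (\<lambda>\<omega>. \<beta> n y \<omega> ^ 2) / P\<^sup>2"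
      using zero_less_power[OF P(1), of 2] \<beta>_second_moment(2)[of n y]
        by (intro integral_Markov_inequality_measure[where A = "{}"]) auto
    also have "\<dots> \<le> (y + 1) / P\<^sup>2"
      using \<beta>_second_moment(1)[OF elim(2), of y] elim(1) by (intro divide_right_mono) auto
    also have "\<dots> = \<epsilon>" using P assms by simp
    finally show ?case .
  qed
  then show ?thesis using P by (intro exI[of _ "P + 1"]) auto
qed

text \<open>A bound at the left end is carried through the interval in \<open>m\<close> steps of
  length \<open>\<delta>\<close>, each costing \<open>\<eta>\<close>.\<close>

lemma \<alpha>_bounded_equicontinuous:
  assumes "0 < c" "\<eta> > 0" "\<epsilon> > 0"
  shows "\<exists>\<delta>>0. \<exists>A. eventually (\<lambda>n. \<exists>E\<in>events. prob E \<le> \<epsilon> \<and>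
    (\<forall>\<omega>\<in>space M - E. (\<forall>x\<in>{c..d}. \<bar>\<alpha> n x \<omega>\<bar> \<le> A) \<and>
      (\<forall>x\<in>{c..d}. \<forall>y\<in>{c..d}. \<bar>x - y\<bar> \<le> \<delta> \<longrightarrow> \<bar>\<alpha> n x \<omega> - \<alpha> n y \<omega>\<bar> \<le> \<eta>))) sequentially"
proof -
  have e2: "\<epsilon> / 2 > 0" using assms by simp
  obtain \<delta> where \<delta>: "\<delta> > 0" and ev: "eventually (\<lambda>n. \<exists>E\<in>events. prob E \<le> \<epsilon> / 2 \<and>
    (\<forall>\<omega>\<in>space M - E. \<forall>x\<in>{c..d}. \<forall>y\<in>{c..d}. \<bar>x - y\<bar> \<le> \<delta> \<longrightarrow> \<bar>\<alpha> n x \<omega> - \<alpha> n y \<omega>\<bar> \<le> \<eta>)) sequentially"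
    using \<alpha>_modulus[OF assms(1,2) e2] by blast
  obtain P where P: "eventually (\<lambda>n. prob {\<omega>\<in>space M. \<bar>\<alpha> n c \<omega>\<bar> > P} \<le> \<epsilon> / 2) sequentially"
    using \<alpha>_stochastically_bounded[OF assms(1) e2] by blast
  define m where "m = nat \<lceil>(d - c) / \<delta>\<rceil>"
  have m: "d \<le> c + real m * \<delta>"
  proof -
    have "(d - c) / \<delta> \<le> real m" unfolding m_def by linarith
    then show ?thesis using \<delta> by (simp add: field_simps)
  qed
  define A where "A = P + real m * \<eta>"
  have "eventually (\<lambda>n. \<exists>E\<in>events. prob E \<le> \<epsilon> \<and>
    (\<forall>\<omega>\<in>space M - E. (\<forall>x\<in>{c..d}. \<bar>\<alpha> n x \<omega>\<bar> \<le> A) \<and>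
      (\<forall>x\<in>{c..d}. \<forall>y\<in>{c..d}. \<bar>x - y\<bar> \<le> \<delta> \<longrightarrow> \<bar>\<alpha> n x \<omega> - \<alpha> n y \<omega>\<bar> \<le> \<eta>))) sequentially"
    using ev P
  proof eventually_elim
    case (elim n)
    then obtain E1 where E1: "E1 \<in> events" "prob E1 \<le> \<epsilon> / 2"
      and mod: "\<And>\<omega> x y. \<omega> \<in> space M - E1 \<Longrightarrow> x \<in> {c..d} \<Longrightarrow> y \<in> {c..d} \<Longrightarrow> \<bar>x - y\<bar> \<le> \<delta> \<Longrightarrow>
          \<bar>\<alpha> n x \<omega> - \<alpha> n y \<omega>\<bar> \<le> \<eta>"
      by blast
    define E where "E = E1 \<union> {\<omega>\<in>space M. \<bar>\<alpha> n c \<omega>\<bar> > P}"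
    have m2: "{\<omega>\<in>space M. \<bar>\<alpha> n c \<omega>\<bar> > P} \<in> events" by measurable
    have "prob E \<le> prob E1 + prob {\<omega>\<in>space M. \<bar>\<alpha> n c \<omega>\<bar> > P}"
      unfolding E_def by (rule measure_Un_le[OF E1(1) m2])
    then have "prob E \<le> \<epsilon>" using E1 elim(2) by simp
    moreover have "\<bar>\<alpha> n x \<omega>\<bar> \<le> A" if w: "\<omega> \<in> space M - E" and x: "x \<in> {c..d}" for \<omega> x
    proof -
      have w1: "\<omega> \<in> space M - E1" using w by (auto simp: E_def)
      have "\<bar>\<alpha> n x \<omega> - \<alpha> n c \<omega>\<bar> \<le> real j * \<eta>" if "x \<in> {c..d}" "x \<le> c + real j * \<delta>" for j x
        using that
      proof (induction j arbitrary: x)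
        case 0
        then have "x = c" by auto
        then show ?case by simp
      next
        case (Suc j)
        define y where "y = max c (x - \<delta>)"
        have y: "y \<in> {c..d}" "y \<le> c + real j * \<delta>" "\<bar>x - y\<bar> \<le> \<delta>"
          using Suc.prems \<delta> by (auto simp: y_def algebra_simps)
        have "\<bar>\<alpha> n y \<omega> - \<alpha> n c \<omega>\<bar> \<le> real j * \<eta>" by (rule Suc.IH[OF y(1,2)])
        moreover have "\<bar>\<alpha> n x \<omega> - \<alpha> n y \<omega>\<bar> \<le> \<eta>" by (rule mod[OF w1 Suc.prems(1) y(1,3)])
        ultimately show ?case by (simp add: algebra_simps abs_le_iff)
      qed
      from this[OF x, of m] have "\<bar>\<alpha> n x \<omega> - \<alpha> n c \<omega>\<bar> \<le> real m * \<eta>" using x m by auto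
      moreover have "\<bar>\<alpha> n c \<omega>\<bar> \<le> P" using w by (auto simp: E_def)
      ultimately show ?thesis unfolding A_def by linarith
    qed
    moreover have "E \<in> events" using E1(1) m2 unfolding E_def by auto
    ultimately show ?case using mod unfolding E_def by (intro bexI[of _ E]) (auto simp: E_def)
  qed
  then show ?thesis using \<delta> by blast
qed

section \<open>Inversion: from counts to order statistics\<close>

lemma cnt_eq_card: "cnt n y \<omega> = real (card {i\<in>{1..n}. X i \<omega> > b n * y powr - \<xi>})"
proof -
  have "cnt n y \<omega> = (\<Sum>i\<in>{1..n}. if X i \<omega> > b n * y powr - \<xi> then 1 else 0)"
    unfolding cnt_def by (intro sum.cong) (auto simp: indicator_def)
  then show ?thesis by (simp add: sum.If_cases Int_def)
qed

text \<open>The quadratic remainder of the logarithm, with a common bound \<open>U\<close> so that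
  the estimate is uniform over the order statistics.\<close>

lemma ln_one_minus_bound:
  fixes u K :: real
  assumes "K > 0" "\<bar>u\<bar> \<le> U" "U / K \<le> 1 / 2" "2 * U\<^sup>2 / K \<le> \<kappa>"
  shows "\<bar>K * ln (1 - u / K) + u\<bar> \<le> \<kappa>"
proof -
  have "\<bar>u / K\<bar> \<le> U / K" using assms by (simp add: divide_right_mono)
  then have "\<bar>- u / K\<bar> \<le> 1 / 2" using assms by simp
  from abs_ln_one_plus_x_minus_x_bound[OF this]
  have "\<bar>ln (1 - u / K) + u / K\<bar> \<le> 2 * (u / K)\<^sup>2" by simp
  then have "K * \<bar>ln (1 - u / K) + u / K\<bar> \<le> K * (2 * (u / K)\<^sup>2)" using assms
    by (intro mult_left_mono) auto
  also have "\<dots> = 2 * \<bar>u\<bar>\<^sup>2 / K" using assms by (simp add: power2_eq_square)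
  also have "\<dots> \<le> 2 * U\<^sup>2 / K" using assms by (intro divide_right_mono mult_left_mono power_mono)
      auto
  also have "K * \<bar>ln (1 - u / K) + u / K\<bar> = \<bar>K * ln (1 - u / K) + u\<bar>"
  proof -
    have "K * \<bar>ln (1 - u / K) + u / K\<bar> = \<bar>K * (ln (1 - u / K) + u / K)\<bar>"
      using assms(1) by (simp add: abs_mult)
    also have "K * (ln (1 - u / K) + u / K) = K * ln (1 - u / K) + u"
      using assms(1) by (simp add: distrib_left)
    finally show ?thesis .
  qed
  finally show ?thesis using assms by simp
qed

text \<open>The \<open>j\<close>-th largest observation exceeds \<open>b n * y powr - \<xi>\<close> iff \<open>j \<le> cnt n y\<close>; the choices
  \<open>y = t - (\<alpha> n t \<mp> 2 * \<eta>) / sqrt (k n)\<close> therefore bracket it.\<close>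

lemma order_stat_expansion:
  assumes b: "b n > 0" and k: "1 \<le> k n" "k n \<le> n" and j: "1 \<le> j" "j \<le> k n"
    and t: "t = real j / real (k n)" "\<tau> \<le> t" and pos: "\<tau> > 0" "\<eta> > 0"
    and mod: "\<And>y. y \<in> {\<tau>/2..2} \<Longrightarrow> \<bar>y - t\<bar> \<le> \<delta> \<Longrightarrow> \<bar>\<alpha> n y \<omega> - \<alpha> n t \<omega>\<bar> \<le> \<eta>"
    and A: "\<bar>\<alpha> n t \<omega>\<bar> \<le> A"
    and big: "(A + 2 * \<eta>) / sqrt (real (k n)) \<le> \<delta>" "(A + 2 * \<eta>) / sqrt (real (k n)) \<le> \<tau> / 2"
      "2 * ((A + 2 * \<eta>) / \<tau>)\<^sup>2 / sqrt (real (k n)) \<le> \<eta> / \<tau>"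
  shows "desc_order_stat X n j \<omega> > 0"
    and "\<bar>sqrt (real (k n)) * (ln (desc_order_stat X n j \<omega> / b n) + \<xi> * ln t) - \<xi> * (\<alpha> n t \<omega> / t)\<bar>
        \<le> 3 * \<xi> * \<eta> / \<tau>"
proof -
  define K where "K = sqrt (real (k n))"
  have K: "K > 0" using k by (simp add: K_def)
  have t1: "t \<le> 1" using j k by (simp add: t)
  have t0: "t > 0" using t pos by simp
  define a where "a = \<alpha> n t \<omega>"
  define Z where "Z = desc_order_stat X n j \<omega>"
  have jn: "j \<le> n" using j k by simp
  have gt_iff: "Z > b n * y powr - \<xi> \<longleftrightarrow> real j \<le> cnt n y \<omega>" for y
    unfolding Z_def desc_order_stat_gt_iff[OF j(1) jn] cnt_eq_card by simp
  have cnt: "K * (cnt n y \<omega> / real (k n) - t) = \<alpha> n y \<omega> + K * (y - t)" for y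
    unfolding \<alpha>_def K_def by (simp add: algebra_simps)
  \<comment> \<open>The first two bounds in \<open>big\<close> keep the bracketing points within
    \<open>\<delta>\<close> of \<open>t\<close> and inside \<open>{\<tau>/2..2}\<close>, where
    \<open>mod\<close> applies.\<close>
  have near: "\<bar>v\<bar> \<le> A + 2 * \<eta> \<Longrightarrow> t - v / K \<in> {\<tau>/2..2} \<and> \<bar>t - v / K - t\<bar> \<le> \<delta> \<and> 0 < t - v / K" for v
  proof -
    assume "\<bar>v\<bar> \<le> A + 2 * \<eta>"
    then have "\<bar>v / K\<bar> \<le> (A + 2 * \<eta>) / K" using K by (simp add: divide_right_mono)
    then have "\<bar>v / K\<bar> \<le> \<delta>" "\<bar>v / K\<bar> \<le> \<tau> / 2" using big unfolding K_def by linarith+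
    then show ?thesis unfolding atLeastAtMost_iff using t(2) t1 pos by (intro conjI) linarith+
  qed
  have jk: "real j \<le> cnt n y \<omega> \<longleftrightarrow> t \<le> cnt n y \<omega> / real (k n)" for y
    using k by (simp add: t divide_le_cancel)
  have l: "\<bar>a - 2 * \<eta>\<bar> \<le> A + 2 * \<eta>" "\<bar>a + 2 * \<eta>\<bar> \<le> A + 2 * \<eta>" using A pos unfolding a_def by auto
  define y1 where "y1 = t - (a - 2 * \<eta>) / K"
  define y2 where "y2 = t - (a + 2 * \<eta>) / K"
  have y: "0 < y1" "0 < y2" using near[OF l(1)] near[OF l(2)] by (auto simp: y1_def y2_def)
  \<comment> \<open>The displacement contributes \<open>2 * \<eta> - a\<close>, and
    \<open>\<alpha>\<close> differs from \<open>a\<close> by at most \<open>\<eta>\<close>, so the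
    sign is certain. At \<open>y2\<close> the displacement contributes
    \<open>- 2 * \<eta> - a\<close>, with the opposite outcome.\<close>
  have "K * (cnt n y1 \<omega> / real (k n) - t) = \<alpha> n y1 \<omega> - a + 2 * \<eta>"
    unfolding cnt using K by (simp add: y1_def)
  moreover have "\<bar>\<alpha> n y1 \<omega> - a\<bar> \<le> \<eta>" using near[OF l(1)] mod[of y1] by (simp add: y1_def a_def)
  ultimately have "K * (cnt n y1 \<omega> / real (k n) - t) \<ge> 0" using pos by linarith
  then have "t \<le> cnt n y1 \<omega> / real (k n)" using K by (simp add: zero_le_mult_iff)
  then have Z1: "Z > b n * y1 powr - \<xi>" using gt_iff jk by blast
  have "K * (cnt n y2 \<omega> / real (k n) - t) = \<alpha> n y2 \<omega> - a - 2 * \<eta>"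
    unfolding cnt using K by (simp add: y2_def)
  moreover have "\<bar>\<alpha> n y2 \<omega> - a\<bar> \<le> \<eta>" using near[OF l(2)] mod[of y2] by (simp add: y2_def a_def)
  ultimately have "K * (cnt n y2 \<omega> / real (k n) - t) < 0" using pos by linarith
  then have "\<not> t \<le> cnt n y2 \<omega> / real (k n)" using K by (simp add: mult_less_0_iff)
  then have Z2: "Z \<le> b n * y2 powr - \<xi>" using gt_iff jk by (meson not_le)
  have "b n * y1 powr - \<xi> > 0" using b y by simp
  then have Z0: "Z > 0" using Z1 by linarith
  then show "desc_order_stat X n j \<omega> > 0" by (simp add: Z_def)
  have "ln (y1 powr - \<xi>) \<le> ln (Z / b n)"
    using Z1 b y Z0 by (subst ln_le_cancel_iff) (auto simp: field_simps)
  then have L1: "- \<xi> * ln y1 \<le> ln (Z / b n)" using y by (simp add: ln_powr)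
  have "ln (Z / b n) \<le> ln (y2 powr - \<xi>)"
    using Z2 b y Z0 by (subst ln_le_cancel_iff) (auto simp: field_simps)
  then have L2: "ln (Z / b n) \<le> - \<xi> * ln y2" using y by (simp add: ln_powr)
  \<comment> \<open>Relative displacements: they split \<open>ln y1\<close> and \<open>ln y2\<close>
    into \<open>ln t\<close> and the logarithm of a factor near 1.\<close>
  define u1 where "u1 = (a - 2 * \<eta>) / t"
  define u2 where "u2 = (a + 2 * \<eta>) / t"
  have Y: "y1 = t * (1 - u1 / K)" "y2 = t * (1 - u2 / K)"
  proof -
    have tu: "t * (u1 / K) = (a - 2 * \<eta>) / K" "t * (u2 / K) = (a + 2 * \<eta>) / K"
      using t0 by (simp_all add: u1_def u2_def)
    show "y1 = t * (1 - u1 / K)" "y2 = t * (1 - u2 / K)"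
      unfolding y1_def y2_def right_diff_distrib tu mult_1_right by (rule refl)+
  qed
  have "0 < 1 - u1 / K" "0 < 1 - u2 / K" using y t0 unfolding Y
    by (simp_all add: zero_less_mult_iff)
  then have ly: "ln y1 = ln t + ln (1 - u1 / K)" "ln y2 = ln t + ln (1 - u2 / K)"
    unfolding Y using t0 by (auto intro!: ln_mult_pos)
  have A0: "0 \<le> A + 2 * \<eta>" using l by linarith
  have ub: "\<bar>v / t\<bar> \<le> (A + 2 * \<eta>) / \<tau>" if "\<bar>v\<bar> \<le> A + 2 * \<eta>" for v
  proof -
    have "\<bar>v / t\<bar> = \<bar>v\<bar> / t" using t0 by simp
    also have "\<dots> \<le> (A + 2 * \<eta>) / \<tau>" using that t pos A0 by (intro frac_le) auto
    finally show ?thesis .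
  qed
  have half: "(A + 2 * \<eta>) / \<tau> / K \<le> 1 / 2"
    using big(2) pos K unfolding K_def[symmetric] by (simp add: field_simps)
  have B: "\<bar>K * ln (1 - u1 / K) + u1\<bar> \<le> \<eta> / \<tau>" "\<bar>K * ln (1 - u2 / K) + u2\<bar> \<le> \<eta> / \<tau>"
    unfolding u1_def u2_def
    using ln_one_minus_bound[OF K ub[OF l(1)] half big(3)[folded K_def]]
      ln_one_minus_bound[OF K ub[OF l(2)] half big(3)[folded K_def]] by auto
  have et: "\<eta> / t \<le> \<eta> / \<tau>" using t(2) t0 pos by (intro divide_left_mono mult_pos_pos) simp_all
  define W where "W = K * (ln (Z / b n) + \<xi> * ln t)"
  have "K * (- \<xi> * ln y1 + \<xi> * ln t) \<le> W" unfolding W_def using L1 K by (intro mult_left_mono) auto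
  moreover have "K * (- \<xi> * ln y1 + \<xi> * ln t) = - \<xi> * (K * ln (1 - u1 / K))" unfolding ly
    by (simp add: algebra_simps)
  moreover have "- \<xi> * (K * ln (1 - u1 / K)) \<ge> - \<xi> * (\<eta> / \<tau> - u1)"
    using B(1) xi by (intro mult_left_mono_neg) auto
  ultimately have W1: "\<xi> * u1 - \<xi> * (\<eta> / \<tau>) \<le> W" by (simp add: algebra_simps)
  have "W \<le> K * (- \<xi> * ln y2 + \<xi> * ln t)" unfolding W_def using L2 K by (intro mult_left_mono) auto
  moreover have "K * (- \<xi> * ln y2 + \<xi> * ln t) = - \<xi> * (K * ln (1 - u2 / K))" unfolding ly
    by (simp add: algebra_simps)
  moreover have "- \<xi> * (K * ln (1 - u2 / K)) \<le> - \<xi> * (- (\<eta> / \<tau>) - u2)"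
    using B(2) xi by (intro mult_left_mono_neg) auto
  ultimately have W2: "W \<le> \<xi> * u2 + \<xi> * (\<eta> / \<tau>)" by (simp add: algebra_simps)
  have "\<xi> * (\<eta> / t) \<le> \<xi> * (\<eta> / \<tau>)" using et xi by (intro mult_left_mono) auto
  moreover have "\<xi> * u1 = \<xi> * (a / t) - 2 * (\<xi> * (\<eta> / t))"
      "\<xi> * u2 = \<xi> * (a / t) + 2 * (\<xi> * (\<eta> / t))"
    by (simp_all add: u1_def u2_def diff_divide_distrib add_divide_distrib algebra_simps)
  \<comment> \<open>The margin contributes \<open>2 * \<eta> / t\<close> and the linearised
    logarithm \<open>\<eta> / \<tau>\<close>; with the factor \<open>\<xi>\<close> this is at most
    \<open>3 * \<xi> * \<eta> / \<tau>\<close>.\<close>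
  moreover have "\<bar>w - x\<bar> \<le> 3 * z" if "y \<le> z" "v1 = x - 2 * y" "v2 = x + 2 * y" "v1 - z \<le> w"
      "w \<le> v2 + z"
    for w x y z v1 v2 :: real
    using that by linarith
  ultimately have "\<bar>W - \<xi> * (a / t)\<bar> \<le> 3 * (\<xi> * (\<eta> / \<tau>))" using W1 W2 by blast
  then show "\<bar>sqrt (real (k n)) * (ln (desc_order_stat X n j \<omega> / b n) + \<xi> * ln t)
      - \<xi> * (\<alpha> n t \<omega> / t)\<bar> \<le> 3 * \<xi> * \<eta> / \<tau>"
    by (simp add: W_def K_def Z_def a_def)
qed

text \<open>If \<open>W\<close> is a Brownian motion, then \<open>W t / t - W 1\<close> has the law of \<open>B t / t\<close>.\<close>

definition G :: "nat \<Rightarrow> real \<Rightarrow> 'v \<Rightarrow> real" where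
  "G n t \<omega> = \<xi> * (\<alpha> n t \<omega> / t - \<alpha> n 1 \<omega>)"

lemma G_measurable[measurable]: "G n t \<in> borel_measurable M"
  unfolding G_def[abs_def] by measurable

text \<open>A linear combination of the \<open>G n (t i)\<close> is a normalised centred row sum of
  one bounded function \<open>h n\<close> of the observations, plus a deterministic centring error
  \<open>d n\<close>. The quadratic form is the one that \<open>brownian_bridge_iexp\<close> yields
  for the weights \<open>a i * \<xi> / t i\<close>.\<close>

lemma G_iexp_tendsto:
  fixes t :: "nat \<Rightarrow> real"
  assumes t: "\<And>i. i < m \<Longrightarrow> 0 < t i \<and> t i \<le> 1"
  shows "(\<lambda>n. expectation (\<lambda>\<omega>. iexp (\<Sum>i<m. a i * G n (t i) \<omega>))) \<longlonglongrightarrow>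
    complex_of_real (exp (- (\<Sum>i<m. \<Sum>j<m. (a i * \<xi> / t i) * (a j * \<xi> / t j) * (min (t i) (t j)
        - t i * t j)) / 2))"
proof -
  define I where "I n y = (indicator {b n * y powr - \<xi><..} :: real \<Rightarrow> real)" for n y
  have [measurable]: "I n y \<in> borel_measurable borel" for n y unfolding I_def by simp
  have intI: "integrable D (I n y)" for n y
    unfolding I_def by (rule D.integrable_const_bound[of _ 1]) (auto simp: indicator_def)
  have EI: "(\<integral>x. I n y x \<partial>D) = p n y" for n y by (simp add: I_def p_def)
  define h where "h n x = (\<Sum>i<m. a i * \<xi> * (I n (t i) x / t i - I n 1 x))" for n x
  have [measurable]: "h n \<in> borel_measurable borel" for n unfolding h_def by measurable
  define C where "C = (\<Sum>i<m. \<bar>a i * \<xi>\<bar> * (1 / t i + 1))"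
  have bd: "\<bar>h n x\<bar> \<le> C" for n x
  proof -
    have "\<bar>h n x\<bar> \<le> (\<Sum>i<m. \<bar>a i * \<xi> * (I n (t i) x / t i - I n 1 x)\<bar>)" unfolding h_def
      by (rule sum_abs)
    also have "\<dots> \<le> C" unfolding C_def abs_mult
    proof (intro sum_mono mult_left_mono)
      fix i assume "i \<in> {..<m}"
      then have "0 < t i" using t by auto
      moreover have "0 \<le> I n y x" "I n y x \<le> 1" for y by (auto simp: I_def indicator_def)
      ultimately have "0 \<le> I n (t i) x / t i" "I n (t i) x / t i \<le> 1 / t i" "0 \<le> I n 1 x"
          "I n 1 x \<le> 1"
        by (auto intro: divide_right_mono)
      then show "\<bar>I n (t i) x / t i - I n 1 x\<bar> \<le> 1 / t i + 1" by linarith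
    qed auto
    finally show ?thesis .
  qed
  have Eh: "(\<integral>x. h n x \<partial>D) = (\<Sum>i<m. a i * \<xi> * (p n (t i) / t i - p n 1))" for n
    unfolding h_def using intI EI by (simp add: Bochner_Integration.integral_sum)
  define c where "c i = a i * \<xi>" for i
  have Eh2: "(\<integral>x. h n x ^ 2 \<partial>D) =
      (\<Sum>i<m. \<Sum>j<m. c i * c j * (p n (min (t i) (t j)) / (t i * t j) - p n (t i) / t i - p n (t j)
          / t j + p n 1))"
    if b: "b n > 0" for n
  proof -
    \<comment> \<open>Exceedance sets are nested, so the product of two indicators is the one with
      the smaller argument. This is the source of \<open>min\<close> in the covariance.\<close>
    have II: "I n y x * I n z x = I n (min y z) x" if "0 < y" "0 < z" for x y z
      using threshold_antimono[OF b, of y z] threshold_antimono[OF b, of z y] that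
      by (auto simp: I_def indicator_def min_def)
    have "h n x ^ 2 = (\<Sum>i<m. \<Sum>j<m. c i * c j * (I n (min (t i) (t j)) x / (t i * t j) - I n (t i)
        x / t i - I n (t j) x / t j + I n 1 x))" for x
      unfolding h_def power2_eq_square sum_product
    proof (intro sum.cong refl)
      fix i j assume "i \<in> {..<m}" "j \<in> {..<m}"
      then have ij: "0 < t i" "t i \<le> 1" "0 < t j" "t j \<le> 1" using t by auto
      have "a i * \<xi> * (I n (t i) x / t i - I n 1 x) * (a j * \<xi> * (I n (t j) x / t j - I n 1 x)) =
        c i * c j * ((I n (t i) x * I n (t j) x) / (t i * t j) - (I n (t i) x * I n 1 x) / t i
            - (I n (t j) x * I n 1 x) / t j + I n 1 x * I n 1 x)"
        by (simp add: c_def algebra_simps)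
      also have "\<dots> = c i * c j * (I n (min (t i) (t j)) x / (t i * t j) - I n (t i) x / t i
          - I n (t j) x / t j + I n 1 x)"
        using II[of "t i" "t j" x] II[of "t i" 1 x] II[of "t j" 1 x] II[of 1 1 x]
        by (simp only: ij min_absorb1 zero_less_one order_refl simp_thms)
      finally show "a i * \<xi> * (I n (t i) x / t i - I n 1 x)
          * (a j * \<xi> * (I n (t j) x / t j - I n 1 x)) =
        c i * c j * (I n (min (t i) (t j)) x / (t i * t j) - I n (t i) x / t i - I n (t j) x / t j
            + I n 1 x)" .
    qed
    then show ?thesis using intI EI by (simp add: Bochner_Integration.integral_sum)
  qed
  have m1: "(\<lambda>n. real n / real (k n) * (\<integral>x. h n x \<partial>D)) \<longlonglongrightarrow> (\<Sum>i<m. a i * \<xi> * (t i / t i - 1))"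
  proof -
    have "(\<lambda>n. \<Sum>i<m. a i * \<xi> * (real n / real (k n) * p n (t i) / t i - real n / real (k n) * p n
        1)) \<longlonglongrightarrow> (\<Sum>i<m. a i * \<xi> * (t i / t i - 1))"
      using t by (intro tendsto_sum tendsto_mult tendsto_const tendsto_diff tendsto_divide
          tail_tendsto) force+
    moreover have "(\<Sum>i<m. a i * \<xi> * (real n / real (k n) * p n (t i) / t i - real n / real (k n)
        * p n 1)) =
        real n / real (k n) * (\<integral>x. h n x \<partial>D)" for n
      unfolding Eh sum_distrib_left by (intro sum.cong refl) (simp add: algebra_simps)
    ultimately show ?thesis by simp
  qed
  \<comment> \<open>The last three summands add up to \<open>- 1\<close>, which turns the Brownian
    covariance over \<open>t i * t j\<close> into that of the bridge.\<close>
  define v where "v = (\<Sum>i<m. \<Sum>j<m. c i * c j * (min (t i) (t j) / (t i * t j) - t i / t i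
      - t j / t j + 1))"
  have m2: "(\<lambda>n. real n / real (k n) * (\<integral>x. h n x ^ 2 \<partial>D)) \<longlonglongrightarrow> v"
  proof -
    let ?s = "\<lambda>n. \<Sum>i<m. \<Sum>j<m. c i * c j * (real n / real (k n) * p n (min (t i) (t j)) / (t i * t j)
        - real n / real (k n) * p n (t i) / t i - real n / real (k n) * p n (t j) / t j + real n
            / real (k n) * p n 1)"
    have "?s \<longlonglongrightarrow> v"
      unfolding v_def
      using t by (intro tendsto_sum tendsto_mult tendsto_const tendsto_diff tendsto_add
          tendsto_divide tail_tendsto) force+
    moreover have "eventually (\<lambda>n. ?s n = real n / real (k n) * (\<integral>x. h n x ^ 2 \<partial>D)) sequentially"
      using eventually_b_pos
    proof eventually_elim
      case (elim n)
      show ?case unfolding Eh2[OF elim] sum_distrib_left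
        by (intro sum.cong refl) (simp add: algebra_simps)
    qed
    ultimately show ?thesis by (rule Lim_transform_eventually)
  qed
  have v: "v = (\<Sum>i<m. \<Sum>j<m. (a i * \<xi> / t i) * (a j * \<xi> / t j) * (min (t i) (t j) - t i * t j))"
    unfolding v_def
  proof (intro sum.cong refl)
    fix i j assume "i \<in> {..<m}" "j \<in> {..<m}"
    then have "t i > 0" "t j > 0" using t by auto
    then show "c i * c j * (min (t i) (t j) / (t i * t j) - t i / t i - t j / t j + 1) =
      (a i * \<xi> / t i) * (a j * \<xi> / t j) * (min (t i) (t j) - t i * t j)"
      by (simp add: c_def field_simps)
  qed
  define e where "e n y = sqrt (real (k n)) * (real n / real (k n) * p n y - y)" for n y
  \<comment> \<open>The difference between centring at \<open>y\<close> and at the exact mean; it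
    vanishes even after multiplication by \<open>sqrt (k n)\<close>, which is the content of
    \<open>tail\<close>.\<close>
  define d where "d n = (\<Sum>i<m. a i * \<xi> * (e n (t i) / t i - e n 1))" for n
  have d: "d \<longlonglongrightarrow> 0"
  proof -
    have "(\<lambda>n. \<Sum>i<m. a i * \<xi> * (e n (t i) / t i - e n 1)) \<longlonglongrightarrow> (\<Sum>i<m. a i * \<xi> * (0 / t i - 0))"
      unfolding e_def
      using t by (intro tendsto_sum tendsto_mult[OF tendsto_const] tendsto_diff tendsto_divide
          tendsto_const tail_error_tendsto) force+
    then show ?thesis by (simp add: d_def[abs_def])
  qed
  define T where "T n \<omega> = (\<Sum>i\<in>{1..n}. h n (X i \<omega>) - (\<integral>x. h n x \<partial>D)) / sqrt (real (k n))" for n \<omega>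
  have dec: "(\<Sum>i<m. a i * G n (t i) \<omega>) = T n \<omega> + d n" if "k n \<ge> 1" for n \<omega>
  proof -
    have c: "cnt n y \<omega> = (\<Sum>l\<in>{1..n}. I n y (X l \<omega>))" for y by (simp add: cnt_def I_def)
    have "T n \<omega> = (\<Sum>i<m. a i * \<xi> * (\<beta> n (t i) \<omega> / t i - \<beta> n 1 \<omega>))"
    proof -
      have "(\<Sum>l\<in>{1..n}. h n (X l \<omega>)) = (\<Sum>i<m. a i * \<xi> * (cnt n (t i) \<omega> / t i - cnt n 1 \<omega>))"
        unfolding h_def c
        by (subst sum.swap) (simp add: sum_subtractf flip: sum_distrib_left sum_divide_distrib)
      then have "T n \<omega> = ((\<Sum>i<m. a i * \<xi> * (cnt n (t i) \<omega> / t i - cnt n 1 \<omega>))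
          - real n * (\<Sum>i<m. a i * \<xi> * (p n (t i) / t i - p n 1))) / sqrt (real (k n))"
        unfolding T_def Eh by (simp add: sum_subtractf)
      also have "\<dots> = (\<Sum>i<m. a i * \<xi> * (\<beta> n (t i) \<omega> / t i - \<beta> n 1 \<omega>))"
        unfolding sum_distrib_left sum_subtractf[symmetric] sum_divide_distrib
        by (intro sum.cong refl) (simp add: \<beta>_def diff_divide_distrib right_diff_distrib ac_simps)
      finally show ?thesis .
    qed
    moreover have ae: "\<alpha> n y \<omega> = \<beta> n y \<omega> + e n y" for y
      using \<alpha>_\<beta>[OF that] by (simp add: e_def)
    moreover have "(\<Sum>i<m. a i * G n (t i) \<omega>) =
        (\<Sum>i<m. a i * \<xi> * (\<beta> n (t i) \<omega> / t i - \<beta> n 1 \<omega>) + a i * \<xi> * (e n (t i) / t i - e n 1))"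
      by (intro sum.cong refl)
        (simp add: G_def ae add_divide_distrib algebra_simps)
    ultimately show ?thesis by (simp add: d_def sum.distrib)
  qed
  have "(\<lambda>n. iexp (d n)) \<longlonglongrightarrow> iexp 0" using d by (intro tendsto_intros)
  moreover have "(\<lambda>n. expectation (\<lambda>\<omega>. iexp (T n \<omega>))) \<longlonglongrightarrow> complex_of_real (exp (- v / 2))"
    unfolding T_def by (rule triangular_clt_iexp[OF indep distr_X _ bd k_inf k_small m1 m2]) auto
  ultimately have "(\<lambda>n. expectation (\<lambda>\<omega>. iexp (T n \<omega>)) * iexp (d n))
      \<longlonglongrightarrow> complex_of_real (exp (- v / 2)) * iexp 0"
    by (intro tendsto_mult)
  moreover have "eventually (\<lambda>n. expectation (\<lambda>\<omega>. iexp (T n \<omega>)) * iexp (d n) =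
      expectation (\<lambda>\<omega>. iexp (\<Sum>i<m. a i * G n (t i) \<omega>))) sequentially"
    using eventually_k_pos
  proof eventually_elim
    case (elim n)
    show ?case unfolding dec[OF elim] by (simp add: distrib_left exp_add)
  qed
  ultimately show ?thesis unfolding v[symmetric] by (simp add: Lim_transform_eventually)
qed

end

section \<open>Random sets and their skeletons\<close>

text \<open>An order statistic with index beyond the sample size is a junk value, but a constant one.\<close>

lemma nth_beyond_length: "length xs \<le> i \<Longrightarrow> xs ! i = [] ! (i - length xs)"
proof (induction xs arbitrary: i)
  case (Cons x xs)
  then show ?case by (cases i) auto
qed simp

lemma desc_order_stat_measurable:
  assumes X: "\<And>i. i \<ge> 1 \<Longrightarrow> X i \<in> borel_measurable M" and "1 \<le> j"
  shows "desc_order_stat X n j \<in> borel_measurable M"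
proof (cases "j \<le> n")
  case True
  show ?thesis
  proof (rule borel_measurable_iff_greater[THEN iffD2], rule allI)
    fix x
    have m: "(\<lambda>\<omega>. \<Sum>i\<in>{1..n}. indicator {x<..} (X i \<omega>) :: real) \<in> borel_measurable M"
      by (intro borel_measurable_sum measurable_compose[OF X] borel_measurable_indicator) auto
    have "(\<Sum>i\<in>{1..n}. indicator {x<..} (X i \<omega>)) = real (card {i\<in>{1..n}. X i \<omega> > x})" for \<omega>
    proof -
      have "(\<Sum>i\<in>{1..n}. indicator {x<..} (X i \<omega>)) = (\<Sum>i\<in>{1..n}. if X i \<omega> > x then 1 else 0 :: real)"
        by (intro sum.cong) (auto simp: indicator_def)
      then show ?thesis by (simp add: sum.If_cases Int_def)
    qed
    then have "{\<omega> \<in> space M. x < desc_order_stat X n j \<omega>} =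
        {\<omega> \<in> space M. real j \<le> (\<Sum>i\<in>{1..n}. indicator {x<..} (X i \<omega>))}"
      using desc_order_stat_gt_iff[OF \<open>1 \<le> j\<close> True, of x X] by simp
    then show "{\<omega> \<in> space M. x < desc_order_stat X n j \<omega>} \<in> sets M" using m by simp
  qed
next
  case False
  have "desc_order_stat X n j = (\<lambda>\<omega>. [] ! (j - 1 - n))"
  proof
    fix \<omega>
    define xs where "xs = rev (sort (map (\<lambda>i. X i \<omega>) [1..<Suc n]))"
    have "length xs = n" by (simp add: xs_def)
    then show "desc_order_stat X n j \<omega> = [] ! (j - 1 - n)"
      unfolding desc_order_stat_def xs_def[symmetric] using False nth_beyond_length[of xs "j - 1"]
        by simp
  qed
  then show ?thesis by simp
qed

lemma closed_QN_seq: "closed (QN_seq \<xi> k X n \<omega>)"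
proof -
  have "{1..k n} = {j. 1 \<le> j \<and> j \<le> k n}" by auto
  then have "finite {j. 1 \<le> j \<and> j \<le> k n}" by (metis finite_atLeastAtMost)
  then show ?thesis unfolding QN_seq_def by (intro finite_imp_closed finite_image_set)
qed

lemma QN_seq_random_closed_set:
  assumes X: "\<And>i. i \<ge> 1 \<Longrightarrow> X i \<in> borel_measurable M"
  shows "random_closed_set M (QN_seq \<xi> k X n)"
proof -
  define pt where "pt j \<omega> = (- ln (real j / real (k n)),
       - \<xi> * ln (real j / real (k n)) +
         sqrt (real (k n)) *
           (ln (desc_order_stat X n j \<omega> / desc_order_stat X n (k n) \<omega>) +
            \<xi> * ln (real j / real (k n))))" for j \<omega>
  have eq: "QN_seq \<xi> k X n \<omega> = (\<lambda>j. pt j \<omega>) ` {1..k n}" for \<omega>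
    by (auto simp: QN_seq_def pt_def)
  have pt: "pt j \<in> borel_measurable M" if "j \<in> {1..k n}" for j
  proof -
    have [measurable]: "desc_order_stat X n j \<in> borel_measurable M"
        "desc_order_stat X n (k n) \<in> borel_measurable M"
      using that by (auto intro!: desc_order_stat_measurable X)
    show ?thesis unfolding pt_def by measurable
  qed
  show ?thesis
  proof (rule random_closed_setI)
    show "closed (QN_seq \<xi> k X n \<omega>)" for \<omega> by (rule closed_QN_seq)
    fix G :: "(real \<times> real) set" assume "open G"
    then have "pt j -` G \<inter> space M \<in> sets M" if "j \<in> {1..k n}" for j
      using measurable_sets[OF pt[OF that], of G] by simp
    then have "(\<Union>j\<in>{1..k n}. pt j -` G \<inter> space M) \<in> sets M" by (intro sets.finite_UN) auto
    also have "(\<Union>j\<in>{1..k n}. pt j -` G \<inter> space M) = {\<omega> \<in> space M. QN_seq \<xi> k X n \<omega> \<inter> G \<noteq> {}}"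
      unfolding eq by auto
    finally show "{\<omega> \<in> space M. QN_seq \<xi> k X n \<omega> \<inter> G \<noteq> {}} \<in> sets M" .
  qed
qed

text \<open>The parameter \<open>u = - ln t\<close> is the first coordinate itself, so the limit set
  is a graph over \<open>{0..}\<close>: it is closed for continuous paths, and a window of radius
  \<open>R\<close> restricts it to \<open>u \<le> R\<close>.\<close>

definition curve :: "real \<Rightarrow> (real \<Rightarrow> real) \<Rightarrow> real \<Rightarrow> real \<times> real" where
  "curve \<xi> g u = (u, \<xi> * u + g (exp (- u)))"

lemma QN_limit_eq: "QN_limit \<xi> B \<omega> = curve \<xi> (\<lambda>t. \<xi> * inverse t * B t \<omega>) ` {0..}"
proof
  show "QN_limit \<xi> B \<omega> \<subseteq> curve \<xi> (\<lambda>t. \<xi> * inverse t * B t \<omega>) ` {0..}"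
    unfolding QN_limit_def curve_def
  proof clarify
    fix t :: real assume "0 < t" "t \<le> 1"
    then show "(- ln t, - \<xi> * ln t + \<xi> * inverse t * B t \<omega>)
      \<in> (\<lambda>u. (u, \<xi> * u + \<xi> * inverse (exp (- u)) * B (exp (- u)) \<omega>)) ` {0..}"
      by (intro image_eqI[of _ _ "- ln t"]) auto
  qed
  show "curve \<xi> (\<lambda>t. \<xi> * inverse t * B t \<omega>) ` {0..} \<subseteq> QN_limit \<xi> B \<omega>"
  proof
    fix x assume "x \<in> curve \<xi> (\<lambda>t. \<xi> * inverse t * B t \<omega>) ` {0..}"
    then obtain u where "u \<ge> 0" "x = (u, \<xi> * u + \<xi> * inverse (exp (- u)) * B (exp (- u)) \<omega>)"
      by (auto simp: curve_def)
    then show "x \<in> QN_limit \<xi> B \<omega>"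
      unfolding QN_limit_def by (auto intro!: exI[of _ "exp (- u)"])
  qed
qed

lemma curve_continuous:
  fixes g :: "real \<Rightarrow> real"
  assumes "continuous_on {0<..1} g"
  shows "continuous_on {0..} (\<lambda>u. \<xi> * u + g (exp (- u)))"
proof -
  have "continuous_on {0..} (\<lambda>u :: real. exp (- u))" by (intro continuous_intros)
  then have "continuous_on {0..} (\<lambda>u. g (exp (- u)))"
    by (rule continuous_on_compose2[OF assms]) auto
  then show ?thesis by (intro continuous_intros)
qed

lemma bridge_path_continuous:
  assumes "brownian_bridge N B" "\<omega> \<in> space N"
  shows "continuous_on {0<..1} (\<lambda>t. \<xi> * inverse t * B t \<omega>)"
proof -
  have "continuous_on {0..1} (\<lambda>t. B t \<omega>)" using assms by (auto simp: brownian_bridge_def)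
  then have "continuous_on {0<..1} (\<lambda>t. B t \<omega>)" by (rule continuous_on_subset) auto
  then show ?thesis by (intro continuous_intros) auto
qed

lemma QN_limit_closed:
  assumes "brownian_bridge N B" "\<omega> \<in> space N"
  shows "closed (QN_limit \<xi> B \<omega>)"
  unfolding QN_limit_eq curve_def
  by (rule continuous_closed_graph[OF closed_atLeast
      curve_continuous[OF bridge_path_continuous[OF assms]]])

text \<open>By path continuity the curve meets an open set iff it does so at a rational parameter,
  which makes the hitting event a countable union. The rational is taken to the right of
  \<open>u\<close>, so it stays in \<open>{0..}\<close>.\<close>

lemma QN_limit_random_closed_set:
  assumes B: "brownian_bridge N B"
  shows "random_closed_set N (QN_limit \<xi> B)"
proof (rule random_closed_setI)
  show "closed (QN_limit \<xi> B \<omega>)" if "\<omega> \<in> space N" for \<omega> by (rule QN_limit_closed[OF B that])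
  fix G :: "(real \<times> real) set" assume G: "open G"
  define c where "c \<omega> = curve \<xi> (\<lambda>t. \<xi> * inverse t * B t \<omega>)" for \<omega>
  have "QN_limit \<xi> B \<omega> \<inter> G \<noteq> {} \<longleftrightarrow> (\<exists>q\<in>\<rat> \<inter> {0..}. c \<omega> q \<in> G)" if w: "\<omega> \<in> space N" for \<omega>
  proof
    assume "QN_limit \<xi> B \<omega> \<inter> G \<noteq> {}"
    then obtain u where u: "u \<ge> 0" "c \<omega> u \<in> G" unfolding QN_limit_eq c_def by auto
    have "continuous_on {0..} (c \<omega>)"
      unfolding c_def curve_def
      by (intro continuous_on_Pair continuous_on_id
          curve_continuous[OF bridge_path_continuous[OF B w]])
    then have "openin (top_of_set {0..}) ({0..} \<inter> c \<omega> -` G)"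
      using G by (rule continuous_openin_preimage_gen)
    then have "\<exists>e>0. \<forall>y\<in>{0..}. dist y u < e \<longrightarrow> y \<in> {0..} \<inter> c \<omega> -` G"
      using u unfolding openin_euclidean_subtopology_iff by auto
    then obtain e where e: "e > 0" "\<And>y. y \<in> {0..} \<Longrightarrow> dist y u < e \<Longrightarrow> c \<omega> y \<in> G" by blast
    obtain q where "q \<in> \<rat>" "u < q" "q < u + e" using Rats_dense_in_real[of u "u + e"] e by auto
    then show "\<exists>q\<in>\<rat> \<inter> {0..}. c \<omega> q \<in> G" using e(2)[of q] u by (auto simp: dist_real_def)
  qed (auto simp: QN_limit_eq c_def)
  then have "{\<omega> \<in> space N. QN_limit \<xi> B \<omega> \<inter> G \<noteq> {}} = {\<omega> \<in> space N. \<exists>q\<in>\<rat> \<inter> {0..}. c \<omega> q \<in> G}"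
    by (simp cong: conj_cong)
  also have "\<dots> = (\<Union>q\<in>\<rat> \<inter> {0..}. (\<lambda>\<omega>. c \<omega> q) -` G \<inter> space N)" by blast
  also have "\<dots> \<in> sets N"
  proof (rule sets.countable_UN'')
    show "countable (\<rat> \<inter> {0..} :: real set)" using countable_rat by auto
    fix q :: real assume "q \<in> \<rat> \<inter> {0..}"
    then have [measurable]: "B (exp (- q)) \<in> borel_measurable N"
      using B by (auto simp: brownian_bridge_def gaussian_process_def)
    have "(\<lambda>\<omega>. c \<omega> q) \<in> borel_measurable N" unfolding c_def curve_def by measurable
    then show "(\<lambda>\<omega>. c \<omega> q) -` G \<inter> space N \<in> sets N" using G by (simp add: measurable_sets)
  qed
  finally show "{\<omega> \<in> space N. QN_limit \<xi> B \<omega> \<inter> G \<noteq> {}} \<in> sets N" .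
qed

text \<open>Mesh \<open>1 / m\<close> on \<open>[0, m]\<close>, hence \<open>m * m + 1\<close>
  points: the single parameter \<open>m\<close> both refines the grid and lengthens its range. The
  deviations from the line of slope \<open>\<xi>\<close> are free coordinates, which makes the set a
  continuous function of a finite vector.\<close>

definition skeleton :: "real \<Rightarrow> nat \<Rightarrow> (nat \<Rightarrow> real) \<Rightarrow> (real \<times> real) set" where
  "skeleton \<xi> m v = (\<lambda>i. (real i / real m, \<xi> * (real i / real m) + v i)) ` {..<m * m + 1}"

lemma closed_skeleton: "closed (skeleton \<xi> m v)"
  unfolding skeleton_def by (intro finite_imp_closed) simp

lemma skeleton_continuous:
  assumes f: "continuous_map fell_topology euclideanreal f"
  shows "continuous_on UNIV (\<lambda>v. f (skeleton \<xi> m v))"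
proof -
  have "continuous_map euclidean fell_topology (skeleton \<xi> m)"
    unfolding skeleton_def[abs_def]
  proof (rule continuous_map_finite_set_fell)
    fix i
    have "continuous_on UNIV (\<lambda>v :: nat \<Rightarrow> real. v i)" by (rule continuous_on_product_coordinates)
    then show "continuous_on UNIV (\<lambda>v. (real i / real m, \<xi> * (real i / real m) + v i))"
      by (intro continuous_intros)
  qed simp
  from continuous_map_compose[OF this f] show ?thesis
    by (simp add: comp_def continuous_map_iff_continuous2)
qed

lemma exp_minus_lipschitz:
  fixes u v :: real
  assumes "0 \<le> u" "0 \<le> v"
  shows "\<bar>exp (- u) - exp (- v)\<bar> \<le> \<bar>u - v\<bar>"
proof -
  have *: "exp (- u) - exp (- v) \<le> v - u" if "0 \<le> u" "u \<le> v" for u v :: real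
  proof -
    have "exp (- u) - exp (- v) = exp (- u) * (1 - exp (- (v - u)))"
      by (simp add: right_diff_distrib flip: exp_add)
    also have "\<dots> \<le> 1 * (v - u)"
    proof (rule mult_mono)
      show "1 - exp (- (v - u)) \<le> v - u" using exp_ge_add_one_self[of "- (v - u)"] by linarith
    qed (use that in auto)
    finally show ?thesis by simp
  qed
  show ?thesis using *[of u v] *[of v u] assms by (cases "u \<le> v") auto
qed

lemma dist_Pair_le: "dist (a, b) (c, d) \<le> \<bar>a - c\<bar> + \<bar>b - d\<bar>" for a b c d :: real
  unfolding dist_Pair_Pair dist_real_def by (rule order_trans[OF sqrt_sum_squares_le_sum_abs]) simp

lemma curve_point_dist:
  assumes "\<bar>u - w\<bar> \<le> s" "\<bar>x - y\<bar> \<le> \<kappa>" "\<xi> > 0" "(1 + \<xi>) * s + \<kappa> < r"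
  shows "dist (u, \<xi> * u + x) (w, \<xi> * w + y) < r"
proof -
  have "dist (u, \<xi> * u + x) (w, \<xi> * w + y) \<le> \<bar>u - w\<bar> + \<bar>\<xi> * (u - w) + (x - y)\<bar>"
    using dist_Pair_le[of u "\<xi> * u + x" w "\<xi> * w + y"] by (simp add: algebra_simps)
  also have "\<bar>\<xi> * (u - w) + (x - y)\<bar> \<le> \<xi> * \<bar>u - w\<bar> + \<bar>x - y\<bar>"
    using abs_triangle_ineq[of "\<xi> * (u - w)" "x - y"] assms(3) by (simp add: abs_mult)
  also have "\<xi> * \<bar>u - w\<bar> \<le> \<xi> * s" using assms by (intro mult_left_mono) auto
  finally show ?thesis using assms by (simp add: algebra_simps)
qed

text \<open>Rounding down keeps the grid point at most \<open>u\<close>, so \<open>exp\<close> of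
  its negative stays in the range where a modulus of \<open>g\<close> is available.\<close>

lemma grid_point:
  fixes u R :: real
  assumes "0 \<le> u" "u \<le> R" "R \<le> real m" "m \<ge> 1"
  obtains i where "i < m * m + 1" "\<bar>u - real i / real m\<bar> \<le> 1 / real m" "real i / real m \<le> u"
proof -
  define i where "i = nat \<lfloor>u * real m\<rfloor>"
  have i: "real i \<le> u * real m" "u * real m < real i + 1"
    using assms by (auto simp: i_def)
  have "u * real m \<le> real m * real m" using assms by (intro mult_right_mono) auto
  then have "real i \<le> real (m * m)" using i by simp
  then have "i < m * m + 1" by (simp only: of_nat_le_iff less_Suc_eq_le flip: Suc_eq_plus1)
  moreover have "real i / real m \<le> u" "u \<le> (real i + 1) / real m"
    using i assms by (simp_all add: pos_divide_le_eq pos_le_divide_eq)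
  moreover from this have "u - real i / real m \<le> 1 / real m" by (simp add: add_divide_distrib)
  ultimately show thesis using that[of i] by auto
qed

text \<open>Skeleton points lie on the curve, so one direction is immediate. In the other, a curve
  point in the window has \<open>u \<le> R\<close>, and its grid neighbour is close in both
  coordinates by the modulus of \<open>g\<close>.\<close>

lemma curve_fell_close_skeleton:
  assumes xi: "\<xi> > 0" and R: "0 \<le> R" "R \<le> real m" "m \<ge> 1"
    and mod: "\<And>s t. s \<in> {exp (- (R + 1))..1} \<Longrightarrow> t \<in> {exp (- (R + 1))..1} \<Longrightarrow> \<bar>s - t\<bar> \<le> 1 / real m \<Longrightarrow>
        \<bar>g s - g t\<bar> \<le> \<kappa>"
    and r: "(1 + \<xi>) * (1 / real m) + \<kappa> < r" "r > 0"
  shows "fell_close R r (curve \<xi> g ` {0..}) (skeleton \<xi> m (\<lambda>i. g (exp (- (real i / real m)))))"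
  unfolding fell_close_def
proof (intro conjI ballI impI)
  fix x assume x: "x \<in> curve \<xi> g ` {0..}" "norm x \<le> R"
  then obtain u where u: "u \<ge> 0" "x = (u, \<xi> * u + g (exp (- u)))" by (auto simp: curve_def)
  then have uR: "u \<le> R" using x(2) norm_fst_le[of u "\<xi> * u + g (exp (- u))"] by simp
  obtain i where i: "i < m * m + 1" "\<bar>u - real i / real m\<bar> \<le> 1 / real m" "real i / real m \<le> u"
    using grid_point[OF u(1) uR R(2,3)] by blast
  let ?w = "real i / real m"
  have "\<bar>exp (- u) - exp (- ?w)\<bar> \<le> 1 / real m"
    using exp_minus_lipschitz[of u ?w] u i by auto
  then have "\<bar>g (exp (- u)) - g (exp (- ?w))\<bar> \<le> \<kappa>" using u uR i by (intro mod) auto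
  from curve_point_dist[OF i(2) this xi r(1)]
  show "\<exists>y\<in>skeleton \<xi> m (\<lambda>i. g (exp (- (real i / real m)))). dist x y < r"
    unfolding skeleton_def u(2) using i(1) by blast
next
  fix y assume "y \<in> skeleton \<xi> m (\<lambda>i. g (exp (- (real i / real m))))"
  then have "y \<in> curve \<xi> g ` {0..}" by (auto simp: skeleton_def curve_def)
  then show "\<exists>x\<in>curve \<xi> g ` {0..}. dist x y < r" using r(2) by (intro bexI[of _ y]) auto
qed

text \<open>Here both directions need an argument: a plot point goes to the grid point below its
  parameter, a skeleton point at \<open>w\<close> to the index obtained by rounding up
  \<open>k * exp (- w)\<close>. One \<open>\<kappa>\<close> pays for \<open>L\<close> against
  \<open>g\<close>, the other for the oscillation of \<open>g\<close>.\<close>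

lemma discrete_fell_close_skeleton:
  fixes L :: "nat \<Rightarrow> real"
  assumes xi: "\<xi> > 0" and R: "0 \<le> R" "R \<le> real m" "m \<ge> 1"
    and mod: "\<And>s t. s \<in> {exp (- (R + 1))..1} \<Longrightarrow> t \<in> {exp (- (R + 1))..1} \<Longrightarrow> \<bar>s - t\<bar> \<le> 1 / real m \<Longrightarrow>
        \<bar>g s - g t\<bar> \<le> \<kappa>"
    and L: "\<And>j. 1 \<le> j \<Longrightarrow> j \<le> k \<Longrightarrow> exp (- (R + 1)) \<le> real j / real k \<Longrightarrow> \<bar>L j - g (real j / real k)\<bar> \<le> \<kappa>"
    and k: "k \<ge> 1" "1 / (real k * exp (- (R + 1))) \<le> 1 / real m"
    and r: "(1 + \<xi>) * (1 / real m) + 2 * \<kappa> < r"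
  shows "fell_close R r {(- ln (real j / real k), - \<xi> * ln (real j / real k) + L j) |j. 1 \<le> j \<and>
      j \<le> k}
    (skeleton \<xi> m (\<lambda>i. g (exp (- (real i / real m)))))"
  unfolding fell_close_def
proof (intro conjI ballI impI)
  fix x assume x: "x \<in> {(- ln (real j / real k), - \<xi> * ln (real j / real k) + L j) |j. 1 \<le> j \<and>
      j \<le> k}" "norm x \<le> R"
  then obtain j where j: "1 \<le> j" "j \<le> k" "x = (- ln (real j / real k), - \<xi> * ln (real j / real k)
      + L j)" by auto
  define t where "t = real j / real k"
  define u where "u = - ln t"
  have t: "0 < t" "t \<le> 1" using j k by (auto simp: t_def)
  have tu: "t = exp (- u)" "u \<ge> 0" using t by (auto simp: u_def)
  have xu: "x = (u, \<xi> * u + L j)" using j by (simp add: u_def t_def)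
  then have uR: "u \<le> R" using x(2) norm_fst_le[of u "\<xi> * u + L j"] by simp
  obtain i where i: "i < m * m + 1" "\<bar>u - real i / real m\<bar> \<le> 1 / real m" "real i / real m \<le> u"
    using grid_point[OF tu(2) uR R(2,3)] by blast
  let ?w = "real i / real m"
  have "\<bar>exp (- u) - exp (- ?w)\<bar> \<le> 1 / real m"
    using exp_minus_lipschitz[of u ?w] tu i by auto
  then have "\<bar>g (exp (- u)) - g (exp (- ?w))\<bar> \<le> \<kappa>" using tu uR i by (intro mod) auto
  moreover have "\<bar>L j - g t\<bar> \<le> \<kappa>" using L[OF j(1,2)] uR tu by (simp add: t_def[symmetric])
  ultimately have "\<bar>L j - g (exp (- ?w))\<bar> \<le> 2 * \<kappa>" unfolding tu(1) by linarith
  from curve_point_dist[OF i(2) this xi r]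
  show "\<exists>y\<in>skeleton \<xi> m (\<lambda>i. g (exp (- (real i / real m)))). dist x y < r"
    unfolding skeleton_def xu using i(1) by blast
next
  fix y assume y: "y \<in> skeleton \<xi> m (\<lambda>i. g (exp (- (real i / real m))))" "norm y \<le> R"
  then obtain i where i: "y = (real i / real m, \<xi> * (real i / real m)
      + g (exp (- (real i / real m))))"
    by (auto simp: skeleton_def)
  define w where "w = real i / real m"
  define v where "v = exp (- w)"
  have w: "0 \<le> w" "w \<le> R"
    using y(2) norm_fst_le[of w "\<xi> * w + g (exp (- w))"] unfolding i by (simp_all add: w_def)
  have v: "0 < v" "v \<le> 1" using w by (auto simp: v_def)
  have vR: "exp (- (R + 1)) \<le> v" using w by (simp add: v_def)
  \<comment> \<open>Rounding up gives \<open>v \<le> t\<close>, so \<open>t\<close> stays in the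
    range where \<open>mod\<close> and \<open>L\<close> apply. The shift of at most
    \<open>1 / k\<close> costs at most \<open>1 / (k * v)\<close> on the logarithmic scale.\<close>
  define j where "j = nat \<lceil>real k * v\<rceil>"
  have kv: "0 < real k * v" "real k * v \<le> real k" using k v by (auto simp: mult_le_cancel_left1)
  have j: "real k * v \<le> real j" "real j < real k * v + 1" using kv by (auto simp: j_def) linarith+
  have "0 < real j" using kv(1) j(1) by linarith
  then have j1: "1 \<le> j" by simp
  have jk: "j \<le> k" using kv by (simp add: j_def nat_le_iff ceiling_le_iff)
  define t where "t = real j / real k"
  have t: "v \<le> t" "t \<le> v + 1 / real k" "t \<le> 1" using j jk k by (auto simp: t_def field_simps)
  define u where "u = - ln t"
  have t0: "0 < t" using t v by linarith
  have uw: "u \<le> w" using t(1) ln_ge_iff[OF t0, of "- w"] by (simp add: u_def v_def)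
  have u0: "0 \<le> u" using t t0 by (simp add: u_def)
  have "w - u = ln (t / v)" using t0 v by (simp add: u_def v_def ln_div)
  also have "\<dots> \<le> t / v - 1" using t0 v by (intro ln_le_minus_one) simp
  also have "\<dots> \<le> 1 / real k / v" using t v by (simp add: field_simps)
  also have "\<dots> \<le> 1 / real k / exp (- (R + 1))" using vR v by (intro divide_left_mono) auto
  also have "\<dots> \<le> 1 / real m" using k by simp
  finally have d: "\<bar>u - w\<bar> \<le> 1 / real m" using uw by simp
  have tu: "t = exp (- u)" using t0 by (simp add: u_def)
  have "\<bar>t - v\<bar> \<le> 1 / real m" unfolding tu v_def using exp_minus_lipschitz[OF u0 w(1)] d by simp
  then have "\<bar>g t - g v\<bar> \<le> \<kappa>" using t v vR by (intro mod) auto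
  moreover have "\<bar>L j - g t\<bar> \<le> \<kappa>" using L[OF j1 jk] vR t by (simp add: t_def[symmetric])
  ultimately have "\<bar>L j - g v\<bar> \<le> 2 * \<kappa>" by linarith
  from curve_point_dist[OF d this xi r]
  have "dist (- ln t, - \<xi> * ln t + L j) y < r" by (simp add: i u_def w_def v_def)
  then show "\<exists>x\<in>{(- ln (real j / real k), - \<xi> * ln (real j / real k) + L j) |j. 1 \<le> j \<and>
      j \<le> k}. dist x y < r"
    using j1 jk unfolding t_def by blast
qed

section \<open>Weak convergence\<close>

lemma eventually_div_nat_less:
  fixes c e :: real
  shows "e > 0 \<Longrightarrow> eventually (\<lambda>m. c / real m < e) sequentially"
  using lim_const_over_n[of c] by (rule order_tendstoD)

context tail_sample
begin

text \<open>The difference of \<open>\<alpha> n s \<omega> / s\<close> and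
  \<open>\<alpha> n t \<omega> / t\<close> splits into an increment of \<open>\<alpha>\<close> and
  an increment of the weight; each is at most \<open>\<eta> / \<tau>\<close>. The second part is why
  boundedness of \<open>\<alpha>\<close> must accompany its equicontinuity.\<close>

lemma G_modulus:
  assumes \<tau>: "0 < \<tau>" "s \<in> {\<tau>..1}" "t \<in> {\<tau>..1}" and d: "\<bar>\<alpha> n s \<omega> - \<alpha> n t \<omega>\<bar> \<le> \<eta>"
    and A: "\<bar>\<alpha> n t \<omega>\<bar> \<le> A" and "\<bar>s - t\<bar> \<le> h" "A * h \<le> \<eta> * \<tau>"
  shows "\<bar>G n s \<omega> - G n t \<omega>\<bar> \<le> 2 * \<xi> * \<eta> / \<tau>"
proof -
  have st: "0 < s" "0 < t" using \<tau> by auto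
  have A0: "0 \<le> A" using A by linarith
  have "\<alpha> n s \<omega> / s - \<alpha> n t \<omega> / t = (\<alpha> n s \<omega> - \<alpha> n t \<omega>) / s + \<alpha> n t \<omega> * (t - s) / (s * t)"
    using st by (simp add: field_simps)
  also have "\<bar>\<dots>\<bar> \<le> \<bar>\<alpha> n s \<omega> - \<alpha> n t \<omega>\<bar> / s + \<bar>\<alpha> n t \<omega>\<bar> * \<bar>t - s\<bar> / (s * t)"
    using st abs_triangle_ineq[of "(\<alpha> n s \<omega> - \<alpha> n t \<omega>) / s" "\<alpha> n t \<omega> * (t - s) / (s * t)"]
    by (simp add: abs_mult)
  also have "\<dots> \<le> \<eta> / \<tau> + A * h / (\<tau> * \<tau>)"
  proof (rule add_mono; rule frac_le)
    have "0 \<le> \<eta>" using d by (rule order_trans[OF abs_ge_zero])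
    then show "0 \<le> \<eta>" .
    show "\<bar>\<alpha> n t \<omega>\<bar> * \<bar>t - s\<bar> \<le> A * h"
      using A A0 \<open>\<bar>s - t\<bar> \<le> h\<close> by (intro mult_mono) auto
    then show "0 \<le> A * h" by (rule order_trans[rotated]) simp
    show "\<tau> * \<tau> \<le> s * t" using \<tau> by (intro mult_mono) auto
  qed (use d \<tau> in auto)
  also have "A * h / (\<tau> * \<tau>) \<le> \<eta> * \<tau> / (\<tau> * \<tau>)" using assms by (intro divide_right_mono) auto
  also have "\<eta> * \<tau> / (\<tau> * \<tau>) = \<eta> / \<tau>" using \<tau> by simp
  finally have "\<bar>\<alpha> n s \<omega> / s - \<alpha> n t \<omega> / t\<bar> \<le> 2 * (\<eta> / \<tau>)" by simp
  then have "\<xi> * \<bar>\<alpha> n s \<omega> / s - \<alpha> n t \<omega> / t\<bar> \<le> \<xi> * (2 * (\<eta> / \<tau>))" using xi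
    by (intro mult_left_mono) auto
  moreover have "G n s \<omega> - G n t \<omega> = \<xi> * (\<alpha> n s \<omega> / s - \<alpha> n t \<omega> / t)"
    by (simp add: G_def algebra_simps)
  ultimately show ?thesis using xi by (simp add: abs_mult ac_simps)
qed

text \<open>\<open>m\<close> is chosen before \<open>n\<close>: the modulus and the bound from
  \<open>\<alpha>_bounded_equicontinuous\<close> hold for all large \<open>n\<close> and dictate how
  fine the skeleton must be. One exceptional event serves both the expansion of the order statistics
  and the modulus of \<open>G\<close>.\<close>

lemma QN_seq_approx:
  assumes "R \<ge> 0" "r > 0" "\<epsilon> > 0"
  shows "eventually (\<lambda>m. eventually (\<lambda>n. \<exists>E\<in>events. prob E \<le> \<epsilon> \<and> (\<forall>\<omega>\<in>space M - E.
    fell_close R r (QN_seq \<xi> k X n \<omega>) (skeleton \<xi> m (\<lambda>i. G n (exp (- (real i / real m))) \<omega>))))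
        sequentially) sequentially"
proof -
  define \<tau> where "\<tau> = exp (- (R + 1))"
  have \<tau>: "0 < \<tau>" "\<tau> < 1" using assms by (auto simp: \<tau>_def)
  \<comment> \<open>Makes \<open>\<xi> * \<eta> / \<tau>\<close> equal to \<open>r / 32\<close>. The
    expansions at \<open>j\<close> and at \<open>k n\<close> together cost 6 such units and the
    modulus of \<open>G\<close> costs 2, each within \<open>r / 4\<close>.\<close>
  define \<eta> where "\<eta> = \<tau> * r / (32 * \<xi>)"
  have \<eta>: "\<eta> > 0" using \<tau> xi assms by (simp add: \<eta>_def)
  have \<eta>r: "\<xi> * \<eta> / \<tau> = r / 32" using \<tau> xi by (simp add: \<eta>_def)
  have t2: "\<tau> / 2 > 0" using \<tau> by simp
  obtain \<delta> A0 where \<delta>: "\<delta> > 0" and good: "eventually (\<lambda>n. \<exists>E\<in>events. prob E \<le> \<epsilon> \<and>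
    (\<forall>\<omega>\<in>space M - E. (\<forall>x\<in>{\<tau>/2..2}. \<bar>\<alpha> n x \<omega>\<bar> \<le> A0) \<and>
      (\<forall>x\<in>{\<tau>/2..2}. \<forall>y\<in>{\<tau>/2..2}. \<bar>x - y\<bar> \<le> \<delta> \<longrightarrow> \<bar>\<alpha> n x \<omega> - \<alpha> n y \<omega>\<bar> \<le> \<eta>))) sequentially"
    using \<alpha>_bounded_equicontinuous[OF t2 \<eta> assms(3), of 2] by blast
  define A where "A = \<bar>A0\<bar>"
  show ?thesis
    using eventually_div_nat_less[OF \<delta>, of 1] eventually_div_nat_less[OF mult_pos_pos[OF \<eta> \<tau>(1)],
        of A] eventually_div_nat_less[OF half_gt_zero[OF assms(2)], of "1 + \<xi>"]
      eventually_ge_at_top[of "nat \<lceil>R\<rceil>"] eventually_ge_at_top[of 1]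
  proof eventually_elim
    case (elim m)
    have m: "1 / real m \<le> \<delta>" "A * (1 / real m) \<le> \<eta> * \<tau>" "(1 + \<xi>) * (1 / real m) < r / 2"
        "R \<le> real m" "m \<ge> 1"
      using elim \<eta> \<tau> assms(2) by (auto simp: nat_le_iff ceiling_le_iff)
    have k_large: "eventually (\<lambda>n. real m / \<tau> \<le> real (k n)) sequentially"
      using k_inf_real by (simp add: filterlim_at_top)
    show ?case
      using good eventually_b_pos eventually_k_pos eventually_k_le k_large
        eventually_sqrt_k[of "(A + 2 * \<eta>) / \<delta>"] eventually_sqrt_k[of "(A + 2 * \<eta>) / (\<tau> / 2)"]
        eventually_sqrt_k[of "2 * ((A + 2 * \<eta>) / \<tau>)\<^sup>2 / (\<eta> / \<tau>)"]
    proof eventually_elim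
      case (elim n)
      from elim(1) obtain E where E: "E \<in> events" "prob E \<le> \<epsilon>"
        and Ab: "\<And>\<omega> x. \<omega> \<in> space M - E \<Longrightarrow> x \<in> {\<tau>/2..2} \<Longrightarrow> \<bar>\<alpha> n x \<omega>\<bar> \<le> A0"
        and mod: "\<And>\<omega> x y. \<omega> \<in> space M - E \<Longrightarrow> x \<in> {\<tau>/2..2} \<Longrightarrow> y \<in> {\<tau>/2..2} \<Longrightarrow> \<bar>x - y\<bar> \<le> \<delta> \<Longrightarrow>
            \<bar>\<alpha> n x \<omega> - \<alpha> n y \<omega>\<bar> \<le> \<eta>"
        by blast
      have sk: "sqrt (real (k n)) > 0" using elim(3) by simp
      have big: "(A + 2 * \<eta>) / sqrt (real (k n)) \<le> \<delta>" "(A + 2 * \<eta>) / sqrt (real (k n)) \<le> \<tau> / 2"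
        "2 * ((A + 2 * \<eta>) / \<tau>)\<^sup>2 / sqrt (real (k n)) \<le> \<eta> / \<tau>"
        using elim(6,7,8) \<delta> t2 divide_pos_pos[OF \<eta> \<tau>(1)] sk
          by (simp_all only: pos_divide_le_eq mult.commute)
      have km: "1 / (real (k n) * exp (- (R + 1))) \<le> 1 / real m"
        using elim(3,5) m(5) \<tau>(1) unfolding \<tau>_def[symmetric] by (simp add: field_simps)
      have "fell_close R r (QN_seq \<xi> k X n \<omega>) (skeleton \<xi> m (\<lambda>i. G n (exp (- (real i / real m)))
          \<omega>))"
        if w: "\<omega> \<in> space M - E" for \<omega>
      proof -
        have Ab': "\<bar>\<alpha> n x \<omega>\<bar> \<le> A" if "x \<in> {\<tau>..1}" for x
          using Ab[OF w, of x] that \<tau> by (auto simp: A_def)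
        define L where "L j = sqrt (real (k n)) *
           (ln (desc_order_stat X n j \<omega> / desc_order_stat X n (k n) \<omega>) + \<xi> * ln
               (real j / real (k n)))" for j
        define l where "l j = sqrt (real (k n)) * (ln (desc_order_stat X n j \<omega> / b n) + \<xi> * ln
            (real j / real (k n)))" for j
        have exp_j: "desc_order_stat X n j \<omega> > 0"
          "\<bar>l j - \<xi> * (\<alpha> n (real j / real (k n)) \<omega> / (real j / real (k n)))\<bar> \<le> 3 * \<xi> * \<eta> / \<tau>"
          if j: "1 \<le> j" "j \<le> k n" "\<tau> \<le> real j / real (k n)" for j
        proof -
          have j1: "real j / real (k n) \<le> 1" using j by simp
          have md: "\<bar>\<alpha> n y \<omega> - \<alpha> n (real j / real (k n)) \<omega>\<bar> \<le> \<eta>"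
            if "y \<in> {\<tau>/2..2}" "\<bar>y - real j / real (k n)\<bar> \<le> \<delta>" for y
          proof (rule mod[OF w that(1) _ that(2)])
            show "real j / real (k n) \<in> {\<tau>/2..2}"
              unfolding atLeastAtMost_iff using j(3) j1 \<tau> by (intro conjI; linarith)
          qed
          have Aj: "\<bar>\<alpha> n (real j / real (k n)) \<omega>\<bar> \<le> A" using j(3) j1 by (intro Ab') auto
          note * = order_stat_expansion[OF elim(2,3,4) j(1,2) refl j(3) \<tau>(1) \<eta> md Aj big]
          show "desc_order_stat X n j \<omega> > 0" by (rule *(1))
          show "\<bar>l j - \<xi> * (\<alpha> n (real j / real (k n)) \<omega> / (real j / real (k n)))\<bar> \<le> 3 * \<xi> * \<eta> / \<tau>"
            unfolding l_def by (rule *(2))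
        qed
        have L: "\<bar>L j - G n (real j / real (k n)) \<omega>\<bar> \<le> r / 4"
            if j: "1 \<le> j" "j \<le> k n" "exp (- (R + 1)) \<le> real j / real (k n)" for j
        proof -
          have j3: "\<tau> \<le> real j / real (k n)" using j by (simp add: \<tau>_def)
          have kk: "real (k n) / real (k n) = 1" using elim(3) by simp
          have k3: "\<tau> \<le> real (k n) / real (k n)" unfolding kk using \<tau> by simp
          note ej = exp_j[OF j(1,2) j3] and ek = exp_j[OF elim(3) order_refl k3]
          \<comment> \<open>The ratio is compared through \<open>b n\<close>. The expansion of the
            denominator, at index \<open>k n\<close> and hence \<open>t = 1\<close>, supplies the
            subtracted \<open>\<alpha> n 1\<close> in \<open>G\<close>.\<close>
          have lnd: "ln (desc_order_stat X n j \<omega> / desc_order_stat X n (k n) \<omega>) =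
              ln (desc_order_stat X n j \<omega> / b n) - ln (desc_order_stat X n (k n) \<omega> / b n)"
            using ej(1) ek(1) elim(2) by (simp add: ln_div)
          have "L j = l j - l (k n)" unfolding L_def l_def kk lnd by (simp add: algebra_simps)
          moreover have "G n (real j / real (k n)) \<omega> =
              \<xi> * (\<alpha> n (real j / real (k n)) \<omega> / (real j / real (k n)))
                  - \<xi> * (\<alpha> n (real (k n) / real (k n)) \<omega> / (real (k n) / real (k n)))"
            unfolding kk G_def by (simp add: algebra_simps)
          moreover have "\<bar>(x - y) - (u - v)\<bar> \<le> 2 * c" if "\<bar>x - u\<bar> \<le> c" "\<bar>y - v\<bar> \<le> c"
              for x y u v c :: real
            using that by linarith
          ultimately have "\<bar>L j - G n (real j / real (k n)) \<omega>\<bar> \<le> 2 * (3 * \<xi> * \<eta> / \<tau>)"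
            using ej(2) ek(2) by presburger
          also have "\<dots> = 6 * (\<xi> * \<eta> / \<tau>)" by simp
          also have "\<dots> \<le> r / 4" unfolding \<eta>r using assms(2) by simp
          finally show ?thesis .
        qed
        have md: "\<bar>G n s \<omega> - G n t \<omega>\<bar> \<le> r / 4"
          if st: "s \<in> {exp (- (R + 1))..1}" "t \<in> {exp (- (R + 1))..1}" "\<bar>s - t\<bar> \<le> 1 / real m"
              for s t
        proof -
          note st' = st(1,2)[folded \<tau>_def]
          have "\<bar>\<alpha> n s \<omega> - \<alpha> n t \<omega>\<bar> \<le> \<eta>" using st' st(3) m(1) \<tau> by (intro mod[OF w]) auto
          from G_modulus[OF \<tau>(1) st' this Ab'[OF st'(2)] st(3) m(2)]
          have "\<bar>G n s \<omega> - G n t \<omega>\<bar> \<le> 2 * (\<xi> * \<eta> / \<tau>)" by simp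
          also have "\<dots> \<le> r / 4" unfolding \<eta>r using assms(2) by simp
          finally show ?thesis .
        qed
        have "(1 + \<xi>) * (1 / real m) + 2 * (r / 4) < r" using m(3) by linarith
        from discrete_fell_close_skeleton[where g = "\<lambda>t. G n t \<omega>"
            and L = L, OF xi assms(1) m(4,5) md L elim(3) km this]
        show ?thesis unfolding QN_seq_def L_def by simp
      qed
      then show ?case using E by blast
    qed
  qed
qed

text \<open>An interchange of limits: \<open>lim1\<close> lets \<open>n\<close> grow for a fixed
  skeleton, \<open>lim2\<close> refines the skeleton of the limit set, and \<open>lim3\<close>
  compares the plot with its skeleton for all large \<open>n\<close> once \<open>m\<close> is large.
  A single large \<open>m\<close> then serves all three.\<close>

theorem QN_converges_weakly:
  assumes B: "brownian_bridge N B"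
  shows "rcs_converges_weakly M (QN_seq \<xi> k X) N (QN_limit \<xi> B)"
  unfolding rcs_converges_weakly_def weak_conv_law_def
proof (intro conjI allI impI)
  interpret N: prob_space N using B by (simp add: brownian_bridge_def)
  have rM: "random_closed_set M (QN_seq \<xi> k X n)" for n
    by (rule QN_seq_random_closed_set[OF rvX])
  then show "random_closed_set M (QN_seq \<xi> k X n)" for n .
  have rN: "random_closed_set N (QN_limit \<xi> B)" by (rule QN_limit_random_closed_set[OF B])
  then show "random_closed_set N (QN_limit \<xi> B)" .
  fix f :: "(real \<times> real) set \<Rightarrow> real"
  assume "continuous_map fell_topology euclideanreal f \<and> bounded (f ` topspace fell_topology)"
  then have f: "continuous_map fell_topology euclideanreal f" and "bounded (f ` {C. closed C})"
    by (auto simp: topspace_fell_topology)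
  then obtain K where K: "\<And>C. closed C \<Longrightarrow> \<bar>f C\<bar> \<le> K" by (auto simp: bounded_iff)
  have K0: "K \<ge> 0" using K[OF closed_empty] by linarith
  note fm = measurable_fell_continuous[OF f]
  have Zm: "QN_seq \<xi> k X n \<in> measurable M (borel_measure_of fell_topology)" for n
    using rM by (simp add: random_closed_set_def)
  have Z'm: "QN_limit \<xi> B \<in> measurable N (borel_measure_of fell_topology)"
    using rN by (simp add: random_closed_set_def)
  have [measurable]: "(\<lambda>\<omega>. f (QN_seq \<xi> k X n \<omega>)) \<in> borel_measurable M" for n
    by (rule measurable_compose[OF Zm fm])
  have [measurable]: "(\<lambda>\<omega>. f (QN_limit \<xi> B \<omega>)) \<in> borel_measurable N"
    by (rule measurable_compose[OF Z'm fm])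
  define V where "V m n \<omega> i = G n (exp (- (real i / real m))) \<omega>" for m n :: nat and \<omega> and i :: nat
  define g where "g \<omega> t = \<xi> * inverse t * B t \<omega>" for \<omega> t
  define W where "W m \<omega> i = g \<omega> (exp (- (real i / real m)))" for m :: nat and \<omega> and i :: nat
  have gm[measurable]: "(\<lambda>\<omega>. g \<omega> (exp (- (real i / real m)))) \<in> borel_measurable N" for i m :: nat
  proof -
    have [measurable]: "B (exp (- (real i / real m))) \<in> borel_measurable N"
      using B by (auto simp: brownian_bridge_def gaussian_process_def)
    show ?thesis unfolding g_def by measurable
  qed
  have Vm: "(\<lambda>\<omega>. V m n \<omega> i) \<in> borel_measurable M" for m n i unfolding V_def by measurable
  have Wm: "(\<lambda>\<omega>. W m \<omega> i) \<in> borel_measurable N" for m i unfolding W_def by measurable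
  define h where "h m v = f (skeleton \<xi> m v)" for m v
  have hc: "continuous_on UNIV (h m)" for m
    unfolding h_def[abs_def] by (rule skeleton_continuous[OF f])
  have [measurable]: "h m \<in> borel_measurable borel" for m
    by (rule borel_measurable_continuous_onI[OF hc])
  have [measurable]: "V m n \<in> borel_measurable M" for m n
    by (rule measurable_coordinatewise_then_product[OF Vm])
  have [measurable]: "W m \<in> borel_measurable N" for m
    by (rule measurable_coordinatewise_then_product[OF Wm])
  have hK: "\<bar>h m v\<bar> \<le> K" for m v unfolding h_def by (rule K[OF closed_skeleton])
  have lim1: "(\<lambda>n. expectation (\<lambda>\<omega>. h m (V m n \<omega>))) \<longlonglongrightarrow> N.expectation (\<lambda>\<omega>. h m (W m \<omega>))"
      if m: "m \<ge> 1" for m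
  proof (rule multivariate_levy_continuity[where m =
      "m * m + 1", OF prob_space_axioms N.prob_space_axioms Vm Wm _ _ hc _ hK])
    define t where "t i = exp (- (real i / real m))" for i :: nat
    have t: "0 < t i \<and> t i \<le> 1" for i by (simp add: t_def)
    fix a :: "nat \<Rightarrow> real"
    \<comment> \<open>The factor \<open>\<xi> / t i\<close> moves into the coefficients, so that
      both sides lead to the same quadratic form.\<close>
    have "N.expectation (\<lambda>\<omega>. iexp (\<Sum>i<m * m + 1. a i * W m \<omega> i)) =
        N.expectation (\<lambda>\<omega>. iexp (\<Sum>i<m * m + 1. (a i * \<xi> / t i) * B (t i) \<omega>))"
      by (simp add: W_def g_def t_def divide_inverse mult.assoc)
    also have "\<dots> = complex_of_real (exp (- (\<Sum>i<m * m + 1. \<Sum>j<m * m + 1. (a i * \<xi> / t i)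
        * (a j * \<xi> / t j) * (min (t i) (t j) - t i * t j)) / 2))"
    proof (rule brownian_bridge_iexp[OF B])
      show "t i \<in> {0..1}" for i using t[of i] by simp
      show "inj_on t {..<m * m + 1}" using m by (auto simp: inj_on_def t_def)
    qed
    finally show "(\<lambda>n. expectation (\<lambda>\<omega>. iexp (\<Sum>i<m * m + 1. a i * V m n \<omega> i)))
        \<longlonglongrightarrow> N.expectation (\<lambda>\<omega>. iexp (\<Sum>i<m * m + 1. a i * W m \<omega> i))"
      using G_iexp_tendsto[where t = t and m = "m * m + 1" and a = a] t by (simp only: V_def t_def)
  next
    fix \<epsilon> :: real assume e: "\<epsilon> > 0"
    \<comment> \<open>The grid times \<open>exp (- (i / m))\<close> with
      \<open>i \<le> m * m\<close> are at least \<open>exp (- m)\<close>; for fixed \<open>m\<close>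
      the process is evaluated away from 0 only.\<close>
    define c where "c = exp (- real m)"
    have c: "0 < c" "c \<le> 1" by (auto simp: c_def)
    obtain \<delta> A where good: "eventually (\<lambda>n. \<exists>E\<in>events. prob E \<le> \<epsilon> \<and>
      (\<forall>\<omega>\<in>space M - E. (\<forall>x\<in>{c..1}. \<bar>\<alpha> n x \<omega>\<bar> \<le> A) \<and>
        (\<forall>x\<in>{c..1}. \<forall>y\<in>{c..1}. \<bar>x - y\<bar> \<le> \<delta> \<longrightarrow> \<bar>\<alpha> n x \<omega> - \<alpha> n y \<omega>\<bar> \<le> 1))) sequentially"
      using \<alpha>_bounded_equicontinuous[OF c(1) zero_less_one e, of 1] by blast
    have "eventually (\<lambda>n. prob {\<omega>\<in>space M. \<exists>i<m * m + 1. \<bar>V m n \<omega> i\<bar> > \<xi> * (A / c + A)}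
        \<le> \<epsilon>) sequentially"
      using good
    proof eventually_elim
      case (elim n)
      then obtain E where E: "E \<in> events" "prob E \<le> \<epsilon>"
          and Ab: "\<And>\<omega> x. \<omega> \<in> space M - E \<Longrightarrow> x \<in> {c..1} \<Longrightarrow> \<bar>\<alpha> n x \<omega>\<bar> \<le> A"
        by blast
      have "\<bar>V m n \<omega> i\<bar> \<le> \<xi> * (A / c + A)" if w: "\<omega> \<in> space M - E" and i: "i < m * m + 1" for \<omega> i
      proof -
        define t where "t = exp (- (real i / real m))"
        have "i \<le> m * m" using i by simp
        then have "real i \<le> real m * real m" by (simp flip: of_nat_mult)
        then have "real i / real m \<le> real m" using m by (simp add: pos_divide_le_eq)
        then have t: "c \<le> t" "t \<le> 1" by (auto simp: t_def c_def)
        have "\<bar>\<alpha> n t \<omega>\<bar> \<le> A" "\<bar>\<alpha> n 1 \<omega>\<bar> \<le> A" using Ab[OF w] t c by auto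
        then have "\<bar>\<alpha> n t \<omega> / t\<bar> \<le> A / c" using t c by (auto simp: abs_divide intro!: frac_le)
        then have "\<bar>\<alpha> n t \<omega> / t - \<alpha> n 1 \<omega>\<bar> \<le> A / c + A" using \<open>\<bar>\<alpha> n 1 \<omega>\<bar> \<le> A\<close> by linarith
        then show ?thesis using xi by (simp add: V_def G_def t_def[symmetric] abs_mult)
      qed
      then have "{\<omega>\<in>space M. \<exists>i<m * m + 1. \<bar>V m n \<omega> i\<bar> > \<xi> * (A / c + A)} \<subseteq> E" by force
      then have "prob {\<omega>\<in>space M. \<exists>i<m * m + 1. \<bar>V m n \<omega> i\<bar> > \<xi> * (A / c + A)} \<le> prob E"
        using E(1) by (rule finite_measure_mono)
      then show ?case using E(2) by simp
    qed
    then show "\<exists>P. eventually (\<lambda>n. prob {\<omega>\<in>space M. \<exists>i<m * m + 1. \<bar>V m n \<omega> i\<bar> > P}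
        \<le> \<epsilon>) sequentially" by blast
  next
    fix v w :: "nat \<Rightarrow> real" assume "\<And>i. i < m * m + 1 \<Longrightarrow> v i = w i"
    then have "skeleton \<xi> m v = skeleton \<xi> m w" unfolding skeleton_def by (intro image_cong) auto
    then show "h m v = h m w" by (simp add: h_def)
  qed
  have lim2: "(\<lambda>m. N.expectation (\<lambda>\<omega>. h m (W m \<omega>))) \<longlonglongrightarrow> N.expectation (\<lambda>\<omega>. f (QN_limit \<xi> B \<omega>))"
  proof (rule integral_dominated_convergence[where w = "\<lambda>_. K"])
    \<comment> \<open>The approximation of the limit set is pathwise: a continuous path is uniformly
      continuous on \<open>{exp (- (R + 1))..1}\<close>, and boundedness of \<open>f\<close> gives
      the dominating constant.\<close>
    show "AE \<omega> in N. (\<lambda>m. h m (W m \<omega>)) \<longlonglongrightarrow> f (QN_limit \<xi> B \<omega>)"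
    proof (rule AE_I2, rule tendstoI)
      fix \<omega> and e :: real assume w: "\<omega> \<in> space N" and e: "e > 0"
      obtain R0 r where r: "r > 0"
        and close: "\<forall>C C'. closed C \<longrightarrow> closed C' \<longrightarrow> fell_close R0 r C C' \<longrightarrow> \<bar>f C - f C'\<bar> < e"
        using fell_uniformly_continuous[OF f e] by (elim exE conjE)
      define R where "R = max R0 0"
      have "continuous_on {exp (- (R + 1))..1} (g \<omega>)"
        unfolding g_def by (rule continuous_on_subset[OF bridge_path_continuous[OF B w]])
            (auto intro: less_le_trans[OF exp_gt_zero])
      then have "uniformly_continuous_on {exp (- (R + 1))..1} (g \<omega>)"
        by (rule compact_uniformly_continuous) simp
      then obtain d where d: "d > 0"
        "\<And>s t. s \<in> {exp (- (R + 1))..1} \<Longrightarrow> t \<in> {exp (- (R + 1))..1} \<Longrightarrow> dist t s < d \<Longrightarrow>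
            dist (g \<omega> t) (g \<omega> s) < r / 2"
        using uniformly_continuous_onE[OF _ half_gt_zero[OF r]] by metis
      show "eventually (\<lambda>m. dist (h m (W m \<omega>)) (f (QN_limit \<xi> B \<omega>)) < e) sequentially"
        using eventually_div_nat_less[OF d(1), of 1] eventually_div_nat_less[OF
            half_gt_zero[OF r], of "1 + \<xi>"] eventually_ge_at_top[of
            "nat \<lceil>R\<rceil>"] eventually_ge_at_top[of 1]
      proof eventually_elim
        case (elim m)
        have "(1 + \<xi>) * (1 / real m) = (1 + \<xi>) / real m" by simp
        then have m: "(1 + \<xi>) * (1 / real m) + r / 2 < r" using elim(2) by linarith
        have m': "R \<le> real m" "0 \<le> R" using elim by (auto simp: nat_le_iff ceiling_le_iff R_def)
        have md: "\<bar>g \<omega> s - g \<omega> t\<bar> \<le> r / 2" if "s \<in> {exp (- (R + 1))..1}"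
            "t \<in> {exp (- (R + 1))..1}" "\<bar>s - t\<bar> \<le> 1 / real m" for s t
          using d(2)[OF that(2,1)] that(3) elim(1) by (simp add: dist_real_def)
        have "fell_close R r (QN_limit \<xi> B \<omega>) (skeleton \<xi> m (W m \<omega>))"
          using curve_fell_close_skeleton[OF xi m'(2,1) elim(4) md m r]
          unfolding QN_limit_eq W_def[abs_def] g_def[abs_def] .
        then have "fell_close R0 r (QN_limit \<xi> B \<omega>) (skeleton \<xi> m (W m \<omega>))"
          by (rule fell_close_mono) (auto simp: R_def)
        from close[rule_format, OF QN_limit_closed[OF B w] closed_skeleton this]
        show ?case by (simp add: h_def dist_real_def abs_minus_commute)
      qed
    qed
  qed (use hK in auto)
  have lim3: "eventually (\<lambda>m. eventually (\<lambda>n. \<bar>expectation (\<lambda>\<omega>. f (QN_seq \<xi> k X n \<omega>))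
      - expectation (\<lambda>\<omega>. h m (V m n \<omega>))\<bar> \<le> e) sequentially) sequentially"
    if e: "e > 0" for e
  proof -
    have e2: "e / 2 > 0" using e by simp
    obtain R0 r where r: "r > 0"
      and close: "\<forall>C C'. closed C \<longrightarrow> closed C' \<longrightarrow> fell_close R0 r C C' \<longrightarrow> \<bar>f C - f C'\<bar> < e / 2"
      using fell_uniformly_continuous[OF f e2] by (elim exE conjE)
    \<comment> \<open>On the exceptional event \<open>f\<close> is controlled by \<open>K\<close>
      alone; this choice makes its contribution \<open>2 * K * \<epsilon>\<close> at most
      \<open>e / 2\<close>.\<close>
    define \<epsilon> where "\<epsilon> = e / (4 * (K + 1))"
    have \<epsilon>: "\<epsilon> > 0" using e K0 by (simp add: \<epsilon>_def)
    have "2 * K * \<epsilon> \<le> 2 * (K + 1) * \<epsilon>" using \<epsilon> by (intro mult_right_mono) auto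
    also have "\<dots> = e / 2" using K0 by (simp add: \<epsilon>_def field_simps)
    finally have K\<epsilon>: "2 * K * \<epsilon> \<le> e / 2" .
    have "max R0 0 \<ge> 0" by simp
    from QN_seq_approx[OF this r \<epsilon>] show ?thesis
    proof eventually_elim
      case (elim m)
      then show ?case
      proof eventually_elim
        case (elim n)
        then obtain E where E: "E \<in> events" "prob E \<le> \<epsilon>"
          and cl: "\<And>\<omega>. \<omega> \<in> space M - E \<Longrightarrow> fell_close (max R0 0) r (QN_seq \<xi> k X n \<omega>)
              (skeleton \<xi> m (V m n \<omega>))"
          unfolding V_def by blast
        have "\<bar>expectation (\<lambda>\<omega>. f (QN_seq \<xi> k X n \<omega>)) - expectation (\<lambda>\<omega>. h m (V m n \<omega>))\<bar>
            \<le> e / 2 + 2 * K * prob E"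
        proof (rule expectation_diff_le[OF _ _ E(1)])
          fix \<omega> assume w: "\<omega> \<in> space M - E"
          have "fell_close R0 r (QN_seq \<xi> k X n \<omega>) (skeleton \<xi> m (V m n \<omega>))"
            using cl[OF w] by (rule fell_close_mono) auto
          from close[rule_format, OF closed_QN_seq closed_skeleton this]
          show "\<bar>f (QN_seq \<xi> k X n \<omega>) - h m (V m n \<omega>)\<bar> \<le> e / 2" by (simp add: h_def)
        qed (use K[OF closed_QN_seq] hK e in auto)
        also have "2 * K * prob E \<le> 2 * K * \<epsilon>" using E(2) K0 by (intro mult_left_mono) auto
        finally show ?case using K\<epsilon> by simp
      qed
    qed
  qed
  have "(\<lambda>n. expectation (\<lambda>\<omega>. f (QN_seq \<xi> k X n \<omega>))) \<longlonglongrightarrow> N.expectation (\<lambda>\<omega>. f (QN_limit \<xi> B \<omega>))"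
  proof (rule tendstoI)
    fix e :: real assume "e > 0"
    then have e3: "e / 3 > 0" by simp
    have "eventually (\<lambda>m. m \<ge> 1 \<and> dist (N.expectation (\<lambda>\<omega>. h m (W m \<omega>)))
        (N.expectation (\<lambda>\<omega>. f (QN_limit \<xi> B \<omega>))) < e / 3 \<and>
      eventually (\<lambda>n. \<bar>expectation (\<lambda>\<omega>. f (QN_seq \<xi> k X n \<omega>)) - expectation (\<lambda>\<omega>. h m (V m n \<omega>))\<bar>
          \<le> e / 3) sequentially) sequentially"
      using eventually_ge_at_top[of 1] tendstoD[OF lim2 e3] lim3[OF e3] by eventually_elim auto
    then obtain m where m: "m \<ge> 1" "dist (N.expectation (\<lambda>\<omega>. h m (W m \<omega>)))
        (N.expectation (\<lambda>\<omega>. f (QN_limit \<xi> B \<omega>))) < e / 3"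
      "eventually (\<lambda>n. \<bar>expectation (\<lambda>\<omega>. f (QN_seq \<xi> k X n \<omega>)) - expectation (\<lambda>\<omega>. h m (V m n \<omega>))\<bar>
          \<le> e / 3) sequentially"
      using eventually_happens'[OF sequentially_bot] by blast
    show "eventually (\<lambda>n. dist (expectation (\<lambda>\<omega>. f (QN_seq \<xi> k X n \<omega>)))
        (N.expectation (\<lambda>\<omega>. f (QN_limit \<xi> B \<omega>))) < e) sequentially"
      using m(3) tendstoD[OF lim1[OF m(1)] e3]
    proof eventually_elim
      case (elim n)
      then show ?case using m(2) unfolding dist_real_def by linarith
    qed
  qed
  then show "(\<lambda>n. \<integral>C. f C \<partial>distr M (borel_measure_of fell_topology) (QN_seq \<xi> k X n))
      \<longlonglongrightarrow> (\<integral>C. f C \<partial>distr N (borel_measure_of fell_topology) (QN_limit \<xi> B))"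
    by (simp add: integral_distr[OF Zm fm] integral_distr[OF Z'm fm])
qed

end

theorem theorem3p3:
  fixes \<xi> :: real
    and D :: "real measure"
    and F :: "real \<Rightarrow> real"
    and k :: "nat \<Rightarrow> nat"
    and M :: "'v measure"
    and X :: "nat \<Rightarrow> 'v \<Rightarrow> real"
    and N :: "'w measure"
    and B :: "real \<Rightarrow> 'w \<Rightarrow> real"
  assumes "\<xi> > 0"
    and "real_distribution D" and "F = cdf D"
    and "regularly_varying (- 1 / \<xi>) (\<lambda>x. 1 - F x)"
    and "\<forall>n\<ge>1. k n \<ge> 1" and "mono_on {1..} k" and "filterlim k at_top sequentially"
    and "(\<lambda>n. real (k n) / real n) \<longlonglongrightarrow> 0"
    and "\<forall>K. compact K \<and> K \<subseteq> {0<..} \<longrightarrow>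
           uniform_limit K
             (\<lambda>n y. sqrt (real (k n)) *
                (real n / real (k n) *
                   (1 - F (quantile_fun F (real n / real (k n)) * y powr (- \<xi>))) - y))
             (\<lambda>y. 0) sequentially"
    and "prob_space M"
    and "prob_space.indep_vars M (\<lambda>i. borel) X {1..}"
    and "\<forall>i\<ge>1. distr M borel (X i) = D"
    and "brownian_bridge N B"
  shows "rcs_converges_weakly M (QN_seq \<xi> k X) N (QN_limit \<xi> B)"
proof -
  interpret M: prob_space M by fact
  interpret D: real_distribution D by fact
  \<comment> \<open>The right-continuous \<open>F\<close> leaves the open half-line as its
    complement, which is the form of the tail in \<open>tail_sample\<close>.\<close>
  have tail: "1 - F x = measure D {x<..}" for x
  proof -
    have "measure D {x<..} = 1 - measure D {..x}"
      using D.prob_compl[of "{..x}"] by (simp add: Compl_eq_Diff_UNIV[symmetric] not_le)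
    then show ?thesis using assms(3) by (simp add: cdf_def)
  qed
  interpret tail_sample M X D \<xi> k "\<lambda>n. quantile_fun F (real n / real (k n))"
  proof
    show "M.indep_vars (\<lambda>_. borel) X {1..}" by fact
    show "\<And>K. compact K \<Longrightarrow> K \<subseteq> {0<..} \<Longrightarrow>
      uniform_limit K (\<lambda>n y. sqrt (real (k n)) * (real n / real (k n) *
        measure D {quantile_fun F (real n / real (k n)) * y powr - \<xi><..} - y)) (\<lambda>y. 0) sequentially"
      using assms(9) unfolding tail by blast
  qed (use assms in auto)
  show ?thesis by (rule QN_converges_weakly[OF assms(13)])
qed

end
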